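(* Fix $\varepsilon_0>0$, and write $\mathbb{R}^{n\times 2}$ for the set of (ordered) $n$-tuples of points $(\mathbf{x}_1,\ldots,\mathbf{x}_n)$ in $\mathbb{R}^2$. For any $X\in\mathbb{R}^{n\times 2}$, let $\mathcal{B}_\varepsilon(X)$ and $\tilde{\mathcal{D}}_\varepsilon(X)$ be the $\varepsilon$-birth content and the edge-relaxed $\varepsilon$-death content of the most persistent degree-$1$ bar $[b,d)$ in the Vietoris–Rips persistence diagram of $X$ (or zero if no such bar exists), where $\varepsilon:=\varepsilon_0(d-b)$. Let $\mathcal{P}:\mathbb{R}^{n\times 2}\to[0,\infty)$ be any differentiable penalty function which is invariant under linear isometries of $\mathbb{R}^2$ and such that for any $X\in\mathbb{R}^{n\times 2}$ which is not all zero, $$\lim_{t_0\to\infty}\frac{d}{dt}\mathcal{P}(t\cdot t_0\cdot X)=\infty,\qquad \lim_{t_0\to 0}\frac{d}{dt}\mathcal{P}(t\cdot t_0\cdot X)=0.$$ Consider the loss function $\mathcal{L}:\mathbb{R}^{n\times 2}\to\mathbb{R}$ given by $$\mathcal{L}(X)=-\left(\tilde{\mathcal{D}}_\varepsilon(X)-\mathcal{B}_\varepsilon(X)\right)+\mathcal{P}(X).$$ Then there is a regular polygon centered at the origin whose vertices $\hat X$ are a critical point of $\mathcal{L}$, assuming that $\varepsilon$ is generic at $\hat X$.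
   Context: (Co)homology has real coefficients. $\mathrm{C}^k(X)$ is the space of real-valued functions on the $k$-simplices of a finite simplicial complex $X$, with the standard $\ell_1$ and $\ell_2$ norms; $\delta^k_X$ is the coboundary operator; $X^k$ is the set of $k$-simplices of $X$. Vietoris–Rips filtration of a point cloud $X=(\mathbf{x}_1,\dots,\mathbf{x}_n)$: $X_t=\mathrm{VR}(X;t)$ consists of all subsets $\sigma$ of the points with $f(\sigma):=\max_{x,y\in\sigma}\|x-y\|_2\le t$. Write $\mathsf{Im} f$ for the set of values of $f$, i.e. the set of distances between points. Persistent cohomology class: inclusions $X_s\subseteq X_t$ induce maps $\mathrm{H}^k(X_t)\to \mathrm{H}^k(X_s)$, giving a persistence module that decomposes as a direct sum of interval modules on half-open intervals (bars) $[b,d)$; the multiset of bars is the degree-$k$ persistence diagram. The persistent cohomology class $c$ of a bar $[b,d)$ is the family of nonzero classes $\{c_t\in \mathrm{H}^k(X_t)\}_{t\in[b,d)}$ (up to scalar multiplication) associated to the corresponding interval module, so that $c_t\mapsto c_s$ for $b\le s<t<d$. The most persistent bar is the one with largest $d-b$. Birth/death cochains for a pair $K\subseteq L$: if $[\alpha]_L\in \mathrm{H}^k(L)$ restricts to zero in $\mathrm{H}^k(K)$, its birth cochain from $K$ to $L$ is the unique $\ell_2$-norm minimizer among cochains $\alpha'\in[\alpha]_L$ with $\alpha'|_K=0$. If $[\beta]_K\in \mathrm{H}^k(K)$ is such that $\beta$ cannot be extended to a $k$-cocycle on $L$, its death cochain from $K$ to $L$ is $\delta_L^k\hat\beta$,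 where $\hat\beta\in \mathrm{C}^k(L)$ is any minimizer of $\|\delta_L^k\beta'\|_2$ subject to $\beta'|_K=\beta$ (this is well defined). For $0<\varepsilon<d-b$, the $\varepsilon$-birth cochain $\eta$ of $c$ is the birth cochain of $c_{b+\varepsilon}$ from $X_{b-\varepsilon}$ to $X_{b+\varepsilon}$; the $\varepsilon$-death cochain $\omega$ of $c$ is the death cochain of $c_{d-\varepsilon}$ from $X_{d-\varepsilon}$ to $X_{d+\varepsilon}$. Contents (degree $k=1$): the $\varepsilon$-birth content of the bar is $\sum_{\sigma\in X^1_{b+\varepsilon}} f(\sigma)\,|\eta(\sigma)|/\|\eta\|_1$. The edge-relaxed $\varepsilon$-death content is $\sum_{\sigma\in X^{2}_{d+\varepsilon}} \tilde f(\sigma)\,|\omega(\sigma)|/\|\omega\|_1$, where $\tilde f(\sigma)$ is the mean of $f(\tau)$ over all edges $\tau\subseteq\sigma$ with $\tau\in X^1_{d+\varepsilon}\setminus X^1_{d-\varepsilon}$. Linear isometries of $\mathbb{R}^2$ act on $\mathbb{R}^{n\times 2}$ by being applied to each of the $n$ points simultaneously. Generic: given an $\varepsilon$ used to calculate the birth and death content for a bar $[b,d)$ associated to a filtration function $f$, $\varepsilon$ is generic if $\{b-\varepsilon,b+\varepsilon,d-\varepsilon,d+\varepsilon\}\cap\mathsf{Im} f=\varnothing$.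
   Formalization: The penalty P is also assumed invariant under permuting the n points (the claim fails for n=4, P=Σ w_i|x_i|² with distinct w_i>0); d/dt P(t·t0·X) is read as the derivative of t↦P(tX) at t=t0; ε0<1 and n≥3 are made explicit. *)

theory Defs
  imports "HOL-Analysis.Analysis"
begin

text \<open>
  A configuration of \<open>n\<close> points in the plane is an element of \<open>real ^ 2 ^ 'n\<close> with \<open>n = CARD('n)\<close>;
  simplices are nonempty sets of point labels. The linear order on \<open>'n\<close> is the order of the
  tuple. It fixes the orientations (signs) in the coboundary operator.
\<close>

type_synonym 'n config = "real ^ 2 ^ 'n"

text \<open>
  A cochain is a vector indexed by all subsets of the label set that vanishes outside the
  \<open>k\<close>-simplices of the complex in question; thus \<^const>\<open>norm\<close> is the \<open>\<ell>\<^sub>2\<close>-norm of cochains.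
\<close>

type_synonym 'n cochain = "real ^ 'n set"

definition simplices :: "'n set set \<Rightarrow> nat \<Rightarrow> 'n set set" where
  "simplices K k = {\<sigma> \<in> K. card \<sigma> = k + 1}"

definition cochains :: "'n::finite set set \<Rightarrow> nat \<Rightarrow> 'n cochain set" where
  "cochains K k = {\<alpha>. \<forall>\<sigma>. \<sigma> \<notin> simplices K k \<longrightarrow> \<alpha> $ \<sigma> = 0}"

definition coboundary :: "'n::{finite,linorder} set set \<Rightarrow> nat \<Rightarrow> 'n cochain \<Rightarrow> 'n cochain" where
  "coboundary K k \<alpha> = (\<chi> \<sigma>. if \<sigma> \<in> simplices K (k + 1)
     then \<Sum>v\<in>\<sigma>. (- 1) ^ card {u \<in> \<sigma>. u < v} * \<alpha> $ (\<sigma> - {v}) else 0)"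

definition cocycles :: "'n::{finite,linorder} set set \<Rightarrow> nat \<Rightarrow> 'n cochain set" where
  "cocycles K k = {\<alpha> \<in> cochains K k. coboundary K k \<alpha> = 0}"

definition coboundaries :: "'n::{finite,linorder} set set \<Rightarrow> nat \<Rightarrow> 'n cochain set" where
  "coboundaries K k = (case k of 0 \<Rightarrow> {0} | Suc j \<Rightarrow> coboundary K j ` cochains K j)"

definition coh_class :: "'n::{finite,linorder} set set \<Rightarrow> nat \<Rightarrow> 'n cochain \<Rightarrow> 'n cochain set" where
  "coh_class K k \<alpha> = {\<alpha>' \<in> cochains K k. \<alpha>' - \<alpha> \<in> coboundaries K k}"

definition restr :: "'n::finite set set \<Rightarrow> 'n cochain \<Rightarrow> 'n cochain" where
  "restr K \<alpha> = (\<chi> \<sigma>. if \<sigma> \<in> K then \<alpha> $ \<sigma> else 0)"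

definition l1_norm :: "'n::finite cochain \<Rightarrow> real" where
  "l1_norm \<alpha> = (\<Sum>\<sigma>\<in>UNIV. \<bar>\<alpha> $ \<sigma>\<bar>)"

definition diam :: "'n::finite config \<Rightarrow> 'n set \<Rightarrow> real" where
  "diam X \<sigma> = Max {dist (X $ i) (X $ j) | i j. i \<in> \<sigma> \<and> j \<in> \<sigma>}"

definition VR :: "'n::finite config \<Rightarrow> real \<Rightarrow> 'n set set" where
  "VR X t = {\<sigma>. \<sigma> \<noteq> {} \<and> diam X \<sigma> \<le> t}"

text \<open>
  A decomposition of the persistence module \<open>H\<^sup>k(F t)\<close> (with the restriction maps) into interval
  modules on \<open>[b i, d i)\<close>, \<open>i \<in> I\<close>: \<open>z i t\<close> is a cocycle representing the generator at time \<open>t\<close>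
  of the \<open>i\<close>-th summand. The last clause says that the classes alive at time \<open>t\<close> form a basis of
  \<open>H\<^sup>k(F t)\<close>. All deaths are finite, which is the case for the Vietoris--Rips filtration
  in degrees \<open>k \<ge> 1\<close> since \<open>VR X t\<close> is a full simplex for large \<open>t\<close>.
\<close>

definition interval_decomposition ::
  "(real \<Rightarrow> 'n::{finite,linorder} set set) \<Rightarrow> nat \<Rightarrow>
   nat set \<Rightarrow> (nat \<Rightarrow> real) \<Rightarrow> (nat \<Rightarrow> real) \<Rightarrow> (nat \<Rightarrow> real \<Rightarrow> 'n cochain) \<Rightarrow> bool" where
  "interval_decomposition F k I b d z \<longleftrightarrow>
     finite I \<and> (\<forall>i\<in>I. b i < d i) \<and>
     (\<forall>i\<in>I. \<forall>t\<in>{b i..<d i}. z i t \<in> cocycles (F t) k) \<and>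
     (\<forall>i\<in>I. \<forall>t\<in>{b i..<d i}. \<forall>s\<le>t.
        restr (F s) (z i t) - (if b i \<le> s then z i s else 0) \<in> coboundaries (F s) k) \<and>
     (\<forall>t. \<forall>\<alpha>\<in>cocycles (F t) k. \<exists>!a :: nat \<Rightarrow> real.
        (\<forall>i. \<not> (i \<in> I \<and> t \<in> {b i..<d i}) \<longrightarrow> a i = 0) \<and>
        \<alpha> - (\<Sum>i\<in>{i \<in> I. t \<in> {b i..<d i}}. a i *\<^sub>R z i t) \<in> coboundaries (F t) k)"

text \<open>
  \<open>[b, d)\<close> is a bar of maximal length in the degree-1 diagram of \<open>X\<close>, and \<open>z t\<close>, \<open>b \<le> t < d\<close>,
  are representatives of its persistent cohomology class. Neither the bar (in case of ties) nor
  the class (which depends on the decomposition) is unique in general.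
\<close>

definition most_persistent_bar ::
  "'n::{finite,linorder} config \<Rightarrow> real \<Rightarrow> real \<Rightarrow> (real \<Rightarrow> 'n cochain) \<Rightarrow> bool" where
  "most_persistent_bar X b d z \<longleftrightarrow>
     (\<exists>I bs ds zs i. interval_decomposition (VR X) 1 I bs ds zs \<and> i \<in> I \<and>
        b = bs i \<and> d = ds i \<and> z = zs i \<and> (\<forall>j\<in>I. ds j - bs j \<le> d - b))"

definition has_bar :: "'n::{finite,linorder} config \<Rightarrow> bool" where
  "has_bar X \<longleftrightarrow> (\<exists>b d z. most_persistent_bar X b d z)"

definition birth_cochain ::
  "'n::{finite,linorder} set set \<Rightarrow> 'n set set \<Rightarrow> nat \<Rightarrow> 'n cochain \<Rightarrow> 'n cochain" where
  "birth_cochain K L k \<alpha> = (THE \<eta>. \<eta> \<in> coh_class L k \<alpha> \<and> restr K \<eta> = 0 \<and>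
     (\<forall>\<alpha>'\<in>coh_class L k \<alpha>. restr K \<alpha>' = 0 \<longrightarrow> norm \<eta> \<le> norm \<alpha>'))"

definition death_cochain ::
  "'n::{finite,linorder} set set \<Rightarrow> 'n set set \<Rightarrow> nat \<Rightarrow> 'n cochain \<Rightarrow> 'n cochain" where
  "death_cochain K L k \<beta> = (THE \<omega>. \<exists>\<gamma>. \<gamma> \<in> cochains L k \<and> restr K \<gamma> = \<beta> \<and>
     (\<forall>\<beta>'\<in>cochains L k. restr K \<beta>' = \<beta> \<longrightarrow>
        norm (coboundary L k \<gamma>) \<le> norm (coboundary L k \<beta>')) \<and>
     \<omega> = coboundary L k \<gamma>)"

definition birth_content ::
  "'n::{finite,linorder} config \<Rightarrow> real \<Rightarrow> real \<Rightarrow> (real \<Rightarrow> 'n cochain) \<Rightarrow> real" where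
  "birth_content X \<epsilon> b z =
     (let \<eta> = birth_cochain (VR X (b - \<epsilon>)) (VR X (b + \<epsilon>)) 1 (z (b + \<epsilon>))
      in \<Sum>\<sigma>\<in>simplices (VR X (b + \<epsilon>)) 1. diam X \<sigma> * \<bar>\<eta> $ \<sigma>\<bar> / l1_norm \<eta>)"

definition relaxed_diam :: "'n::finite config \<Rightarrow> real \<Rightarrow> real \<Rightarrow> 'n set \<Rightarrow> real" where
  "relaxed_diam X \<epsilon> d \<sigma> =
     (let E = {\<tau>. \<tau> \<subseteq> \<sigma> \<and> \<tau> \<in> simplices (VR X (d + \<epsilon>)) 1 - simplices (VR X (d - \<epsilon>)) 1}
      in (\<Sum>\<tau>\<in>E. diam X \<tau>) / real (card E))"

definition relaxed_death_content ::
  "'n::{finite,linorder} config \<Rightarrow> real \<Rightarrow> real \<Rightarrow> (real \<Rightarrow> 'n cochain) \<Rightarrow> real" where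
  "relaxed_death_content X \<epsilon> d z =
     (let \<omega> = death_cochain (VR X (d - \<epsilon>)) (VR X (d + \<epsilon>)) 1 (z (d - \<epsilon>))
      in \<Sum>\<sigma>\<in>simplices (VR X (d + \<epsilon>)) 2. relaxed_diam X \<epsilon> d \<sigma> * \<bar>\<omega> $ \<sigma>\<bar> / l1_norm \<omega>)"

definition generic :: "'n::finite config \<Rightarrow> real \<Rightarrow> real \<Rightarrow> real \<Rightarrow> bool" where
  "generic X \<epsilon> b d \<longleftrightarrow>
     {b - \<epsilon>, b + \<epsilon>, d - \<epsilon>, d + \<epsilon>} \<inter> diam X ` {\<sigma>. \<sigma> \<noteq> {}} = {}"

text \<open>
  The points, in the order of their labels, are the successive vertices of a regular
  \<open>CARD('n)\<close>-gon centred at the origin; \<open>card {j. j < i}\<close> is the position of \<open>i\<close> in that order.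
\<close>

definition regular_polygon :: "'n::{finite,linorder} config \<Rightarrow> bool" where
  "regular_polygon X \<longleftrightarrow> CARD('n) \<ge> 3 \<and>
     (\<exists>r>0. \<exists>\<theta>. \<forall>i. X $ i =
        vector [r * cos (\<theta> + 2 * pi * real (card {j. j < i}) / real CARD('n)),
                r * sin (\<theta> + 2 * pi * real (card {j. j < i}) / real CARD('n))])"

end

theory Submission
  imports Defs
begin

text \<open>
  Near a regular polygon \<open>X\<close>, longer steps around the polygon still give strictly longer edges. Adding
  edges in that order, the first cohomology appears when the polygon closes up and can only be killed
  afterwards: it is detected by the holonomy, the sum of a cocycle around the polygon. So there is at
  most one bar, it moves continuously, and if \<open>\<epsilon>\<close> is generic then all complexes entering the contents
  are constant near \<open>X\<close>. Up to a scalar the birth and death cochains are then constant as well, and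
  locally \<open>D - B\<close> is a fixed dihedrally invariant linear combination of edge lengths. Hence the gradient
  of \<open>L\<close> at \<open>X\<close> is radial, and it vanishes if the radial derivative of \<open>P\<close> equals the value \<open>\<kappa>\<close> of
  \<open>D - B\<close> on the unit polygon. As derivatives have the intermediate value property, some radius
  achieves this, provided that \<open>\<kappa> > 0\<close>.

  Positivity is immediate unless some edge that is new at time \<open>d + \<epsilon>\<close> is at most as long as the birth
  content. In that case the complex at \<open>d + \<epsilon>\<close> is the full simplex, the death cochain is explicit, and
  the claim reduces to comparing the mean distance between vertices with the birth content.
\<close>

section \<open>Cyclic positions\<close>

text \<open>The gradient at the polygon calls for a formula on an open set of configurations without
  symmetry, while the minimizing cochains are accessible only through symmetry. Two kinds of
  complexes bridge this: \<open>cyclic_complex\<close> keeps what survives a perturbation and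
  suffices to identify cohomology and the bar, while \<open>regular_complex\<close> is dihedrally
  invariant; the latter applies near the polygon because there, at the times that matter, the
  complexes are literally those of the polygon. The cocycle of a bar is an arbitrary choice, and the
  only thing retained of it is that its holonomy is nonzero.

  The explicit cocycle counts signed steps. It closes on triangles as long as three edges cannot go
  around the polygon, hence the recurring condition \<open>3 * cdist u v < CARD('n)\<close>, and by
  reflection symmetry it is divergence-free, that is, harmonic.

  The obstacle to positivity is that \<epsilon> may be almost as long as the bar. The intervals
  around birth and death then overlap, and edges counted at death can be shorter than edges counted
  at birth, so that no comparison edge by edge is possible.\<close>

definition pos :: "'n::{finite,linorder} \<Rightarrow> int" where
  "pos i = int (card {j. j < i})"

lemma pos_mono: "i < j \<Longrightarrow> pos i < pos (j::'n::{finite,linorder})"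
  unfolding pos_def by (auto intro!: psubset_card_mono)

lemma pos_less_iff: "pos i < pos j \<longleftrightarrow> i < (j::'n::{finite,linorder})"
  using pos_mono by (metis less_asym linorder_neqE)

lemma inj_pos: "inj (pos :: 'n::{finite,linorder} \<Rightarrow> int)"
  by (metis injI less_irrefl linorder_neqE pos_less_iff)

lemma pos_ge_0 [simp]: "0 \<le> pos i"
  by (simp add: pos_def)

lemma pos_less_card [simp]: "pos (i::'n::{finite,linorder}) < int CARD('n)"
  unfolding pos_def by (auto intro!: psubset_card_mono)

lemma bij_pos: "bij_betw pos (UNIV::'n::{finite,linorder} set) {0..<int CARD('n)}"
proof -
  have "pos ` (UNIV::'n set) = {0..<int CARD('n)}"
    by (rule card_subset_eq) (auto simp: card_image inj_pos)
  then show ?thesis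
    using inj_pos by (auto simp: bij_betw_def)
qed

text \<open>The argument is reduced modulo \<open>CARD('n)\<close>, so \<open>lab\<close> is a
  periodic inverse of \<open>pos\<close> on all integers and cyclic shifts of labels become
  additions.\<close>

definition lab :: "int \<Rightarrow> 'n::{finite,linorder}" where
  "lab x = inv_into UNIV pos (x mod int CARD('n))"

lemma pos_lab [simp]: "pos (lab x :: 'n::{finite,linorder}) = x mod int CARD('n)"
proof -
  have "x mod int CARD('n) \<in> pos ` (UNIV::'n set)"
    using bij_pos[where 'n='n] by (auto simp: bij_betw_def)
  then show ?thesis
    by (simp add: lab_def f_inv_into_f)
qed

lemma pos_mod [simp]: "pos (i::'n::{finite,linorder}) mod int CARD('n) = pos i"
  by simp

lemma lab_pos [simp]: "lab (pos i) = (i::'n::{finite,linorder})"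
  by (rule injD[OF inj_pos]) simp

lemma lab_eqI: "x mod int CARD('n) = pos (i::'n::{finite,linorder}) \<Longrightarrow> lab x = i"
  by (rule injD[OF inj_pos]) simp

definition gap :: "'n::{finite,linorder} \<Rightarrow> 'n \<Rightarrow> int" where
  "gap u v = (pos v - pos u) mod int CARD('n)"

lemma gap_ge_0 [simp]: "0 \<le> gap u v"
  by (simp add: gap_def)

lemma gap_less: "gap (u::'n::{finite,linorder}) v < int CARD('n)"
  by (simp add: gap_def)

lemma gap_refl [simp]: "gap u u = 0"
  by (simp add: gap_def)

lemma gap_eq_0_iff [simp]: "gap u v = 0 \<longleftrightarrow> u = (v::'n::{finite,linorder})"
proof
  assume "gap u v = 0"
  then have "pos v mod int CARD('n) = pos u mod int CARD('n)"
    unfolding gap_def by (metis mod_eq_dvd_iff mod_0_imp_dvd)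
  then show "u = v"
    using injD[OF inj_pos, of u v] by simp
qed simp

lemma gap_trans: "gap u w = (gap u v + gap v w) mod int CARD('n)"
  for u v w :: "'n::{finite,linorder}"
  unfolding gap_def by (simp add: mod_simps)

lemma gap_swap: "gap v u = (if u = v then 0 else int CARD('n) - gap u v)"
  for u v :: "'n::{finite,linorder}"
proof (cases "u = v")
  case False
  then have "gap u v \<noteq> 0" "gap v u \<noteq> 0" by auto
  moreover have "(gap u v + gap v u) mod int CARD('n) = 0"
    using gap_trans[of u u v] by simp
  moreover have "gap u v + gap v u < 2 * int CARD('n)"
    using gap_less[of u v] gap_less[of v u] by linarith
  ultimately have "gap u v + gap v u = int CARD('n)"
    using gap_ge_0[of u v] gap_ge_0[of v u]
    by (smt (verit) mod_pos_pos_trivial minus_mod_self2)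
  then show ?thesis using False by simp
qed simp

lemma gap_uminus: "gap v u = (- gap u v) mod int CARD('n)"
  for u v :: "'n::{finite,linorder}"
  unfolding gap_def by (simp add: mod_simps)

lemma gap_pos_lab: "gap u (lab (pos u + x)) = x mod int CARD('n)"
  for u :: "'n::{finite,linorder}"
  unfolding gap_def by (simp add: mod_simps)

lemma lab_pos_gap: "lab (pos u + gap u v) = (v::'n::{finite,linorder})"
  by (rule lab_eqI) (simp add: gap_def mod_simps)

lemma bij_gap: "bij_betw (gap u) (UNIV::'n::{finite,linorder} set) {0..<int CARD('n)}"
proof (rule bij_betw_byWitness[where f' = "\<lambda>x. lab (pos u + x)"])
qed (auto simp: gap_pos_lab lab_pos_gap gap_less)

lemma sum_gap: "(\<Sum>v\<in>UNIV. h (gap u v)) = (\<Sum>x\<in>{0..<int CARD('n)}. h x)"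
  for u :: "'n::{finite,linorder}"
  by (rule sum.reindex_bij_betw[OF bij_gap])

lemma bij_gap': "bij_betw (\<lambda>u. gap u v) (UNIV::'n::{finite,linorder} set) {0..<int CARD('n)}"
proof (rule bij_betw_byWitness[where f' = "\<lambda>x. lab (pos v - x)"])
qed (auto simp: gap_def mod_simps intro!: lab_eqI)

lemma sum_gap': "(\<Sum>u\<in>UNIV. h (gap u v)) = (\<Sum>x\<in>{0..<int CARD('n)}. h x)"
  for v :: "'n::{finite,linorder}"
  by (rule sum.reindex_bij_betw[OF bij_gap'])

text \<open>Distance in the cycle graph on the labels, which orders the edges of a regular polygon
  by length.\<close>

definition cdist :: "'n::{finite,linorder} \<Rightarrow> 'n \<Rightarrow> int" where
  "cdist u v = min (gap u v) (int CARD('n) - gap u v)"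

lemma cdist_commute: "cdist u v = cdist v u"
  unfolding cdist_def by (subst (1 2) gap_swap) (auto simp: min_def)

lemma cdist_refl [simp]: "cdist u u = 0"
  by (simp add: cdist_def)

lemma cdist_ge_0 [simp]: "0 \<le> cdist u v"
  using gap_less[of u v] by (simp add: cdist_def del: gap_less)

lemma cdist_eq_0_iff [simp]: "cdist u v = 0 \<longleftrightarrow> u = v"
  using gap_less[of u v] gap_ge_0[of u v] gap_eq_0_iff[of u v] unfolding cdist_def min_def
  by (smt (verit))

lemma cdist_half: "2 * cdist (u::'n::{finite,linorder}) v \<le> int CARD('n)"
  by (simp add: cdist_def min_def)

text \<open>Zero for antipodal labels, so that it is antisymmetric.\<close>

definition sstep :: "'n::{finite,linorder} \<Rightarrow> 'n \<Rightarrow> real" where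
  "sstep u v = (if 2 * gap u v < int CARD('n) then of_int (gap u v)
     else if 2 * gap u v > int CARD('n) then of_int (gap u v - int CARD('n)) else 0)"

lemma sstep_swap: "sstep v u = - sstep u v"
  unfolding sstep_def by (subst (1 2 3 4) gap_swap[of v u]) auto

lemma sstep_refl [simp]: "sstep u u = 0"
  by (simp add: sstep_def)

lemma abs_sstep: "2 * cdist u v < int CARD('n) \<Longrightarrow> \<bar>sstep u v\<bar> = of_int (cdist u v)"
  for u v :: "'n::{finite,linorder}"
  using gap_less[of u v] by (auto simp: sstep_def cdist_def min_def simp del: gap_less)

definition rot :: "'n::{finite,linorder} \<Rightarrow> 'n" where
  "rot i = lab (pos i + 1)"

definition flip :: "'n::{finite,linorder} \<Rightarrow> 'n" where
  "flip i = lab (- pos i)"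

lemma gap_rot: "2 \<le> CARD('n) \<Longrightarrow> gap u (rot u) = 1"
  for u :: "'n::{finite,linorder}"
  by (simp add: rot_def gap_pos_lab)

lemma rot_neq: "2 \<le> CARD('n) \<Longrightarrow> rot u \<noteq> u"
  for u :: "'n::{finite,linorder}"
  using gap_rot[of u] by (metis gap_refl zero_neq_one)

lemma gap_rot_rot [simp]: "gap (rot u) (rot v) = gap u v"
  by (simp add: rot_def gap_def mod_simps)

lemma gap_flip_flip [simp]: "gap (flip u) (flip v) = gap v u"
  by (simp add: flip_def gap_def mod_simps)

lemma cdist_rot_rot [simp]: "cdist (rot u) (rot v) = cdist u v"
  by (simp add: cdist_def)

lemma cdist_flip_flip [simp]: "cdist (flip u) (flip v) = cdist u v"
  by (subst (2) cdist_commute) (simp add: cdist_def)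

lemma sstep_rot_rot [simp]: "sstep (rot u) (rot v) = sstep u v"
  by (simp add: sstep_def)

lemma sstep_flip_flip [simp]: "sstep (flip u) (flip v) = - sstep u v"
  by (subst sstep_swap[of v u, symmetric]) (simp add: sstep_def)

lemma bij_rot: "bij (rot :: 'n::{finite,linorder} \<Rightarrow> 'n)"
proof -
  have "inj (rot :: 'n \<Rightarrow> 'n)"
    by (metis gap_rot_rot gap_eq_0_iff injI)
  then show ?thesis
    by (simp add: bij_def finite_UNIV_inj_surj)
qed

lemma bij_flip: "bij (flip :: 'n::{finite,linorder} \<Rightarrow> 'n)"
proof -
  have "inj (flip :: 'n \<Rightarrow> 'n)"
    by (metis gap_flip_flip gap_eq_0_iff injI)
  then show ?thesis
    by (simp add: bij_def finite_UNIV_inj_surj)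
qed

lemma cdist_rot: "3 \<le> CARD('n) \<Longrightarrow> cdist u (rot u) = 1"
  for u :: "'n::{finite,linorder}"
  by (simp add: cdist_def gap_rot min_def)

lemma gap_rot_left: "u \<noteq> v \<Longrightarrow> gap (rot u) v = gap u v - 1"
  for u v :: "'n::{finite,linorder}"
proof -
  assume "u \<noteq> v"
  then have "gap u v \<ge> 1"
    using gap_eq_0_iff[of u v] gap_ge_0[of u v] by linarith
  then have "(gap u v - 1) mod int CARD('n) = gap u v - 1"
    using gap_less[of u v] by (intro mod_pos_pos_trivial) auto
  moreover have "gap (rot u) v = (gap u v - 1) mod int CARD('n)"
    by (simp add: rot_def gap_def mod_simps algebra_simps)
  ultimately show ?thesis by simp
qed

lemma cdist_eq_1_imp: "cdist u v = 1 \<Longrightarrow> v = rot u \<or> u = rot v"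
  for u v :: "'n::{finite,linorder}"
proof -
  assume "cdist u v = 1"
  then have "gap u v = 1 \<or> gap v u = 1"
    using gap_swap[of u v] by (auto simp: cdist_def min_def split: if_splits)
  then show ?thesis
    by (metis lab_pos_gap rot_def)
qed

text \<open>Cutting the cycle at the edge that leaves \<open>i0\<close> turns it into a path, on
  which partial sums are a primitive; the total sum is the only obstruction to closing it up. The
  cut version serves complexes with a missing side, the closed one cocycles with zero
  holonomy.\<close>

lemma cyclic_primitive:
  fixes c :: "'n::{finite,linorder} \<Rightarrow> real" and i0 :: 'n
  assumes "2 \<le> CARD('n)"
  obtains g where "\<And>i. i \<noteq> i0 \<Longrightarrow> g (rot i) = g i + c i"
    and "sum c UNIV = 0 \<Longrightarrow> g (rot i0) = g i0 + c i0"
proof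
  \<comment> \<open>\<open>q\<close> numbers the labels along the path, beginning with
    \<open>rot i0\<close> and ending with \<open>i0\<close>.\<close>
  define q where "q i = gap (rot i0) i" for i
  define g where "g i = (\<Sum>j | q j < q i. c j)" for i
  have inj: "q i = q j \<longleftrightarrow> i = j" for i j
    unfolding q_def by (metis lab_pos_gap)
  have q0: "q (rot i0) = 0" by (simp add: q_def)
  have q_i0: "q i0 = int CARD('n) - 1"
    using gap_swap[of "rot i0" i0] gap_rot[OF assms, of i0] rot_neq[OF assms, of i0]
    by (simp add: q_def)
  have q_Suc: "q (rot i) = q i + 1" if "i \<noteq> i0" for i
  proof -
    have "q i \<noteq> int CARD('n) - 1" using that inj q_i0 by metis
    then have "q i + 1 < int CARD('n)" using gap_less[of "rot i0" i] by (simp add: q_def)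
    moreover have "q (rot i) = (q i + 1) mod int CARD('n)"
      by (simp add: q_def rot_def gap_def mod_simps algebra_simps)
    ultimately show ?thesis
      using gap_ge_0[of "rot i0" i] by (simp add: q_def)
  qed
  show "g (rot i) = g i + c i" if "i \<noteq> i0" for i
  proof -
    have "{j. q j < q (rot i)} = insert i {j. q j < q i}"
      using q_Suc[OF that] inj by (auto simp: less_le)
    then show ?thesis by (simp add: g_def add.commute)
  qed
  show "g (rot i0) = g i0 + c i0" if "sum c UNIV = 0"
  proof -
    have "q j < q i0 \<longleftrightarrow> j \<noteq> i0" for j
      using gap_less[of "rot i0" j] inj[of j i0] q_i0 unfolding q_def by linarith
    then have "{j. q j < q i0} = UNIV - {i0}"
      by auto
    then have "g i0 = - c i0"
      using that by (simp add: g_def sum_diff1)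
    moreover have "{j. q j < q (rot i0)} = {}"
      using q0 by (auto simp: q_def not_less)
    ultimately show ?thesis by (simp add: g_def)
  qed
qed

section \<open>Cochains and holonomy\<close>

text \<open>Values on oriented edges. The signs that come from the order of the labels are confined
  here, so that cyclic arguments, which do not respect that order, can rely on antisymmetry
  alone.\<close>

definition evl :: "'n::{finite,linorder} cochain \<Rightarrow> 'n \<Rightarrow> 'n \<Rightarrow> real" where
  "evl \<alpha> u v = (if u < v then \<alpha> $ {u, v} else if v < u then - (\<alpha> $ {u, v}) else 0)"

lemma evl_swap: "evl \<alpha> v u = - evl \<alpha> u v"
  by (auto simp: evl_def insert_commute)

lemma evl_refl [simp]: "evl \<alpha> u u = 0"
  by (simp add: evl_def)

lemma evl_simps [simp]:
  "evl (\<alpha> + \<beta>) u v = evl \<alpha> u v + evl \<beta> u v"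
  "evl (\<alpha> - \<beta>) u v = evl \<alpha> u v - evl \<beta> u v"
  "evl (c *\<^sub>R \<alpha>) u v = c * evl \<alpha> u v"
  "evl 0 u v = 0"
  by (auto simp: evl_def)

lemma abs_evl: "u \<noteq> v \<Longrightarrow> \<bar>evl \<alpha> u v\<bar> = \<bar>\<alpha> $ {u, v}\<bar>"
  by (auto simp: evl_def)

lemma evl_restr: "evl (restr K \<alpha>) u v = (if {u, v} \<in> K then evl \<alpha> u v else 0)"
  by (simp add: evl_def restr_def)

lemma simplices_1_iff: "\<sigma> \<in> simplices K 1 \<longleftrightarrow> (\<exists>u v. u < v \<and> \<sigma> = {u, v} \<and> {u, v} \<in> K)"
  for K :: "'n::{finite,linorder} set set"
proof
  assume "\<sigma> \<in> simplices K 1"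
  then have "card \<sigma> = 2" "\<sigma> \<in> K"
    by (auto simp: simplices_def)
  then obtain u v where "\<sigma> = {u, v}" "u \<noteq> v" "\<sigma> \<in> K"
    unfolding card_2_iff by blast
  then show "\<exists>u v. u < v \<and> \<sigma> = {u, v} \<and> {u, v} \<in> K"
    by (metis insert_commute linorder_neqE)
qed (auto simp: simplices_def)

lemma edge_in_simplices [simp]: "{u, v} \<in> simplices K 1 \<longleftrightarrow> u \<noteq> v \<and> {u, v} \<in> K"
  by (cases "u = v") (auto simp: simplices_def)

lemma edge_in_simplices' [simp]: "{u, v} \<in> simplices K (Suc 0) \<longleftrightarrow> u \<noteq> v \<and> {u, v} \<in> K"
  using edge_in_simplices by simp

lemma evl_outside: "\<alpha> \<in> cochains K 1 \<Longrightarrow> {u, v} \<notin> K \<Longrightarrow> evl \<alpha> u v = 0"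
  by (auto simp: cochains_def evl_def)

lemma cochain_eqI:
  fixes \<alpha> \<beta> :: "'n::{finite,linorder} cochain"
  assumes "\<alpha> \<in> cochains K 1" "\<beta> \<in> cochains K 1"
    and "\<And>u v. u \<noteq> v \<Longrightarrow> {u, v} \<in> K \<Longrightarrow> evl \<alpha> u v = evl \<beta> u v"
  shows "\<alpha> = \<beta>"
proof (rule vec_eq_iff[THEN iffD2], rule)
  fix \<sigma>
  show "\<alpha> $ \<sigma> = \<beta> $ \<sigma>"
  proof (cases "\<sigma> \<in> simplices K 1")
    case True
    then obtain u v where "u < v" "\<sigma> = {u, v}" "{u, v} \<in> K"
      using simplices_1_iff by metis
    then show ?thesis using assms(3)[of u v] by (auto simp: evl_def)
  qed (use assms in \<open>auto simp: cochains_def\<close>)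
qed

definition cochain_of :: "'n::{finite,linorder} set set \<Rightarrow> ('n \<Rightarrow> 'n \<Rightarrow> real) \<Rightarrow> 'n cochain" where
  "cochain_of K a = (\<chi> \<sigma>. if \<sigma> \<in> simplices K 1 then a (Min \<sigma>) (Max \<sigma>) else 0)"

lemma cochain_of_in_cochains [simp]: "cochain_of K a \<in> cochains K 1"
  "cochain_of K a \<in> cochains K (Suc 0)"
  by (auto simp: cochains_def cochain_of_def)

lemma evl_cochain_of:
  fixes u v :: "'n::{finite,linorder}"
  assumes "\<And>u v. a v u = - a u v"
  shows "evl (cochain_of K a) u v = (if {u, v} \<in> K then a u v else 0)"
proof -
  have "a u u = 0" for u using assms[of u u] by simp
  then show ?thesis
    using assms[of u v] by (auto simp: evl_def cochain_of_def min_def max_def insert_commute)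
qed

definition d3 :: "'n::{finite,linorder} cochain \<Rightarrow> 'n \<Rightarrow> 'n \<Rightarrow> 'n \<Rightarrow> real" where
  "d3 \<alpha> u v w = evl \<alpha> u v + evl \<alpha> v w + evl \<alpha> w u"

lemma coboundary_triple_ordered:
  fixes u v w :: "'n::{finite,linorder}"
  assumes "u < v" "v < w"
  shows "coboundary K 1 \<alpha> $ {u, v, w} = (if {u, v, w} \<in> K then d3 \<alpha> u v w else 0)"
proof -
  have neq: "u \<noteq> v" "v \<noteq> w" "u \<noteq> w" "u < w" using assms by auto
  have c: "{x \<in> {u, v, w}. x < u} = {}" "{x \<in> {u, v, w}. x < v} = {u}" "{x \<in> {u, v, w}. x < w} = {u, v}"
    using assms by auto
  have e: "{u, v, w} - {u} = {v, w}" "{u, v, w} - {v} = {u, w}" "{u, v, w} - {w} = {u, v}"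
    using neq by auto
  have "(\<Sum>x\<in>{u, v, w}. h x) = h u + (h v + h w)" for h :: "'n \<Rightarrow> real"
    using neq by simp
  then have "(\<Sum>x\<in>{u, v, w}. (- 1) ^ card {y \<in> {u, v, w}. y < x} * \<alpha> $ ({u, v, w} - {x}))
      = \<alpha> $ {v, w} + (- \<alpha> $ {u, w} + \<alpha> $ {u, v})"
    by (simp only: c e) (use neq in simp)
  also have "\<dots> = d3 \<alpha> u v w"
    using neq assms by (simp add: d3_def evl_def insert_commute)
  finally have "(\<Sum>x\<in>{u, v, w}. (- 1) ^ card {y \<in> {u, v, w}. y < x} * \<alpha> $ ({u, v, w} - {x}))
      = d3 \<alpha> u v w" .
  moreover have "{u, v, w} \<in> simplices K (1 + 1) \<longleftrightarrow> {u, v, w} \<in> K"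
    using neq by (simp add: simplices_def)
  ultimately show ?thesis
    by (simp only: coboundary_def vec_lambda_beta)
qed

text \<open>The sign of the coboundary depends on how the labels of the triangle are ordered.
  Absolute values suffice, because vanishing, norms and contents do not see the sign.\<close>

lemma coboundary_triple:
  fixes u v w :: "'n::{finite,linorder}"
  assumes "u \<noteq> v" "v \<noteq> w" "u \<noteq> w"
  shows "\<bar>coboundary K 1 \<alpha> $ {u, v, w}\<bar> = (if {u, v, w} \<in> K then \<bar>d3 \<alpha> u v w\<bar> else 0)"
proof -
  have *: "\<bar>coboundary K 1 \<alpha> $ {u, v, w}\<bar> = (if {u, v, w} \<in> K then \<bar>d3 \<alpha> u v w\<bar> else 0)"
    if "u < v" "v < w" for u v w
    using coboundary_triple_ordered[OF that, of K \<alpha>] by simp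
  consider "u < v" "v < w" | "u < w" "w < v" | "v < u" "u < w" | "v < w" "w < u"
    | "w < u" "u < v" | "w < v" "v < u"
    using assms by (metis linorder_neqE)
  moreover have "{u, w, v} = {u, v, w}" "{v, u, w} = {u, v, w}" "{v, w, u} = {u, v, w}"
    "{w, u, v} = {u, v, w}" "{w, v, u} = {u, v, w}"
    by auto
  moreover have "\<bar>d3 \<alpha> u w v\<bar> = \<bar>d3 \<alpha> u v w\<bar>" "\<bar>d3 \<alpha> v u w\<bar> = \<bar>d3 \<alpha> u v w\<bar>"
    "\<bar>d3 \<alpha> v w u\<bar> = \<bar>d3 \<alpha> u v w\<bar>" "\<bar>d3 \<alpha> w u v\<bar> = \<bar>d3 \<alpha> u v w\<bar>"
    "\<bar>d3 \<alpha> w v u\<bar> = \<bar>d3 \<alpha> u v w\<bar>"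
    using evl_swap[of \<alpha> u v] evl_swap[of \<alpha> u w] evl_swap[of \<alpha> v w] by (auto simp: d3_def)
  ultimately show ?thesis
    using *[of u v w] *[of u w v] *[of v u w] *[of v w u] *[of w u v] *[of w v u] by metis
qed

lemma triple_cases:
  assumes "card (\<sigma>::'n::{finite,linorder} set) = 3"
  obtains u v w where "\<sigma> = {u, v, w}" "u \<noteq> v" "v \<noteq> w" "u \<noteq> w"
  using assms by (auto simp: card_3_iff)

lemma coboundary_in_cochains: "coboundary K 1 \<alpha> \<in> cochains K 2"
  by (simp add: cochains_def coboundary_def flip: numeral_2_eq_2)

lemma coboundary_outside: "\<sigma> \<notin> simplices K 2 \<Longrightarrow> coboundary K 1 \<alpha> $ \<sigma> = 0"
  by (simp add: coboundary_def flip: numeral_2_eq_2)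

lemma coboundary_1_eq_0_iff:
  fixes \<alpha> :: "'n::{finite,linorder} cochain"
  shows "coboundary K 1 \<alpha> = 0 \<longleftrightarrow>
    (\<forall>u v w. u \<noteq> v \<longrightarrow> v \<noteq> w \<longrightarrow> u \<noteq> w \<longrightarrow> {u, v, w} \<in> K \<longrightarrow> d3 \<alpha> u v w = 0)" (is "?L \<longleftrightarrow> ?R")
proof
  assume ?L
  then show ?R using coboundary_triple[of _ _ _ K \<alpha>]
    by (metis abs_eq_0 zero_index)
next
  assume R: ?R
  show ?L
  proof (rule vec_eq_iff[THEN iffD2], rule)
    fix \<sigma>
    show "coboundary K 1 \<alpha> $ \<sigma> = 0 $ \<sigma>"
    proof (cases "\<sigma> \<in> simplices K 2")
      case True
      then obtain u v w where "\<sigma> = {u, v, w}" "u \<noteq> v" "v \<noteq> w" "u \<noteq> w"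
        by (auto simp: simplices_def elim: triple_cases)
      with R coboundary_triple[of u v w K \<alpha>] show ?thesis by (auto split: if_splits)
    qed (use coboundary_outside[of \<sigma> K \<alpha>] in simp)
  qed
qed

lemma cocycles_1_iff:
  fixes \<alpha> :: "'n::{finite,linorder} cochain"
  shows "\<alpha> \<in> cocycles K 1 \<longleftrightarrow> \<alpha> \<in> cochains K 1 \<and>
    (\<forall>u v w. u \<noteq> v \<longrightarrow> v \<noteq> w \<longrightarrow> u \<noteq> w \<longrightarrow> {u, v, w} \<in> K \<longrightarrow> d3 \<alpha> u v w = 0)"
  unfolding cocycles_def using coboundary_1_eq_0_iff by auto

lemma coboundary_linear:
  "coboundary K k (\<alpha> + \<beta>) = coboundary K k \<alpha> + coboundary K k \<beta>"
  "coboundary K k (\<alpha> - \<beta>) = coboundary K k \<alpha> - coboundary K k \<beta>"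
  "coboundary K k (c *\<^sub>R \<alpha>) = c *\<^sub>R coboundary K k \<alpha>"
  by (simp_all add: vec_eq_iff coboundary_def sum.distrib sum_subtractf sum_distrib_left
      algebra_simps)

lemma coboundary_0_eq:
  fixes K :: "'n::{finite,linorder} set set"
  shows "coboundary K 0 g = cochain_of K (\<lambda>u v. g $ {v} - g $ {u})"
proof (rule vec_eq_iff[THEN iffD2], rule)
  fix \<sigma>
  show "coboundary K 0 g $ \<sigma> = cochain_of K (\<lambda>u v. g $ {v} - g $ {u}) $ \<sigma>"
  proof (cases "\<sigma> \<in> simplices K 1")
    case True
    then obtain u v where uv: "u < v" "\<sigma> = {u, v}" "{u, v} \<in> K"
      using simplices_1_iff by metis
    then have c: "{x \<in> {u, v}. x < u} = {}" "{x \<in> {u, v}. x < v} = {u}"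
      and e: "{u, v} - {u} = {v}" "{u, v} - {v} = {u}" and "u \<noteq> v"
      by auto
    have "(\<Sum>x\<in>{u, v}. h x) = h u + h v" for h :: "'n \<Rightarrow> real"
      using \<open>u \<noteq> v\<close> by simp
    then have "(\<Sum>x\<in>{u, v}. (- 1) ^ card {y \<in> {u, v}. y < x} * g $ ({u, v} - {x})) = g $ {v} - g $ {u}"
      by (simp only: c e) simp
    then show ?thesis
      using True uv by (simp add: coboundary_def cochain_of_def)
  qed (simp add: coboundary_def cochain_of_def)
qed

lemma coboundaries_1_iff:
  fixes \<alpha> :: "'n::{finite,linorder} cochain"
  assumes "\<And>v. {v} \<in> K"
  shows "\<alpha> \<in> coboundaries K 1 \<longleftrightarrow> (\<exists>g. \<alpha> = cochain_of K (\<lambda>u v. g v - g u))"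
proof
  assume "\<alpha> \<in> coboundaries K 1"
  then show "\<exists>g. \<alpha> = cochain_of K (\<lambda>u v. g v - g u)"
    by (auto simp: coboundaries_def coboundary_0_eq)
next
  assume "\<exists>g. \<alpha> = cochain_of K (\<lambda>u v. g v - g u)"
  then obtain g where g: "\<alpha> = cochain_of K (\<lambda>u v. g v - g u)" by auto
  define h :: "'n cochain" where "h = (\<chi> \<sigma>. if \<sigma> \<in> simplices K 0 then g (Min \<sigma>) else 0)"
  have "h $ {v} = g v" for v using assms[of v] by (simp add: h_def simplices_def)
  then have "\<alpha> = coboundary K 0 h" by (simp add: g coboundary_0_eq)
  moreover have "h \<in> cochains K 0" by (simp add: h_def cochains_def)
  ultimately show "\<alpha> \<in> coboundaries K 1" by (auto simp: coboundaries_def)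
qed

lemma evl_exact: "evl (cochain_of K (\<lambda>u v. g v - g u)) u v = (if {u, v} \<in> K then g v - g u else 0)"
  by (rule evl_cochain_of) simp

lemma zero_coboundaries [simp]: "0 \<in> coboundaries K (Suc k)"
proof -
  have "coboundary K k 0 = 0" "0 \<in> cochains K k"
    by (simp_all add: coboundary_def cochains_def vec_eq_iff)
  then show ?thesis by (force simp: coboundaries_def)
qed

lemma subspace_coboundaries: "subspace (coboundaries K (Suc k))"
proof -
  have "linear (coboundary K k)"
    by (rule linearI) (simp_all add: coboundary_linear)
  moreover have "subspace (cochains K k)"
    by (simp add: subspace_def cochains_def)
  ultimately show ?thesis
    using linear_subspace_image[of "coboundary K k" "cochains K k"] by (simp add: coboundaries_def)
qed

lemma subspace_cocycles: "subspace (cocycles K k)"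
  by (auto simp: subspace_def cocycles_def coboundary_linear cochains_def)
    (simp add: coboundary_def vec_eq_iff)

section \<open>Holonomy as the complete invariant of first cohomology\<close>

definition hol :: "'n::{finite,linorder} cochain \<Rightarrow> real" where
  "hol \<alpha> = (\<Sum>i\<in>UNIV. evl \<alpha> i (rot i))"

lemma hol_simps [simp]:
  "hol (\<alpha> + \<beta>) = hol \<alpha> + hol \<beta>" "hol (\<alpha> - \<beta>) = hol \<alpha> - hol \<beta>" "hol (c *\<^sub>R \<alpha>) = c * hol \<alpha>"
  "hol 0 = 0"
  by (simp_all add: hol_def sum.distrib sum_subtractf sum_distrib_left)

text \<open>The pairs with \<open>u = v\<close> bring the vertices of a simplex into the
  condition.\<close>

definition flag :: "'n set set \<Rightarrow> bool" where
  "flag K \<longleftrightarrow> (\<forall>\<sigma>. \<sigma> \<in> K \<longleftrightarrow> \<sigma> \<noteq> {} \<and> (\<forall>u\<in>\<sigma>. \<forall>v\<in>\<sigma>. {u, v} \<in> K))"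

text \<open>After a perturbation, edges with equally many steps enter at different times, so an edge
  forces only those with strictly fewer steps. In the later \<open>regular_complex\<close> the
  inequality is non-strict, which makes membership of an edge a function of
  \<open>cdist\<close>.\<close>

definition cyclic_complex :: "'n::{finite,linorder} set set \<Rightarrow> bool" where
  "cyclic_complex K \<longleftrightarrow> flag K \<and> (\<forall>u. {u, rot u} \<in> K) \<and>
     (\<forall>u v u' v'. {u, v} \<in> K \<longrightarrow> cdist u' v' < cdist u v \<longrightarrow> {u', v'} \<in> K)"

lemma flag_triple:
  "flag K \<Longrightarrow> {u, v, w} \<in> K \<longleftrightarrow> {u} \<in> K \<and> {v} \<in> K \<and> {w} \<in> K \<and> {u, v} \<in> K \<and> {v, w} \<in> K \<and> {u, w} \<in> K"
  unfolding flag_def by (drule spec[of _ "{u, v, w}"]) (simp add: insert_commute, blast)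

lemma cyclic_vertex:
  fixes K :: "'n::{finite,linorder} set set"
  assumes "3 \<le> CARD('n)" "cyclic_complex K"
  shows "{v} \<in> K"
proof -
  have "cdist v v < cdist v (rot v)" using cdist_rot[OF assms(1)] by simp
  then show ?thesis using assms(2) unfolding cyclic_complex_def
    by (metis insert_absorb2)
qed

lemma hol_coboundary:
  fixes K :: "'n::{finite,linorder} set set"
  assumes "3 \<le> CARD('n)" "cyclic_complex K" "\<alpha> \<in> coboundaries K 1"
  shows "hol \<alpha> = 0"
proof -
  obtain g where "\<alpha> = cochain_of K (\<lambda>u v. g v - g u)"
    using assms(3) coboundaries_1_iff[of K] cyclic_vertex[OF assms(1,2)] by metis
  then have "hol \<alpha> = (\<Sum>i\<in>UNIV. g (rot i) - g i)"
    using assms(2) by (simp add: hol_def evl_exact cyclic_complex_def)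
  also have "\<dots> = 0"
    using sum.reindex_bij_betw[OF bij_rot, of g] by (simp add: sum_subtractf)
  finally show ?thesis .
qed

text \<open>Induction on the number of steps: an edge of \<open>k + 1\<close> steps spans a triangle
  with a polygon side and an edge of \<open>k\<close> steps, which lies in \<open>K\<close> because
  it has fewer steps. This needs the gap to be the shorter way around; otherwise the edge is read
  backwards.\<close>

lemma cocycle_zero_of_polygon_zero:
  fixes a :: "'n::{finite,linorder} \<Rightarrow> 'n \<Rightarrow> real"
  assumes n: "3 \<le> CARD('n)" and K: "cyclic_complex K" and anti: "\<And>u v. a v u = - a u v"
    and rot: "\<And>i. a i (rot i) = 0"
    and tri: "\<And>u v w. {u, v, w} \<in> K \<Longrightarrow> a u v + a v w + a w u = 0"
    and edge: "{u, v} \<in> K"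
  shows "a u v = 0"
proof -
  have flag: "flag K" and step: "\<And>u v u' v'. {u, v} \<in> K \<Longrightarrow> cdist u' v' < cdist u v \<Longrightarrow> {u', v'} \<in> K"
    and rotK: "\<And>u. {u, rot u} \<in> K"
    using K by (auto simp: cyclic_complex_def)
  have main: "a u v = 0" if "{u, v} \<in> K" "gap u v = int k" "2 * k \<le> CARD('n)" for k u v
    using that
  proof (induction k arbitrary: u v)
    case 0
    then show ?case using anti[of u u] by simp
  next
    case (Suc k)
    show ?case
    proof (cases "k = 0")
      case True
      then have "v = rot u" using Suc.prems lab_pos_gap[of u v] by (simp add: rot_def)
      then show ?thesis using rot by simp
    next
      case False
      have "u \<noteq> v" using Suc.prems by auto
      then have g: "gap (rot u) v = int k" using gap_rot_left[of u v] Suc.prems by simp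
      have cd: "cdist u v = int (Suc k)" "cdist (rot u) v = int k"
        using Suc.prems g by (auto simp: cdist_def min_def)
      have e: "{rot u, v} \<in> K" by (rule step[OF Suc.prems(1)]) (simp add: cd)
      have "{u, rot u, v} \<in> K"
        using flag_triple[OF flag] e Suc.prems(1) rotK cyclic_vertex[OF n K] by simp
      from tri[OF this] have "a u v = a u (rot u) + a (rot u) v" using anti[of u v] by simp
      then show ?thesis using rot Suc.IH[OF e g] Suc.prems by simp
    qed
  qed
  show ?thesis
  proof (cases "2 * gap u v \<le> int CARD('n)")
    case True
    then show ?thesis using main[of u v "nat (gap u v)"] edge by simp
  next
    case False
    then have "2 * gap v u \<le> int CARD('n)" using gap_swap[where u=u and v=v] by auto
    then have "a v u = 0" using main[of v u "nat (gap v u)"] edge by (simp add: insert_commute)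
    then show ?thesis using anti[of u v] by simp
  qed
qed

text \<open>Zero holonomy yields a potential along the polygon. The cocycle minus the gradient of
  that potential vanishes on the sides, hence on all edges.\<close>

lemma hol_zero_imp_coboundary:
  fixes K :: "'n::{finite,linorder} set set"
  assumes n: "3 \<le> CARD('n)" and K: "cyclic_complex K" and \<alpha>: "\<alpha> \<in> cocycles K 1" and h: "hol \<alpha> = 0"
  shows "\<alpha> \<in> coboundaries K 1"
proof -
  obtain g where g: "\<And>i. g (rot i) = g i + evl \<alpha> i (rot i)"
  proof (rule cyclic_primitive[of undefined "\<lambda>i. evl \<alpha> i (rot i)"])
    fix g assume "\<And>i. i \<noteq> undefined \<Longrightarrow> g (rot i) = g i + evl \<alpha> i (rot i)"
      and "(\<Sum>i\<in>UNIV. evl \<alpha> i (rot i)) = 0 \<Longrightarrow>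
        g (rot undefined) = g undefined + evl \<alpha> undefined (rot undefined)"
    then show thesis using that[of g] h unfolding hol_def by metis
  qed (use n in simp)
  have "\<alpha> = cochain_of K (\<lambda>u v. g v - g u)"
  proof (rule cochain_eqI)
    fix u v assume uv: "u \<noteq> v" "{u, v} \<in> K"
    have "evl \<alpha> u v - (g v - g u) = 0"
    proof (rule cocycle_zero_of_polygon_zero[OF n K _ _ _ uv(2)])
      show "evl \<alpha> v u - (g u - g v) = - (evl \<alpha> u v - (g v - g u))" for u v
        using evl_swap[of \<alpha> u v] by simp
      show "evl \<alpha> i (rot i) - (g (rot i) - g i) = 0" for i using g by simp
      fix u v w assume "{u, v, w} \<in> K"
      then have "d3 \<alpha> u v w = 0" if "u \<noteq> v" "v \<noteq> w" "u \<noteq> w"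
        using \<alpha> that unfolding cocycles_1_iff by blast
      moreover have "d3 \<alpha> u v w = 0" if "\<not> (u \<noteq> v \<and> v \<noteq> w \<and> u \<noteq> w)"
        using that evl_swap[of \<alpha> u v] evl_swap[of \<alpha> u w] by (auto simp: d3_def)
      ultimately have "d3 \<alpha> u v w = 0" by blast
      then show "evl \<alpha> u v - (g v - g u) + (evl \<alpha> v w - (g w - g v)) + (evl \<alpha> w u - (g u - g w)) = 0"
        by (simp add: d3_def)
    qed
    then show "evl \<alpha> u v = evl (cochain_of K (\<lambda>u v. g v - g u)) u v"
      using uv by (simp add: evl_exact)
  qed (use \<alpha> in \<open>auto simp: cocycles_def\<close>)
  then show ?thesis using coboundaries_1_iff[of K] cyclic_vertex[OF n K] by auto
qed

lemma coboundary_iff_hol: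
  fixes K :: "'n::{finite,linorder} set set"
  assumes "3 \<le> CARD('n)" "cyclic_complex K" "\<alpha> \<in> cocycles K 1"
  shows "\<alpha> \<in> coboundaries K 1 \<longleftrightarrow> hol \<alpha> = 0"
  using assms hol_coboundary hol_zero_imp_coboundary by blast

text \<open>Only sides of the polygon are present and at least one is absent, so the graph is a
  union of paths and every function on its edges is a gradient.\<close>

lemma forest_coboundary:
  fixes K :: "'n::{finite,linorder} set set"
  assumes n: "3 \<le> CARD('n)" and vert: "\<And>v. {v} \<in> K"
    and edges: "\<And>u v. {u, v} \<in> K \<Longrightarrow> cdist u v \<le> 1" and miss: "{i0, rot i0} \<notin> K"
    and \<alpha>: "\<alpha> \<in> cochains K 1"
  shows "\<alpha> \<in> coboundaries K 1"
proof -
  have "2 \<le> CARD('n)" using n by simp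
  then obtain g where g: "\<And>i. i \<noteq> i0 \<Longrightarrow> g (rot i) = g i + evl \<alpha> i (rot i)"
    by (rule cyclic_primitive[of i0 "\<lambda>i. evl \<alpha> i (rot i)"]) blast
  have "\<alpha> = cochain_of K (\<lambda>u v. g v - g u)"
  proof (rule cochain_eqI)
    fix u v assume uv: "u \<noteq> v" "{u, v} \<in> K"
    then have "cdist u v = 1" using edges[OF uv(2)] cdist_ge_0[of u v] cdist_eq_0_iff[of u v] by linarith
    then consider "v = rot u" "u \<noteq> i0" | "u = rot v" "v \<noteq> i0"
      using cdist_eq_1_imp[of u v] miss uv by (metis insert_commute)
    then have "evl \<alpha> u v = g v - g u"
      by cases (use g evl_swap[of \<alpha> u v] in auto)
    then show "evl \<alpha> u v = evl (cochain_of K (\<lambda>u v. g v - g u)) u v"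
      using uv by (simp add: evl_exact)
  qed (use \<alpha> in auto)
  then show ?thesis using coboundaries_1_iff[of K] vert by auto
qed

section \<open>Persistence of step-ordered configurations\<close>

lemma finite_dists: "finite {dist (X $ i) (X $ j) | i j. i \<in> \<sigma> \<and> j \<in> \<sigma>}"
  for X :: "'n::finite config"
  by (rule finite_subset[of _ "(\<lambda>(i, j). dist (X $ i) (X $ j)) ` UNIV"]) auto

lemma diam_le_iff:
  fixes X :: "'n::finite config"
  assumes "\<sigma> \<noteq> {}"
  shows "diam X \<sigma> \<le> t \<longleftrightarrow> (\<forall>u\<in>\<sigma>. \<forall>v\<in>\<sigma>. dist (X $ u) (X $ v) \<le> t)"
proof -
  have "{dist (X $ i) (X $ j) | i j. i \<in> \<sigma> \<and> j \<in> \<sigma>} \<noteq> {}" using assms by auto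
  then show ?thesis unfolding diam_def using finite_dists[of X \<sigma>] by (subst Max_le_iff) blast+
qed

lemma diam_pair: "diam X {u, v} = dist (X $ u) (X $ v)"
  for X :: "'n::finite config"
proof (rule antisym)
  show "diam X {u, v} \<le> dist (X $ u) (X $ v)"
    by (subst diam_le_iff) (auto simp: dist_commute)
  show "dist (X $ u) (X $ v) \<le> diam X {u, v}"
    using diam_le_iff[of "{u, v}" X "diam X {u, v}"] by simp
qed

lemma VR_iff: "\<sigma> \<in> VR X t \<longleftrightarrow> \<sigma> \<noteq> {} \<and> (\<forall>u\<in>\<sigma>. \<forall>v\<in>\<sigma>. dist (X $ u) (X $ v) \<le> t)"
  for X :: "'n::finite config"
  using diam_le_iff[of \<sigma> X t] by (auto simp: VR_def)

lemma VR_edge [simp]: "{u, v} \<in> VR X t \<longleftrightarrow> dist (X $ u) (X $ v) \<le> t"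
  for X :: "'n::finite config"
  using zero_le_dist[of "X $ u" "X $ v"] by (auto simp: VR_iff dist_commute simp del: zero_le_dist)

lemma VR_vertex [simp]: "{u} \<in> VR X t \<longleftrightarrow> 0 \<le> t"
  for X :: "'n::finite config"
  by (simp add: VR_iff)

lemma flag_VR: "flag (VR X t)"
  for X :: "'n::finite config"
  unfolding flag_def VR_edge by (simp add: VR_iff)

lemma VR_mono: "s \<le> t \<Longrightarrow> VR X s \<subseteq> VR X t"
  by (auto simp: VR_def)

lemma VR_eqI:
  fixes X Y :: "'n::finite config"
  assumes "\<And>u v. dist (X $ u) (X $ v) \<le> s \<longleftrightarrow> dist (Y $ u) (Y $ v) \<le> t"
  shows "VR X s = VR Y t"
  using assms by (auto simp: VR_iff)

definition step_ordered :: "'n::{finite,linorder} config \<Rightarrow> bool" where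
  "step_ordered X \<longleftrightarrow> (\<forall>u v u' v'. cdist u v < cdist u' v' \<longrightarrow>
     dist (X $ u) (X $ v) < dist (X $ u') (X $ v'))"

definition polygon_scale :: "'n::{finite,linorder} config \<Rightarrow> real" where
  "polygon_scale X = Max (range (\<lambda>i. dist (X $ i) (X $ rot i)))"

definition nontrivial_H1 :: "'n::{finite,linorder} set set \<Rightarrow> bool" where
  "nontrivial_H1 K \<longleftrightarrow> (\<exists>\<alpha>\<in>cocycles K 1. \<alpha> \<notin> coboundaries K 1)"

lemma polygon_scale_le_iff: "polygon_scale X \<le> t \<longleftrightarrow> (\<forall>i. dist (X $ i) (X $ rot i) \<le> t)"
  unfolding polygon_scale_def by (subst Max_le_iff) auto

lemma cyclic_complex_VR:
  assumes "step_ordered X" "polygon_scale X \<le> t"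
  shows "cyclic_complex (VR X t)"
  using assms unfolding cyclic_complex_def step_ordered_def polygon_scale_le_iff
  by (auto simp: flag_VR) (meson less_imp_le order_trans)

lemma trivial_below_polygon_scale:
  fixes X :: "'n::{finite,linorder} config"
  assumes n: "3 \<le> CARD('n)" and X: "step_ordered X" and t: "t < polygon_scale X"
    and \<alpha>: "\<alpha> \<in> cochains (VR X t) 1"
  shows "\<alpha> \<in> coboundaries (VR X t) 1"
proof (cases "0 \<le> t")
  case True
  obtain i where i: "t < dist (X $ i) (X $ rot i)"
    using t polygon_scale_le_iff[of X t] by (auto simp: not_le)
  show ?thesis
  proof (rule forest_coboundary[OF n _ _ _ \<alpha>])
    show "{i, rot i} \<notin> VR X t" using i by simp
    \<comment> \<open>An edge of two or more steps would be longer than the side at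
      \<open>i\<close>, which is still absent.\<close>
    show "cdist u v \<le> 1" if "{u, v} \<in> VR X t" for u v
    proof (rule ccontr)
      assume "\<not> cdist u v \<le> 1"
      then have "cdist i (rot i) < cdist u v" using cdist_rot[OF n] by simp
      then show False using X that i unfolding step_ordered_def by (smt (verit) VR_edge)
    qed
  qed (use True in simp)
next
  case False
  \<comment> \<open>Before time 0 the complex is empty, without even the vertices that
    \<open>coboundaries_1_iff\<close> asks for; but then the cochain is zero.\<close>
  have far: "\<not> dist (X $ u) (X $ v) \<le> t" for u v
  proof
    assume "dist (X $ u) (X $ v) \<le> t"
    then have "0 \<le> t" by (rule order_trans[OF zero_le_dist])
    then show False using False by simp
  qed
  have "\<alpha> = 0"
    by (intro cochain_eqI[OF \<alpha>]) (simp_all add: cochains_def far)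
  then show ?thesis by simp
qed

lemma coboundary_iff_hol_VR:
  fixes X :: "'n::{finite,linorder} config"
  assumes "3 \<le> CARD('n)" "step_ordered X" "polygon_scale X \<le> t" "\<alpha> \<in> cocycles (VR X t) 1"
  shows "\<alpha> \<in> coboundaries (VR X t) 1 \<longleftrightarrow> hol \<alpha> = 0"
  using coboundary_iff_hol[OF assms(1) cyclic_complex_VR] assms by blast

lemma nontrivial_H1_iff:
  fixes X :: "'n::{finite,linorder} config"
  assumes "3 \<le> CARD('n)" "step_ordered X"
  shows "nontrivial_H1 (VR X t) \<longleftrightarrow> polygon_scale X \<le> t \<and> (\<exists>\<alpha>\<in>cocycles (VR X t) 1. hol \<alpha> \<noteq> 0)"
proof (cases "polygon_scale X \<le> t")
  case True
  then show ?thesis using coboundary_iff_hol_VR[OF assms True] by (auto simp: nontrivial_H1_def)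
next
  case False
  then show ?thesis using trivial_below_polygon_scale[OF assms]
    by (auto simp: nontrivial_H1_def cocycles_def)
qed

section \<open>Restriction maps and the unique bar\<close>

lemma restr_cocycle:
  fixes \<alpha> :: "'n::{finite,linorder} cochain"
  assumes "K \<subseteq> L" "flag K" "\<alpha> \<in> cocycles L 1"
  shows "restr K \<alpha> \<in> cocycles K 1"
  unfolding cocycles_1_iff
proof (intro conjI allI impI)
  show "restr K \<alpha> \<in> cochains K 1"
    using assms by (auto simp: cocycles_def cochains_def restr_def simplices_def)
  fix u v w assume uvw: "u \<noteq> v" "v \<noteq> w" "u \<noteq> w" "{u, v, w} \<in> K"
  then have "d3 \<alpha> u v w = 0" using assms unfolding cocycles_1_iff by blast
  moreover have "{u, v} \<in> K" "{v, w} \<in> K" "{w, u} \<in> K"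
    using uvw flag_triple[OF assms(2), of u v w] by (auto simp: insert_commute)
  ultimately show "d3 (restr K \<alpha>) u v w = 0" by (simp add: d3_def evl_restr)
qed

lemma hol_restr: "(\<And>u. {u, rot u} \<in> K) \<Longrightarrow> hol (restr K \<alpha>) = hol \<alpha>"
  by (simp add: hol_def evl_restr)

lemma trivial_full:
  fixes K :: "'n::{finite,linorder} set set"
  assumes "\<And>u v. {u, v} \<in> K" "flag K" "\<alpha> \<in> cocycles K 1"
  shows "\<alpha> \<in> coboundaries K 1"
proof -
  have vert: "{v} \<in> K" for v using assms(1)[of v v] by simp
  have full: "{u, v, w} \<in> K" for u v w using flag_triple[OF assms(2), of u v w] assms(1) vert by simp
  have "\<alpha> = cochain_of K (\<lambda>u v. evl \<alpha> undefined v - evl \<alpha> undefined u)"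
  proof (rule cochain_eqI)
    fix u v :: 'n
    have "d3 \<alpha> undefined u v = 0" if "undefined \<noteq> u" "u \<noteq> v" "undefined \<noteq> v"
      using assms(3) full that unfolding cocycles_1_iff by blast
    then have "evl \<alpha> u v = evl \<alpha> undefined v - evl \<alpha> undefined u"
      using evl_swap[of \<alpha> undefined v] evl_swap[of \<alpha> undefined u]
      by (cases "undefined \<noteq> u \<and> u \<noteq> v \<and> undefined \<noteq> v") (auto simp: d3_def)
    then show "evl \<alpha> u v = evl (cochain_of K (\<lambda>u v. evl \<alpha> undefined v - evl \<alpha> undefined u)) u v"
      using assms(1) evl_exact[of K "evl \<alpha> undefined" u v] by simp
  qed (use assms in \<open>auto simp: cocycles_def\<close>)
  then show ?thesis using coboundaries_1_iff[of K \<alpha>] vert by blast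
qed

text \<open>Finitely many distances are compared with the time, and each comparison stays unchanged
  for a short while after \<open>t\<close>. This is what makes the set of times with cohomology
  half-open.\<close>

lemma VR_right_continuous:
  fixes X :: "'n::finite config"
  shows "\<exists>\<delta>>0. \<forall>t'\<ge>t. t' < t + \<delta> \<longrightarrow> VR X t' = VR X t"
proof -
  have "\<exists>\<delta>>0. \<forall>t'\<ge>t. t' < t + \<delta> \<longrightarrow> (r \<le> t' \<longleftrightarrow> r \<le> t)" for r :: real
  proof (cases "r \<le> t")
    case True
    then show ?thesis by (intro exI[of _ 1]) auto
  next
    case False
    then show ?thesis by (intro exI[of _ "r - t"]) auto
  qed
  then obtain \<delta> where \<delta>: "\<And>r. 0 < \<delta> r" "\<And>r t'. t \<le> t' \<Longrightarrow> t' < t + \<delta> r \<Longrightarrow> r \<le> t' \<longleftrightarrow> r \<le> t"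
    by metis
  define S where "S = (\<lambda>(u, v). \<delta> (dist (X $ u) (X $ v))) ` UNIV"
  have S: "finite S" "S \<noteq> {}" "\<delta> (dist (X $ u) (X $ v)) \<in> S" for u v
    by (auto simp: S_def)
  have "0 < Min S" using S(1,2) \<delta>(1) by (subst Min_gr_iff) (auto simp: S_def)
  moreover have "VR X t' = VR X t" if "t \<le> t'" "t' < t + Min S" for t'
  proof (rule VR_eqI)
    fix u v
    have "Min S \<le> \<delta> (dist (X $ u) (X $ v))" using S by simp
    then show "dist (X $ u) (X $ v) \<le> t' \<longleftrightarrow> dist (X $ u) (X $ v) \<le> t"
      using that by (intro \<delta>(2)) auto
  qed
  ultimately show ?thesis by blast
qed

text \<open>Restriction preserves holonomy, so nontriviality passes to every earlier time from the
  closing of the polygon on. By right continuity the infimum of the later trivial times is itself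
  trivial.\<close>

lemma nontrivial_H1_interval:
  fixes X :: "'n::{finite,linorder} config"
  assumes n: "3 \<le> CARD('n)" and X: "step_ordered X" and t0: "nontrivial_H1 (VR X t0)"
  shows "\<exists>d>polygon_scale X. \<forall>t. nontrivial_H1 (VR X t) \<longleftrightarrow> polygon_scale X \<le> t \<and> t < d"
proof -
  let ?b = "polygon_scale X"
  note iff = nontrivial_H1_iff[OF n X]
  have down: "nontrivial_H1 (VR X s)" if t: "nontrivial_H1 (VR X t)" and s: "?b \<le> s" "s \<le> t" for s t
  proof -
    obtain \<alpha> where \<alpha>: "\<alpha> \<in> cocycles (VR X t) 1" "hol \<alpha> \<noteq> 0" using iff[of t] t by blast
    have r: "restr (VR X s) \<alpha> \<in> cocycles (VR X s) 1"
      by (rule restr_cocycle[OF VR_mono[OF s(2)] flag_VR \<alpha>(1)])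
    have h: "hol (restr (VR X s) \<alpha>) = hol \<alpha>"
      by (rule hol_restr) (use s(1) polygon_scale_le_iff[of X s] in simp)
    show ?thesis using s(1) \<alpha>(2) h r iff[of s] by metis
  qed
  have b0: "nontrivial_H1 (VR X ?b)" using down[OF t0, of ?b] t0 iff[of t0] by blast
  define U where "U = {t. ?b \<le> t \<and> \<not> nontrivial_H1 (VR X t)}"
  obtain M where M: "\<And>u v. dist (X $ u) (X $ v) \<le> M"
    using diam_le_iff[of UNIV X "diam X UNIV"] by auto
  have "\<not> nontrivial_H1 (VR X (max M ?b))"
    unfolding nontrivial_H1_def using trivial_full[OF _ flag_VR, of X "max M ?b"] M by (auto simp: le_max_iff_disj)
  then have U: "U \<noteq> {}" "bdd_below U" unfolding U_def by (auto intro!: exI[of _ "max M ?b"] bdd_belowI[of _ ?b])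
  define d where "d = Inf U"
  have bd: "?b \<le> d" unfolding d_def by (rule cInf_greatest[OF U(1)]) (simp add: U_def)
  obtain \<delta> where \<delta>: "\<delta> > 0" "\<And>t'. d \<le> t' \<Longrightarrow> t' < d + \<delta> \<Longrightarrow> VR X t' = VR X d"
    using VR_right_continuous[of d X] by blast
  obtain u where u: "u \<in> U" "u < d + \<delta>"
    using cInf_lessD[OF U(1), of "d + \<delta>"] \<delta>(1) by (auto simp: d_def)
  have "d \<le> u" unfolding d_def by (rule cInf_lower[OF u(1) U(2)])
  then have "VR X u = VR X d" using u(2) by (rule \<delta>(2))
  then have dU: "\<not> nontrivial_H1 (VR X d)" using u(1) by (simp add: U_def)
  then have "?b \<noteq> d" using b0 by metis
  moreover have "nontrivial_H1 (VR X t) \<longleftrightarrow> ?b \<le> t \<and> t < d" for t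
  proof
    assume t: "nontrivial_H1 (VR X t)"
    then show "?b \<le> t \<and> t < d" using dU down[OF t bd] iff[of t] by (meson not_le)
  next
    assume t: "?b \<le> t \<and> t < d"
    then have "t \<notin> U" using cInf_lower[OF _ U(2), of t] by (auto simp: d_def)
    then show "nontrivial_H1 (VR X t)" using t by (simp add: U_def)
  qed
  ultimately show ?thesis using bd by (intro exI[of _ d]) auto
qed

text \<open>Cocycles of holonomy 1 can be picked independently at each time: once the polygon is
  closed, holonomy determines the class, so they are compatible with restriction and each spans the
  cohomology.\<close>

lemma has_bar_of_nontrivial_H1:
  fixes X :: "'n::{finite,linorder} config"
  assumes n: "3 \<le> CARD('n)" and X: "step_ordered X" and t0: "nontrivial_H1 (VR X t0)"
  shows "has_bar X"
proof -
  let ?b = "polygon_scale X"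
  note iff = nontrivial_H1_iff[OF n X]
  obtain d where d: "?b < d" "\<And>t. nontrivial_H1 (VR X t) \<longleftrightarrow> ?b \<le> t \<and> t < d"
    using nontrivial_H1_interval[OF assms] by blast
  have "\<exists>\<alpha>\<in>cocycles (VR X t) 1. hol \<alpha> = 1" if t: "t \<in> {?b..<d}" for t
  proof -
    obtain \<alpha> where "\<alpha> \<in> cocycles (VR X t) 1" "hol \<alpha> \<noteq> 0" using d(2)[of t] t iff[of t] by auto
    then show ?thesis
      by (intro bexI[of _ "(1 / hol \<alpha>) *\<^sub>R \<alpha>"]) (auto simp: subspace_scale[OF subspace_cocycles])
  qed
  then obtain z where z: "\<And>t. t \<in> {?b..<d} \<Longrightarrow> z t \<in> cocycles (VR X t) 1"
    "\<And>t. t \<in> {?b..<d} \<Longrightarrow> hol (z t) = 1" by metis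
  have triv: "\<alpha> \<in> coboundaries (VR X t) 1" if "t \<notin> {?b..<d}" "\<alpha> \<in> cocycles (VR X t) 1" for t \<alpha>
    using d(2)[of t] that by (auto simp: nontrivial_H1_def)
  have "interval_decomposition (VR X) 1 {0} (\<lambda>_. ?b) (\<lambda>_. d) (\<lambda>_. z)"
    unfolding interval_decomposition_def
  proof (intro conjI ballI allI impI)
    fix i :: nat and t s assume t: "t \<in> {?b..<d}" and s: "s \<le> t"
    have r: "restr (VR X s) (z t) \<in> cocycles (VR X s) 1"
      by (rule restr_cocycle[OF VR_mono[OF s] flag_VR z(1)[OF t]])
    show "restr (VR X s) (z t) - (if ?b \<le> s then z s else 0) \<in> coboundaries (VR X s) 1"
    proof (cases "?b \<le> s")
      case True
      then have s': "s \<in> {?b..<d}" using s t by auto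
      have "hol (restr (VR X s) (z t)) = hol (z t)"
        by (rule hol_restr) (use True polygon_scale_le_iff in auto)
      then show ?thesis
        using True coboundary_iff_hol_VR[OF n X True subspace_diff[OF subspace_cocycles r z(1)[OF s']]]
          z(2)[OF t] z(2)[OF s'] by simp
    next
      case False
      then show ?thesis using triv[OF _ r] by simp
    qed
  next
    fix t \<alpha> assume \<alpha>: "\<alpha> \<in> cocycles (VR X t) 1"
    show "\<exists>!a::nat \<Rightarrow> real. (\<forall>i. \<not> (i \<in> {0} \<and> t \<in> {?b..<d}) \<longrightarrow> a i = 0) \<and>
        \<alpha> - (\<Sum>i\<in>{i \<in> {0}. t \<in> {?b..<d}}. a i *\<^sub>R z t) \<in> coboundaries (VR X t) 1"
    proof (cases "t \<in> {?b..<d}")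
      case True
      then have s: "{i \<in> {0}. t \<in> {?b..<d}} = {0::nat}" by auto
      have cob: "\<alpha> - c *\<^sub>R z t \<in> coboundaries (VR X t) 1 \<longleftrightarrow> c = hol \<alpha>" for c
        using True coboundary_iff_hol_VR[OF n X _ subspace_diff[OF subspace_cocycles \<alpha>
            subspace_scale[OF subspace_cocycles z(1)[OF True]]], of c] z(2)[OF True]
        by auto
      show ?thesis unfolding s
      proof (rule ex1I[of _ "\<lambda>i. if i = 0 then hol \<alpha> else 0"])
        fix a :: "nat \<Rightarrow> real"
        assume a: "(\<forall>i. \<not> (i \<in> {0} \<and> t \<in> {?b..<d}) \<longrightarrow> a i = 0) \<and>
          \<alpha> - (\<Sum>i\<in>{0}. a i *\<^sub>R z t) \<in> coboundaries (VR X t) 1"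
        then show "a = (\<lambda>i. if i = 0 then hol \<alpha> else 0)"
          using cob[of "a 0"] by (auto simp: fun_eq_iff)
      qed (use True cob[of "hol \<alpha>"] in auto)
    next
      case False
      then have s: "{i \<in> {0}. t \<in> {?b..<d}} = ({}::nat set)" by auto
      show ?thesis unfolding s
        by (rule ex1I[of _ "\<lambda>i. 0"]) (use False triv[OF False \<alpha>] in \<open>auto simp: fun_eq_iff\<close>)
    qed
  qed (use d(1) z(1) in auto)
  then have "most_persistent_bar X ?b d z"
    unfolding most_persistent_bar_def by fastforce
  then show ?thesis unfolding has_bar_def by blast
qed

text \<open>The bar comes from an arbitrary decomposition, so its uniqueness has to be derived from
  the decomposition axioms. At each time holonomy is injective on cohomology, hence at most one
  summand is alive; as all summands are born when the polygon closes, there is only one.\<close>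

lemma most_persistent_bar_step_ordered:
  fixes X :: "'n::{finite,linorder} config"
  assumes n: "3 \<le> CARD('n)" and X: "step_ordered X" and bar: "most_persistent_bar X b d z"
  shows "b < d" and "nontrivial_H1 (VR X t) \<longleftrightarrow> b \<le> t \<and> t < d"
    and "b \<le> t \<Longrightarrow> t < d \<Longrightarrow> z t \<in> cocycles (VR X t) 1 \<and> z t \<notin> coboundaries (VR X t) 1"
proof -
  let ?b = "polygon_scale X"
  note iff = nontrivial_H1_iff[OF n X]
  obtain I bs ds zs i where dec: "interval_decomposition (VR X) 1 I bs ds zs" and i: "i \<in> I"
    and bdz: "b = bs i" "d = ds i" "z = zs i"
    using bar unfolding most_persistent_bar_def by blast
  define alive where "alive t = {i \<in> I. t \<in> {bs i..<ds i}}" for t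
  have fin: "finite (alive t)" for t
    using dec unfolding interval_decomposition_def alive_def by auto
  have lt: "bs j < ds j" if "j \<in> I" for j
    using dec that unfolding interval_decomposition_def by blast
  have cocyc: "zs j t \<in> cocycles (VR X t) 1" if "j \<in> alive t" for j t
    using dec that unfolding interval_decomposition_def alive_def by blast
  have res: "restr (VR X s) (zs j t) - (if bs j \<le> s then zs j s else 0) \<in> coboundaries (VR X s) 1"
    if "j \<in> alive t" "s \<le> t" for j t s
    using dec that unfolding interval_decomposition_def alive_def by blast
  have ex1: "\<exists>!a :: nat \<Rightarrow> real. (\<forall>i. i \<notin> alive t \<longrightarrow> a i = 0) \<and>
      \<alpha> - (\<Sum>i\<in>alive t. a i *\<^sub>R zs i t) \<in> coboundaries (VR X t) 1"
    if "\<alpha> \<in> cocycles (VR X t) 1" for \<alpha> t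
    using dec that unfolding interval_decomposition_def alive_def by simp
  \<comment> \<open>The coefficients of the zero cocycle are unique too, which says that the classes
    alive at \<open>t\<close> are linearly independent.\<close>
  have indep: "a = (\<lambda>_. 0)" if "\<And>i. i \<notin> alive t \<Longrightarrow> a i = 0"
    "(\<Sum>i\<in>alive t. a i *\<^sub>R zs i t) \<in> coboundaries (VR X t) 1" for a t
  proof -
    define Q where "Q a \<longleftrightarrow> (\<forall>i. i \<notin> alive t \<longrightarrow> a i = 0) \<and>
      0 - (\<Sum>i\<in>alive t. a i *\<^sub>R zs i t) \<in> coboundaries (VR X t) 1" for a :: "nat \<Rightarrow> real"
    have "\<exists>!a. Q a"
      unfolding Q_def by (rule ex1) (rule subspace_0[OF subspace_cocycles])
    moreover have "- (\<Sum>i\<in>alive t. a i *\<^sub>R zs i t) \<in> coboundaries (VR X t) 1"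
      using subspace_neg[OF subspace_coboundaries[of "VR X t" 0]] that(2) by simp
    then have "Q a" using that(1) by (simp add: Q_def)
    moreover have "Q (\<lambda>_. 0)" by (simp add: Q_def)
    ultimately show ?thesis by blast
  qed
  have nz: "zs j t \<notin> coboundaries (VR X t) 1" if j: "j \<in> alive t" for j t
  proof
    assume "zs j t \<in> coboundaries (VR X t) 1"
    moreover have "(\<Sum>i\<in>alive t. (if i = j then 1 else 0) *\<^sub>R zs i t) = zs j t"
      using j fin by (simp add: if_distrib[of "\<lambda>c. c *\<^sub>R _"] cong: if_cong)
    ultimately have "(\<lambda>i. if i = j then 1 else 0::real) = (\<lambda>_. 0)"
      using j by (intro indep[of t]) auto
    then show False by (metis zero_neq_one)
  qed
  have nt: "nontrivial_H1 (VR X t)" if "j \<in> alive t" for j t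
    using nz[OF that] cocyc[OF that] by (auto simp: nontrivial_H1_def)
  have hol_nz: "hol (zs j t) \<noteq> 0" if "j \<in> alive t" for j t
    using nz[OF that] cocyc[OF that] nt[OF that] coboundary_iff_hol_VR[OF n X] iff by blast
  have uniq: "j = k" if j: "j \<in> alive t" and k: "k \<in> alive t" for j k t
  proof (rule ccontr)
    assume jk: "j \<noteq> k"
    \<comment> \<open>These coefficients make the two holonomies cancel; independence then forces
      them to vanish.\<close>
    define a where "a i = (if i = j then hol (zs k t) else if i = k then - hol (zs j t) else 0)" for i
    have bt: "?b \<le> t" using nt[OF j] iff by blast
    let ?c = "hol (zs k t) *\<^sub>R zs j t - hol (zs j t) *\<^sub>R zs k t"
    have "(\<Sum>i\<in>alive t. a i *\<^sub>R zs i t) = (\<Sum>i\<in>{j, k}. a i *\<^sub>R zs i t)"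
      using j k fin by (intro sum.mono_neutral_right) (auto simp: a_def)
    also have "\<dots> = ?c" using jk by (simp add: a_def)
    finally have s: "(\<Sum>i\<in>alive t. a i *\<^sub>R zs i t) = ?c" .
    have "?c \<in> cocycles (VR X t) 1"
      by (intro subspace_diff[OF subspace_cocycles] subspace_scale[OF subspace_cocycles] cocyc j k)
    then have "?c \<in> coboundaries (VR X t) 1"
      using coboundary_iff_hol_VR[OF n X bt] by simp
    then have "a = (\<lambda>_. 0)" using j k s by (intro indep[of t]) (auto simp: a_def)
    then have "a j = 0" by simp
    then show False using hol_nz[OF k] by (simp add: a_def)
  qed
  obtain d' where d': "?b < d'" "\<And>t. nontrivial_H1 (VR X t) \<longleftrightarrow> ?b \<le> t \<and> t < d'"
  proof -
    have "i \<in> alive (bs i)" using i lt[OF i] by (simp add: alive_def)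
    from nontrivial_H1_interval[OF n X nt[OF this]] that show thesis by blast
  qed
  \<comment> \<open>A generator born later would restrict to a coboundary at the closing time, yet
    restriction keeps its holonomy, which is nonzero.\<close>
  have born: "bs j = ?b" if j: "j \<in> I" for j
  proof (rule ccontr)
    assume neq: "bs j \<noteq> ?b"
    have aj: "j \<in> alive (bs j)" using j lt by (simp add: alive_def)
    then have lt: "?b < bs j" using nt[OF aj] iff neq by (auto simp: less_le)
    then have "restr (VR X ?b) (zs j (bs j)) \<in> coboundaries (VR X ?b) 1"
      using res[OF aj, of ?b] by simp
    moreover have "restr (VR X ?b) (zs j (bs j)) \<in> cocycles (VR X ?b) 1"
      using lt by (intro restr_cocycle[OF VR_mono flag_VR cocyc[OF aj]]) auto
    ultimately have "hol (restr (VR X ?b) (zs j (bs j))) = 0"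
      using coboundary_iff_hol_VR[OF n X order_refl] by blast
    moreover have "hol (restr (VR X ?b) (zs j (bs j))) = hol (zs j (bs j))"
      by (rule hol_restr) (use polygon_scale_le_iff in auto)
    ultimately show False using hol_nz[OF aj] by simp
  qed
  \<comment> \<open>If the bar ended while cohomology persists, a summand alive at \<open>d\<close>
    would also be alive at the common birth time and thus equal \<open>i\<close>, which has
    ended.\<close>
  have dd: "d = d'"
  proof (rule ccontr)
    assume neq: "d \<noteq> d'"
    have "i \<in> alive t" if "b \<le> t" "t < d" for t using that i bdz by (simp add: alive_def)
    then have sub: "t < d'" if "b \<le> t" "t < d" for t using that nt d'(2) by blast
    have "d \<le> d'"
    proof (rule ccontr)
      assume "\<not> d \<le> d'"
      moreover have "b < d'" using sub[of b] lt[OF i] bdz by simp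
      ultimately show False using sub[of d'] by simp
    qed
    then have "nontrivial_H1 (VR X d)"
      using neq d'(2) born[OF i] bdz lt[OF i] by auto
    then obtain \<alpha> where \<alpha>: "\<alpha> \<in> cocycles (VR X d) 1" "\<alpha> \<notin> coboundaries (VR X d) 1"
      by (auto simp: nontrivial_H1_def)
    have "alive d \<noteq> {}" using ex1[OF \<alpha>(1)] \<alpha>(2) by auto
    then obtain j where j: "j \<in> alive d" by auto
    then have "j \<in> I" "j \<in> alive ?b" "i \<in> alive ?b"
      using born[OF i] born[of j] i lt[OF i] bdz by (auto simp: alive_def)
    then have "j = i" using uniq by blast
    then show False using j bdz by (simp add: alive_def)
  qed
  show "b < d" using lt[OF i] bdz by simp
  show "nontrivial_H1 (VR X t) \<longleftrightarrow> b \<le> t \<and> t < d" using d'(2) dd born[OF i] bdz by simp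
  show "z t \<in> cocycles (VR X t) 1 \<and> z t \<notin> coboundaries (VR X t) 1" if "b \<le> t" "t < d"
    using that i bdz cocyc[of i t] nz[of i t] by (simp add: alive_def)
qed

section \<open>Birth and death cochains\<close>

definition regular_complex :: "'n::{finite,linorder} set set \<Rightarrow> bool" where
  "regular_complex K \<longleftrightarrow> flag K \<and> (\<forall>u. {u, rot u} \<in> K) \<and>
     (\<forall>u v u' v'. {u, v} \<in> K \<longrightarrow> cdist u' v' \<le> cdist u v \<longrightarrow> {u', v'} \<in> K)"

lemma regular_imp_cyclic: "regular_complex K \<Longrightarrow> cyclic_complex K"
  unfolding regular_complex_def cyclic_complex_def by (meson less_imp_le)

lemma regular_edge_cong: "regular_complex K \<Longrightarrow> cdist u v = cdist u' v' \<Longrightarrow> {u, v} \<in> K \<longleftrightarrow> {u', v'} \<in> K"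
  unfolding regular_complex_def by (metis order_refl)

text \<open>The three edges of a triangle then make fewer than \<open>CARD('n)\<close> steps in
  total and cannot wind around the polygon. For regular complexes this amounts to nontrivial
  cohomology (\<open>nontrivial_H1_regular_iff\<close>).\<close>

definition small_steps :: "'n::{finite,linorder} set set \<Rightarrow> bool" where
  "small_steps K \<longleftrightarrow> (\<forall>u v. {u, v} \<in> K \<longrightarrow> 3 * cdist u v < int CARD('n))"

text \<open>Away from antipodal labels the residue \<open>gap u v\<close> has a single integer
  representative of least absolute value, and this is \<open>sstep\<close>.\<close>

lemma sstep_int:
  fixes u v :: "'n::{finite,linorder}"
  assumes "2 * cdist u v < int CARD('n)"
  obtains s where "sstep u v = of_int s" "s mod int CARD('n) = gap u v" "\<bar>s\<bar> = cdist u v"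
proof (cases "2 * gap u v < int CARD('n)")
  case True
  then show ?thesis
    using that[of "gap u v"] gap_less[of u v] by (simp add: sstep_def cdist_def)
next
  case False
  then have "2 * gap u v > int CARD('n)" using assms by (simp add: cdist_def min_def split: if_splits)
  moreover have "(gap u v - int CARD('n)) mod int CARD('n) = gap u v"
    using gap_less[of u v] by simp
  ultimately show ?thesis
    using that[of "gap u v - int CARD('n)"] gap_less[of u v] by (simp add: sstep_def cdist_def)
qed

text \<open>The steps around a triangle add up to a multiple of \<open>CARD('n)\<close>, and the
  bounds leave only 0.\<close>

lemma sstep_cyclic_sum:
  fixes u v w :: "'n::{finite,linorder}"
  assumes "3 * cdist u v < int CARD('n)" "3 * cdist v w < int CARD('n)" "3 * cdist w u < int CARD('n)"
  shows "sstep u v + sstep v w + sstep w u = 0"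
proof -
  have lt: "2 * cdist u v < int CARD('n)" "2 * cdist v w < int CARD('n)" "2 * cdist w u < int CARD('n)"
    using assms cdist_ge_0[of u v] cdist_ge_0[of v w] cdist_ge_0[of w u] by linarith+
  obtain a where a: "sstep u v = of_int a" "a mod int CARD('n) = gap u v" "\<bar>a\<bar> = cdist u v"
    using sstep_int[OF lt(1)] by blast
  obtain b where b: "sstep v w = of_int b" "b mod int CARD('n) = gap v w" "\<bar>b\<bar> = cdist v w"
    using sstep_int[OF lt(2)] by blast
  obtain c where c: "sstep w u = of_int c" "c mod int CARD('n) = gap w u" "\<bar>c\<bar> = cdist w u"
    using sstep_int[OF lt(3)] by blast
  have "(a + b + c) mod int CARD('n) = ((gap u v + gap v w) mod int CARD('n) + gap w u) mod int CARD('n)"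
    by (simp add: mod_simps flip: a b c)
  also have "\<dots> = 0" using gap_trans[of u w v] gap_trans[of u u w] by simp
  finally have "int CARD('n) dvd a + b + c" by (simp add: dvd_eq_mod_eq_0)
  moreover have "\<bar>a + b + c\<bar> < int CARD('n)" using a b c assms by linarith
  ultimately have "a + b + c = 0" using zdvd_not_zless[of "\<bar>a + b + c\<bar>" "int CARD('n)"] by (cases "a + b + c = 0") auto
  then show ?thesis using a b c by (metis of_int_0 of_int_add)
qed

abbreviation step_cochain :: "'n::{finite,linorder} set set \<Rightarrow> 'n cochain" where
  "step_cochain K \<equiv> cochain_of K sstep"

lemma evl_step_cochain: "evl (step_cochain K) u v = (if {u, v} \<in> K then sstep u v else 0)"
  by (rule evl_cochain_of) (rule sstep_swap)

lemma step_cochain_cocycle: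
  fixes K :: "'n::{finite,linorder} set set"
  assumes "flag K" "small_steps K"
  shows "step_cochain K \<in> cocycles K 1"
  unfolding cocycles_1_iff
proof (intro conjI allI impI)
  fix u v w assume "{u, v, w} \<in> K"
  then have e: "{u, v} \<in> K" "{v, w} \<in> K" "{w, u} \<in> K"
    using flag_triple[OF assms(1), of u v w] by (auto simp: insert_commute)
  then show "d3 (step_cochain K) u v w = 0"
    using assms(2) sstep_cyclic_sum[of u v w] unfolding small_steps_def d3_def
    by (simp add: evl_step_cochain)
qed simp

lemma hol_step_cochain:
  fixes K :: "'n::{finite,linorder} set set"
  assumes "3 \<le> CARD('n)" "\<And>u. {u, rot u} \<in> K"
  shows "hol (step_cochain K) = CARD('n)"
proof -
  have "sstep i (rot i) = 1" for i :: 'n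
    using assms(1) gap_rot[of i] by (simp add: sstep_def)
  then show ?thesis using assms(2) by (simp add: hol_def evl_step_cochain)
qed

text \<open>Outgoing and incoming gaps at \<open>v\<close> run through the same residues, so by
  antisymmetry the sum equals its own negative. The step cochain is thus divergence-free.\<close>

lemma sum_sstep:
  fixes v :: "'n::{finite,linorder}"
  assumes "regular_complex K"
  shows "(\<Sum>u\<in>UNIV. evl (step_cochain K) v u) = 0"
proof -
  define h where "h x = evl (step_cochain K) v (lab (pos v + x))" for x :: int
  have h: "evl (step_cochain K) v u = h (gap v u)" for u
    by (simp add: h_def lab_pos_gap)
  have h': "evl (step_cochain K) u v = h (gap u v)" for u
  proof -
    let ?u = "lab (pos v + gap u v) :: 'n"
    have g: "gap v ?u = gap u v" using gap_less[of u v] by (simp add: gap_pos_lab)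
    then have "cdist v ?u = cdist u v" "sstep v ?u = sstep u v" by (simp_all add: cdist_def sstep_def)
    then show ?thesis
      using regular_edge_cong[OF assms, of v ?u u v] by (simp add: h_def evl_step_cochain)
  qed
  have "(\<Sum>u\<in>UNIV. evl (step_cochain K) v u) = (\<Sum>u\<in>UNIV. h (gap v u))" by (simp add: h)
  also have "\<dots> = (\<Sum>u\<in>UNIV. h (gap u v))" by (rule trans[OF sum_gap sum_gap'[symmetric]])
  also have "\<dots> = (\<Sum>u\<in>UNIV. evl (step_cochain K) u v)" by (simp add: h')
  also have "\<dots> = - (\<Sum>u\<in>UNIV. evl (step_cochain K) v u)"
    by (subst evl_swap) (simp add: sum_negf)
  finally show ?thesis by simp
qed

lemma sum_pairs:
  fixes F :: "'n::{finite,linorder} set \<Rightarrow> real"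
  shows "(\<Sum>\<sigma> | card \<sigma> = 2. F \<sigma>) = (\<Sum>u\<in>UNIV. \<Sum>v\<in>UNIV. if u \<noteq> v then F {u, v} else 0) / 2"
proof -
  let ?A = "{(u, v). u < v} :: ('n \<times> 'n) set"
  let ?B = "{(u, v). v < u} :: ('n \<times> 'n) set"
  let ?F = "\<lambda>p. F {fst p, snd p}"
  have "bij_betw (\<lambda>p. {fst p, snd p}) ?A {\<sigma>. card \<sigma> = 2}"
  proof (rule bij_betwI')
    fix \<sigma> :: "'n set" assume "\<sigma> \<in> {\<sigma>. card \<sigma> = 2}"
    then obtain u v where "\<sigma> = {u, v}" "u \<noteq> v" unfolding mem_Collect_eq card_2_iff by blast
    then show "\<exists>p\<in>?A. \<sigma> = {fst p, snd p}"
    proof (cases "u < v")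
      case True
      then show ?thesis using \<open>\<sigma> = {u, v}\<close> by (intro bexI[of _ "(u, v)"]) simp_all
    next
      case False
      then show ?thesis using \<open>\<sigma> = {u, v}\<close> \<open>u \<noteq> v\<close>
        by (intro bexI[of _ "(v, u)"]) (simp_all add: insert_commute)
    qed
  qed (auto simp: doubleton_eq_iff)
  then have 1: "(\<Sum>\<sigma> | card \<sigma> = 2. F \<sigma>) = sum ?F ?A"
    by (rule sum.reindex_bij_betw[symmetric])
  have 2: "sum ?F ?B = sum ?F ?A"
    by (rule sum.reindex_bij_witness[of _ prod.swap prod.swap]) (auto simp: insert_commute[of _ _ "{}"])
  have "(\<Sum>u\<in>UNIV. \<Sum>v\<in>UNIV. if u \<noteq> v then F {u, v} else 0)
      = (\<Sum>p\<in>UNIV. if fst p \<noteq> snd p then ?F p else 0)"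
    by (simp add: sum.cartesian_product case_prod_beta)
  also have "\<dots> = sum ?F (?A \<union> ?B)"
    by (rule sum.mono_neutral_cong_right) auto
  also have "\<dots> = sum ?F ?A + sum ?F ?B"
    by (rule sum.union_disjoint) auto
  finally show ?thesis using 1 2 by simp
qed

lemma inner_cochains:
  fixes \<alpha> \<beta> :: "'n::{finite,linorder} cochain"
  assumes "\<alpha> \<in> cochains K 1"
  shows "\<alpha> \<bullet> \<beta> = (\<Sum>u\<in>UNIV. \<Sum>v\<in>UNIV. evl \<alpha> u v * evl \<beta> u v) / 2"
proof -
  have "\<alpha> \<bullet> \<beta> = (\<Sum>\<sigma> | card \<sigma> = 2. \<alpha> $ \<sigma> * \<beta> $ \<sigma>)"
    unfolding inner_vec_def
    by (rule sum.mono_neutral_cong_right)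
      (use assms in \<open>auto simp: cochains_def simplices_def numeral_2_eq_2\<close>)
  also have "\<dots> = (\<Sum>u\<in>UNIV. \<Sum>v\<in>UNIV. if u \<noteq> v then \<alpha> $ {u, v} * \<beta> $ {u, v} else 0) / 2"
    by (rule sum_pairs)
  also have "\<dots> = (\<Sum>u\<in>UNIV. \<Sum>v\<in>UNIV. evl \<alpha> u v * evl \<beta> u v) / 2"
    by (intro arg_cong[where f = "\<lambda>x. x / 2"] sum.cong refl) (auto simp: evl_def)
  finally show ?thesis .
qed

text \<open>Summation by parts moves the difference operator from the potential to the step cochain,
  whose divergence is zero at every vertex.\<close>

lemma step_cochain_orthogonal:
  fixes K :: "'n::{finite,linorder} set set"
  assumes "3 \<le> CARD('n)" "regular_complex K" "\<beta> \<in> coboundaries K 1"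
  shows "step_cochain K \<bullet> \<beta> = 0"
proof -
  obtain g where g: "\<beta> = cochain_of K (\<lambda>u v. g v - g u)"
    using assms coboundaries_1_iff[of K] cyclic_vertex[OF assms(1) regular_imp_cyclic] by metis
  let ?e = "\<lambda>u v. evl (step_cochain K) u v"
  have "?e u v * evl \<beta> u v = ?e u v * g v - ?e u v * g u" for u v
    by (simp add: g evl_exact evl_step_cochain algebra_simps)
  then have "(\<Sum>u\<in>UNIV. \<Sum>v\<in>UNIV. ?e u v * evl \<beta> u v)
      = (\<Sum>u\<in>UNIV. \<Sum>v\<in>UNIV. ?e u v * g v) - (\<Sum>u\<in>UNIV. \<Sum>v\<in>UNIV. ?e u v * g u)"
    by (simp add: sum_subtractf)
  also have "(\<Sum>u\<in>UNIV. \<Sum>v\<in>UNIV. ?e u v * g v) = (\<Sum>v\<in>UNIV. \<Sum>u\<in>UNIV. - (?e v u * g v))"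
    by (subst sum.swap, intro sum.cong refl) (subst evl_swap, simp)
  also have "\<dots> = - (\<Sum>v\<in>UNIV. (\<Sum>u\<in>UNIV. ?e v u) * g v)" by (simp add: sum_negf sum_distrib_right)
  also have "\<dots> = 0" by (simp add: sum_sstep[OF assms(2)])
  also have "(\<Sum>u\<in>UNIV. \<Sum>v\<in>UNIV. ?e u v * g u) = (\<Sum>u\<in>UNIV. (\<Sum>v\<in>UNIV. ?e u v) * g u)"
    by (simp add: sum_distrib_right)
  also have "\<dots> = 0" by (simp add: sum_sstep[OF assms(2)])
  finally show ?thesis using inner_cochains[of "step_cochain K" K \<beta>] by simp
qed

lemma cocycle_minus_step_cochain:
  fixes K :: "'n::{finite,linorder} set set"
  assumes "3 \<le> CARD('n)" "regular_complex K" "small_steps K" "\<alpha> \<in> cocycles K 1"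
  shows "\<alpha> - (hol \<alpha> / CARD('n)) *\<^sub>R step_cochain K \<in> coboundaries K 1"
proof (rule hol_zero_imp_coboundary[OF assms(1) regular_imp_cyclic[OF assms(2)]])
  show "\<alpha> - (hol \<alpha> / CARD('n)) *\<^sub>R step_cochain K \<in> cocycles K 1"
    using assms step_cochain_cocycle[of K]
    by (intro subspace_diff[OF subspace_cocycles] subspace_scale[OF subspace_cocycles])
      (auto simp: regular_complex_def)
  show "hol (\<alpha> - (hol \<alpha> / CARD('n)) *\<^sub>R step_cochain K) = 0"
    using hol_step_cochain[OF assms(1), of K] assms(2) by (simp add: regular_complex_def)
qed

lemma subspace_coboundaries_1: "subspace (coboundaries K 1)"
  using subspace_coboundaries[of K 0] by simp

text \<open>\<open>K\<close> has no edges, so vanishing on \<open>K\<close> is no constraint and the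
  minimizer is the harmonic representative, a multiple of the step cochain. Orthogonality to
  coboundaries gives uniqueness by Pythagoras.\<close>

lemma birth_cochain_regular:
  fixes L :: "'n::{finite,linorder} set set"
  assumes n: "3 \<le> CARD('n)" and L: "regular_complex L" "small_steps L"
    and K: "\<And>u v. u \<noteq> v \<Longrightarrow> {u, v} \<notin> K" and \<alpha>: "\<alpha> \<in> cocycles L 1"
  shows "birth_cochain K L 1 \<alpha> = (hol \<alpha> / CARD('n)) *\<^sub>R step_cochain L"
proof -
  let ?\<eta> = "(hol \<alpha> / CARD('n)) *\<^sub>R step_cochain L"
  have \<eta>L: "?\<eta> \<in> cochains L 1" by (simp add: cochains_def cochain_of_def)
  have diff: "\<alpha> - ?\<eta> \<in> coboundaries L 1" by (rule cocycle_minus_step_cochain[OF n L \<alpha>])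
  have res: "restr K \<beta> = 0" if "\<beta> \<in> cochains L 1" for \<beta>
  proof -
    have "restr K \<beta> $ \<sigma> = 0" for \<sigma>
    proof (cases "\<sigma> \<in> K \<and> \<sigma> \<in> simplices L 1")
      case True
      then show ?thesis using K simplices_1_iff[of \<sigma> L] by (metis less_irrefl)
    qed (use that in \<open>auto simp: restr_def cochains_def\<close>)
    then show ?thesis by (simp add: vec_eq_iff)
  qed
  have min: "norm ?\<eta> \<le> norm \<alpha>' \<and> (norm \<alpha>' \<le> norm ?\<eta> \<longrightarrow> \<alpha>' = ?\<eta>)" if "\<alpha>' \<in> coh_class L 1 \<alpha>" for \<alpha>'
  proof -
    have "(\<alpha>' - \<alpha>) + (\<alpha> - ?\<eta>) \<in> coboundaries L 1"
      using that by (intro subspace_add[OF subspace_coboundaries_1] diff) (simp add: coh_class_def)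
    then have c: "\<alpha>' - ?\<eta> \<in> coboundaries L 1" by simp
    have "?\<eta> \<bullet> (\<alpha>' - ?\<eta>) = 0" using step_cochain_orthogonal[OF n L(1) c] by simp
    then have "(norm \<alpha>')\<^sup>2 = (norm ?\<eta>)\<^sup>2 + (norm (\<alpha>' - ?\<eta>))\<^sup>2"
      using norm_add_Pythagorean[of ?\<eta> "\<alpha>' - ?\<eta>"] by (simp add: orthogonal_def)
    then show ?thesis
      by (smt (verit) norm_ge_zero power_mono right_minus_eq zero_less_norm_iff zero_less_power zero_le_power)
  qed
  have "?\<eta> - \<alpha> \<in> coboundaries L 1"
    using subspace_neg[OF subspace_coboundaries_1 diff] by simp
  then have in_class: "?\<eta> \<in> coh_class L 1 \<alpha>" using \<eta>L by (simp add: coh_class_def)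
  show ?thesis
    unfolding birth_cochain_def
  proof (rule the_equality)
    show "?\<eta> \<in> coh_class L 1 \<alpha> \<and> restr K ?\<eta> = 0 \<and>
        (\<forall>\<alpha>'\<in>coh_class L 1 \<alpha>. restr K \<alpha>' = 0 \<longrightarrow> norm ?\<eta> \<le> norm \<alpha>')"
      using in_class res[OF \<eta>L] min by blast
    fix \<eta>' assume \<eta>': "\<eta>' \<in> coh_class L 1 \<alpha> \<and> restr K \<eta>' = 0 \<and>
        (\<forall>\<alpha>'\<in>coh_class L 1 \<alpha>. restr K \<alpha>' = 0 \<longrightarrow> norm \<eta>' \<le> norm \<alpha>')"
    then have "norm \<eta>' \<le> norm ?\<eta>" using in_class res[OF \<eta>L] by blast
    then show "\<eta>' = ?\<eta>" using \<eta>' min by blast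
  qed
qed

section \<open>Death cochains as points of smallest norm in an affine space\<close>

definition extension_coboundaries ::
  "'n::{finite,linorder} set set \<Rightarrow> 'n set set \<Rightarrow> 'n cochain \<Rightarrow> 'n cochain set" where
  "extension_coboundaries K L \<beta> = coboundary L 1 ` {\<gamma> \<in> cochains L 1. restr K \<gamma> = \<beta>}"

lemma closed_convex_extension_coboundaries:
  shows "closed (extension_coboundaries K L \<beta>)" "convex (extension_coboundaries K L \<beta>)"
proof -
  have lin: "linear (restr K)" by (rule linearI) (simp_all add: restr_def vec_eq_iff)
  have aff: "u *\<^sub>R \<gamma> + v *\<^sub>R \<gamma>' \<in> {\<gamma> \<in> cochains L 1. restr K \<gamma> = \<beta>}"
    if "\<gamma> \<in> {\<gamma> \<in> cochains L 1. restr K \<gamma> = \<beta>}" "\<gamma>' \<in> {\<gamma> \<in> cochains L 1. restr K \<gamma> = \<beta>}"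
      "u + v = 1" for \<gamma> \<gamma>' u v
    using that
    by (auto simp: cochains_def linear_add[OF lin] linear_scale[OF lin] simp flip: scaleR_left_distrib)
  have aff': "affine (extension_coboundaries K L \<beta>)"
    unfolding affine_def extension_coboundaries_def
  proof (intro ballI allI impI, elim imageE)
    fix x y u v \<gamma> \<gamma>' assume h: "u + v = (1::real)" "x = coboundary L 1 \<gamma>" "y = coboundary L 1 \<gamma>'"
      "\<gamma> \<in> {\<gamma> \<in> cochains L 1. restr K \<gamma> = \<beta>}" "\<gamma>' \<in> {\<gamma> \<in> cochains L 1. restr K \<gamma> = \<beta>}"
    have "u *\<^sub>R x + v *\<^sub>R y = coboundary L 1 (u *\<^sub>R \<gamma> + v *\<^sub>R \<gamma>')"
      by (simp only: h coboundary_linear)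
    then show "u *\<^sub>R x + v *\<^sub>R y \<in> coboundary L 1 ` {\<gamma> \<in> cochains L 1. restr K \<gamma> = \<beta>}"
      using aff[OF h(4,5,1)] by (rule image_eqI)
  qed
  then show "closed (extension_coboundaries K L \<beta>)" by (rule affine_closed)
  show "convex (extension_coboundaries K L \<beta>)" using aff' by (rule affine_imp_convex)
qed

text \<open>The minimizing extension need not be unique, but the coboundaries of all extensions form
  a closed convex set, whose point closest to 0 is unique.\<close>

lemma death_cochain_eqI:
  assumes "\<omega> \<in> extension_coboundaries K L \<beta>"
    and "\<And>\<omega>'. \<omega>' \<in> extension_coboundaries K L \<beta> \<Longrightarrow> norm \<omega> \<le> norm \<omega>'"
  shows "death_cochain K L 1 \<beta> = \<omega>"
  unfolding death_cochain_def
proof (rule the_equality)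
  show "\<exists>\<gamma>. \<gamma> \<in> cochains L 1 \<and> restr K \<gamma> = \<beta> \<and>
      (\<forall>\<beta>'\<in>cochains L 1. restr K \<beta>' = \<beta> \<longrightarrow> norm (coboundary L 1 \<gamma>) \<le> norm (coboundary L 1 \<beta>')) \<and>
      \<omega> = coboundary L 1 \<gamma>"
    using assms unfolding extension_coboundaries_def by blast
  fix \<omega>' assume "\<exists>\<gamma>. \<gamma> \<in> cochains L 1 \<and> restr K \<gamma> = \<beta> \<and>
      (\<forall>\<beta>'\<in>cochains L 1. restr K \<beta>' = \<beta> \<longrightarrow> norm (coboundary L 1 \<gamma>) \<le> norm (coboundary L 1 \<beta>')) \<and>
      \<omega>' = coboundary L 1 \<gamma>"
  then have "\<omega>' \<in> extension_coboundaries K L \<beta>" "\<And>\<omega>. \<omega> \<in> extension_coboundaries K L \<beta> \<Longrightarrow> norm \<omega>' \<le> norm \<omega>"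
    unfolding extension_coboundaries_def by blast+
  then have "\<omega>' = closest_point (extension_coboundaries K L \<beta>) 0"
    "\<omega> = closest_point (extension_coboundaries K L \<beta>) 0"
    using assms by (auto intro!: closest_point_unique closed_convex_extension_coboundaries)
  then show "\<omega>' = \<omega>" by simp
qed

lemma death_cochain_in:
  assumes "extension_coboundaries K L \<beta> \<noteq> {}"
  shows "death_cochain K L 1 \<beta> \<in> extension_coboundaries K L \<beta>"
    and "\<And>\<omega>. \<omega> \<in> extension_coboundaries K L \<beta> \<Longrightarrow> norm (death_cochain K L 1 \<beta>) \<le> norm \<omega>"
proof -
  obtain \<omega> where "\<omega> \<in> extension_coboundaries K L \<beta>"
    "\<And>\<omega>'. \<omega>' \<in> extension_coboundaries K L \<beta> \<Longrightarrow> norm \<omega> \<le> norm \<omega>'"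
    using distance_attains_inf[OF closed_convex_extension_coboundaries(1) assms, of 0] by auto
  moreover from this have "death_cochain K L 1 \<beta> = \<omega>" by (rule death_cochain_eqI)
  ultimately show "death_cochain K L 1 \<beta> \<in> extension_coboundaries K L \<beta>"
    "\<And>\<omega>. \<omega> \<in> extension_coboundaries K L \<beta> \<Longrightarrow> norm (death_cochain K L 1 \<beta>) \<le> norm \<omega>" by auto
qed

lemma restr_cochains_id: "\<beta> \<in> cochains K k \<Longrightarrow> restr K \<beta> = \<beta>"
  by (auto simp: vec_eq_iff restr_def cochains_def simplices_def)

lemma extension_coboundaries_nonempty:
  assumes "K \<subseteq> L" "\<beta> \<in> cochains K 1"
  shows "extension_coboundaries K L \<beta> \<noteq> {}"
proof -
  have "\<beta> \<in> cochains L 1" using assms by (auto simp: cochains_def simplices_def)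
  then show ?thesis using restr_cochains_id[OF assms(2)] by (auto simp: extension_coboundaries_def)
qed

lemma restr_linear:
  "restr K (\<alpha> + \<beta>) = restr K \<alpha> + restr K \<beta>" "restr K (c *\<^sub>R \<alpha>) = c *\<^sub>R restr K \<alpha>"
  by (simp_all add: restr_def vec_eq_iff)

text \<open>The potential of the exact part \<tau> also defines an exact cochain on
  \<open>L\<close>. It extends \<tau> and has zero coboundary, so only the scalar acts on the
  coboundaries of extensions.\<close>

lemma extension_coboundaries_cohomologous:
  fixes K L :: "'n::{finite,linorder} set set"
  assumes KL: "K \<subseteq> L" and vert: "\<And>v. {v} \<in> K" and "flag L" and \<tau>: "\<tau> \<in> coboundaries K 1"
    and \<omega>: "\<omega> \<in> extension_coboundaries K L \<beta>"
  shows "c *\<^sub>R \<omega> \<in> extension_coboundaries K L (c *\<^sub>R \<beta> + \<tau>)"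
proof -
  obtain g where g: "\<tau> = cochain_of K (\<lambda>u v. g v - g u)"
    using \<tau> coboundaries_1_iff[of K] vert by metis
  define \<tau>' where "\<tau>' = cochain_of L (\<lambda>u v. g v - g u)"
  have r: "restr K \<tau>' = \<tau>"
    using KL by (auto simp: g \<tau>'_def vec_eq_iff restr_def cochain_of_def simplices_def)
  have d: "coboundary L 1 \<tau>' = 0"
    unfolding coboundary_1_eq_0_iff
  proof (intro allI impI)
    fix u v w assume "{u, v, w} \<in> L"
    then have "{u, v} \<in> L" "{v, w} \<in> L" "{w, u} \<in> L"
      using flag_triple[OF \<open>flag L\<close>, of u v w] by (auto simp: insert_commute)
    then show "d3 \<tau>' u v w = 0" by (simp add: d3_def \<tau>'_def evl_exact)
  qed
  obtain \<gamma> where \<gamma>: "\<gamma> \<in> cochains L 1" "restr K \<gamma> = \<beta>" "\<omega> = coboundary L 1 \<gamma>"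
    using \<omega> by (auto simp: extension_coboundaries_def)
  have "c *\<^sub>R \<gamma> + \<tau>' \<in> cochains L 1" using \<gamma>(1) by (auto simp: \<tau>'_def cochains_def cochain_of_def)
  moreover have "restr K (c *\<^sub>R \<gamma> + \<tau>') = c *\<^sub>R \<beta> + \<tau>" by (simp add: restr_linear \<gamma> r)
  moreover have "coboundary L 1 (c *\<^sub>R \<gamma> + \<tau>') = c *\<^sub>R \<omega>" using d \<gamma>(3) by (simp add: coboundary_linear)
  ultimately show ?thesis unfolding extension_coboundaries_def by force
qed

text \<open>\<beta> is a multiple of the step cochain up to a coboundary. Minimality is transported
  back with the inverse scalar, which is where the nonzero holonomy enters.\<close>

lemma death_cochain_regular:
  fixes K L :: "'n::{finite,linorder} set set"
  assumes n: "3 \<le> CARD('n)" and K: "regular_complex K" "small_steps K" and KL: "K \<subseteq> L" and L: "flag L"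
    and \<beta>: "\<beta> \<in> cocycles K 1" "hol \<beta> \<noteq> 0"
  shows "death_cochain K L 1 \<beta> = (hol \<beta> / CARD('n)) *\<^sub>R death_cochain K L 1 (step_cochain K)"
proof -
  let ?c = "hol \<beta> / CARD('n)" and ?s = "step_cochain K"
  have c: "?c \<noteq> 0" using \<beta> by simp
  note vert = cyclic_vertex[OF n regular_imp_cyclic[OF K(1)]]
  define \<tau> where "\<tau> = \<beta> - ?c *\<^sub>R ?s"
  have \<tau>: "\<tau> \<in> coboundaries K 1" unfolding \<tau>_def by (rule cocycle_minus_step_cochain[OF n K \<beta>(1)])
  have \<tau>': "- (1 / ?c) *\<^sub>R \<tau> \<in> coboundaries K 1"
    by (rule subspace_scale[OF subspace_coboundaries_1 \<tau>])
  note in_s = death_cochain_in[OF extension_coboundaries_nonempty[OF KL cochain_of_in_cochains(1)[of K sstep]]]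
  show ?thesis
  proof (rule death_cochain_eqI)
    have "?c *\<^sub>R death_cochain K L 1 ?s \<in> extension_coboundaries K L (?c *\<^sub>R ?s + \<tau>)"
      by (rule extension_coboundaries_cohomologous[OF KL vert L \<tau> in_s(1)])
    then show "?c *\<^sub>R death_cochain K L 1 ?s \<in> extension_coboundaries K L \<beta>" by (simp add: \<tau>_def)
    fix \<omega>' assume "\<omega>' \<in> extension_coboundaries K L \<beta>"
    then have "(1 / ?c) *\<^sub>R \<omega>' \<in> extension_coboundaries K L ((1 / ?c) *\<^sub>R \<beta> + - (1 / ?c) *\<^sub>R \<tau>)"
      by (rule extension_coboundaries_cohomologous[OF KL vert L \<tau>'])
    also have "(1 / ?c) *\<^sub>R \<beta> + - (1 / ?c) *\<^sub>R \<tau> = ?s" using c by (simp add: \<tau>_def algebra_simps)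
    finally have "norm (death_cochain K L 1 ?s) \<le> norm ((1 / ?c) *\<^sub>R \<omega>')" by (rule in_s(2))
    then have "\<bar>?c\<bar> * norm (death_cochain K L 1 ?s) \<le> \<bar>?c\<bar> * norm ((1 / ?c) *\<^sub>R \<omega>')"
      by (rule mult_left_mono) simp
    also have "\<dots> = norm \<omega>'" using c by simp
    finally show "norm (?c *\<^sub>R death_cochain K L 1 ?s) \<le> norm \<omega>'" by simp
  qed
qed

section \<open>Regular polygons\<close>

definition polygon :: "real \<Rightarrow> 'n::{finite,linorder} config" where
  "polygon r = (\<chi> i. vector [r * cos (2 * pi * of_int (pos i) / CARD('n)),
     r * sin (2 * pi * of_int (pos i) / CARD('n))])"

lemma regular_polygon_polygon:
  assumes "3 \<le> CARD('n)" "0 < r"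
  shows "regular_polygon (polygon r :: 'n::{finite,linorder} config)"
  unfolding regular_polygon_def polygon_def pos_def
  using assms by (intro conjI exI[of _ r] exI[of _ 0]) auto

lemma polygon_scaleR: "polygon (c * r) = c *\<^sub>R polygon r"
  by (simp add: polygon_def vec_eq_iff forall_2)

lemma vec2_norm_power2: "(norm (x :: real ^ 2))\<^sup>2 = (x $ 1)\<^sup>2 + (x $ 2)\<^sup>2"
  by (simp add: norm_eq_sqrt_inner inner_vec_def sum_2 power2_eq_square)

text \<open>The edge length on the unit circle. Using \<open>cdist\<close> instead of
  \<open>gap\<close> keeps the argument in the range where the sine increases.\<close>

definition chord :: "'n::{finite,linorder} \<Rightarrow> 'n \<Rightarrow> real" where
  "chord u v = 2 * sin (pi * of_int (cdist u v) / CARD('n))"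

lemma sin_gap_eq_chord:
  fixes u v :: "'n::{finite,linorder}"
  shows "2 * sin (pi * of_int (gap u v) / CARD('n)) = chord u v"
proof (cases "cdist u v = gap u v")
  case False
  then have "cdist u v = int CARD('n) - gap u v" by (auto simp: cdist_def min_def)
  then have c: "real_of_int (cdist u v) = real CARD('n) - of_int (gap u v)" by simp
  have "pi * of_int (cdist u v) / CARD('n) = pi - pi * of_int (gap u v) / CARD('n)"
    unfolding c by (simp add: field_simps)
  then show ?thesis unfolding chord_def by (metis sin_pi_minus)
qed (simp add: chord_def)

lemma abs_sin_gap:
  fixes u v :: "'n::{finite,linorder}"
  shows "\<bar>sin (pi * of_int (pos v - pos u) / CARD('n))\<bar> = sin (pi * of_int (gap u v) / CARD('n))"
proof -
  let ?n = "CARD('n)"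
  have ge: "0 \<le> sin (pi * of_int (gap u v) / ?n)"
  proof (rule sin_ge_zero)
    have "pi * of_int (gap u v) \<le> pi * of_int (int ?n)"
      using gap_less[of u v] by (intro mult_left_mono) simp_all
    then show "pi * of_int (gap u v) / ?n \<le> pi" by (simp add: field_simps)
  qed simp
  have "pos v - pos u = gap u v \<or> pos v - pos u = gap u v - int ?n"
  proof (cases "pos u \<le> pos v")
    case True
    moreover have "pos v - pos u < int ?n" using pos_less_card[of v] pos_ge_0[of u] by linarith
    ultimately show ?thesis by (simp add: gap_def)
  next
    case False
    then have "(pos v - pos u + int ?n) mod int ?n = pos v - pos u + int ?n"
      using pos_less_card[of u] pos_ge_0[of v] by (intro mod_pos_pos_trivial) linarith+
    then show ?thesis by (simp add: gap_def)
  qed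
  then show ?thesis
  proof
    assume "pos v - pos u = gap u v"
    then show ?thesis using ge by simp
  next
    assume "pos v - pos u = gap u v - int ?n"
    then have c: "real_of_int (pos v - pos u) = of_int (gap u v) - real ?n" by simp
    have "pi * of_int (pos v - pos u) / ?n = pi * of_int (gap u v) / ?n - pi"
      unfolding c by (simp add: field_simps)
    then show ?thesis using ge by simp
  qed
qed

lemma dist_polygon:
  fixes u v :: "'n::{finite,linorder}"
  assumes "0 \<le> r"
  shows "dist (polygon r $ u) (polygon r $ v :: real ^ 2) = r * chord u v"
proof -
  define a b where "a = 2 * pi * of_int (pos u) / CARD('n)" and "b = 2 * pi * of_int (pos v) / CARD('n)"
  define h where "h = pi * of_int (pos v - pos u) / CARD('n)"
  have h: "b - a = 2 * h" by (simp add: a_def b_def h_def field_simps)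
  have "(dist (polygon r $ u) (polygon r $ v :: real ^ 2))\<^sup>2
      = (r * cos a - r * cos b)\<^sup>2 + (r * sin a - r * sin b)\<^sup>2"
    by (simp add: dist_norm vec2_norm_power2 polygon_def a_def b_def)
  also have "\<dots> = r\<^sup>2 * ((cos a)\<^sup>2 + (sin a)\<^sup>2) + r\<^sup>2 * ((cos b)\<^sup>2 + (sin b)\<^sup>2)
      - 2 * r\<^sup>2 * (cos b * cos a + sin b * sin a)"
    by algebra
  also have "\<dots> = 2 * r\<^sup>2 - 2 * r\<^sup>2 * cos (b - a)"
    unfolding cos_diff sin_cos_squared_add2 by simp
  also have "\<dots> = (r * (2 * \<bar>sin h\<bar>))\<^sup>2"
    unfolding h cos_double_sin by (simp add: power_mult_distrib algebra_simps)
  finally have "dist (polygon r $ u) (polygon r $ v :: real ^ 2) = r * (2 * \<bar>sin h\<bar>)"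
    using assms by (simp add: power2_eq_iff_nonneg)
  then show ?thesis using abs_sin_gap[of v u] sin_gap_eq_chord[of u v] by (simp add: h_def)
qed

lemma chord_less_iff: "chord u v < chord u' v' \<longleftrightarrow> cdist u v < cdist u' v'"
  for u v u' v' :: "'n::{finite,linorder}"
proof -
  have "pi * of_int (cdist x y) / CARD('n) \<in> {- (pi / 2)..pi / 2}" for x y :: 'n
  proof -
    have "pi * of_int (2 * cdist x y) \<le> pi * of_int (int CARD('n))"
      using cdist_half[of x y] by (intro mult_left_mono) simp_all
    then have "pi * of_int (cdist x y) / CARD('n) \<le> pi / 2" by (simp add: field_simps)
    moreover have "0 \<le> pi * of_int (cdist x y) / CARD('n)" by simp
    ultimately show ?thesis using pi_ge_zero by (auto intro: order_trans[of _ 0])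
  qed
  then have "chord u v < chord u' v' \<longleftrightarrow> pi * of_int (cdist u v) / CARD('n) < pi * of_int (cdist u' v') / CARD('n)"
    unfolding chord_def by (simp add: sin_mono_less_eq del: times_divide_eq_right)
  then show ?thesis by (simp add: divide_less_cancel)
qed

lemma chord_le_iff: "chord u v \<le> chord u' v' \<longleftrightarrow> cdist u v \<le> cdist u' v'"
  for u v u' v' :: "'n::{finite,linorder}"
  using chord_less_iff[of u' v' u v] by linarith

lemma chord_refl [simp]: "chord u u = 0"
  by (simp add: chord_def)

lemma step_ordered_polygon: "0 < r \<Longrightarrow> step_ordered (polygon r)"
  by (simp add: step_ordered_def dist_polygon chord_less_iff)

lemma regular_complex_polygon:
  assumes r: "0 < r" and t: "polygon_scale (polygon r :: 'n::{finite,linorder} config) \<le> t"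
  shows "regular_complex (VR (polygon r :: 'n config) t)"
  unfolding regular_complex_def
proof (intro conjI allI impI)
  show "{u, rot u} \<in> VR (polygon r) t" for u :: 'n
    using t by (simp add: polygon_scale_le_iff)
  fix u v u' v' :: 'n assume "{u, v} \<in> VR (polygon r) t" "cdist u' v' \<le> cdist u v"
  then have "r * chord u v \<le> t" "r * chord u' v' \<le> r * chord u v"
    using r by (simp_all add: dist_polygon chord_le_iff)
  then have "r * chord u' v' \<le> t" by linarith
  then show "{u', v'} \<in> VR (polygon r) t" using r by (simp add: dist_polygon)
qed (rule flag_VR)

lemma polygon_scale_polygon:
  assumes "3 \<le> CARD('n)" "0 \<le> r"
  shows "polygon_scale (polygon r :: 'n::{finite,linorder} config) = r * (2 * sin (pi / CARD('n)))"
proof -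
  have "dist (polygon r $ i) (polygon r $ rot i) = r * (2 * sin (pi / CARD('n)))" for i :: 'n
    using assms by (simp add: dist_polygon chord_def cdist_rot)
  then show ?thesis by (simp add: polygon_scale_def)
qed

section \<open>Cohomology of regular complexes\<close>

lemma cocycle_d3:
  fixes \<alpha> :: "'n::{finite,linorder} cochain"
  assumes "flag K" "\<And>v. {v} \<in> K" "\<alpha> \<in> cocycles K 1" "{u, v} \<in> K" "{v, w} \<in> K" "{u, w} \<in> K"
  shows "d3 \<alpha> u v w = 0"
proof (cases "u \<noteq> v \<and> v \<noteq> w \<and> u \<noteq> w")
  case True
  then show ?thesis
    using assms(3) flag_triple[OF assms(1), of u v w] assms(2,4,5,6) unfolding cocycles_1_iff by blast
next
  case False
  then show ?thesis using evl_swap[of \<alpha> u v] evl_swap[of \<alpha> u w] by (auto simp: d3_def)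
qed

text \<open>If an edge of \<open>k\<close> steps with \<open>3 * k \<ge> CARD('n)\<close> is
  present, the triangle at positions 0, \<open>k\<close> and \<open>2 * k\<close> lies in
  \<open>K\<close>. Each of its sides carries the sum of the cocycle over the polygon sides that it
  cuts off, so the holonomy is the circulation around this triangle, which is 0.\<close>

lemma small_steps_of_cocycle:
  fixes K :: "'n::{finite,linorder} set set"
  assumes n: "3 \<le> CARD('n)" and K: "regular_complex K" and \<alpha>: "\<alpha> \<in> cocycles K 1" and h: "hol \<alpha> \<noteq> 0"
  shows "small_steps K"
proof (rule ccontr)
  assume "\<not> small_steps K"
  then obtain u v where uv: "{u, v} \<in> K" "3 * cdist u v \<ge> int CARD('n)"
    by (auto simp: small_steps_def not_less)
  define k where "k = nat (cdist u v)"
  have k: "int k = cdist u v" by (simp add: k_def)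
  have kn: "CARD('n) \<le> 3 * k" "2 * k \<le> CARD('n)" using uv(2) cdist_half[of u v] k by linarith+
  have flag: "flag K" and near: "\<And>x y. cdist x y \<le> int k \<Longrightarrow> {x, y} \<in> K"
    using K uv(1) unfolding regular_complex_def k by blast+
  have vert: "{v} \<in> K" for v using near[of v v] by simp
  define P where "P x = (lab (int x) :: 'n)" for x
  have edge: "{P x, P (x + i)} \<in> K" if "i \<le> k" for x i
  proof (rule near)
    have "gap (P x) (P (x + i)) = int i mod int CARD('n)" by (simp add: gap_def P_def mod_simps)
    also have "\<dots> \<le> int i" by (rule zmod_le_nonneg_dividend) simp
    finally show "cdist (P x) (P (x + i)) \<le> int k" using that by (simp add: cdist_def)
  qed
  \<comment> \<open>A fan of triangles with apex \<open>P x\<close> breaks the chord into polygon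
    sides.\<close>
  have path: "evl \<alpha> (P x) (P (x + i)) = (\<Sum>s<i. evl \<alpha> (P (x + s)) (P (x + Suc s)))" if "i \<le> k" for x i
    using that
  proof (induction i)
    case (Suc i)
    have "1 \<le> k" using Suc.prems by simp
    have "d3 \<alpha> (P x) (P (x + i)) (P (x + Suc i)) = 0"
      using edge[of i x] edge[of 1 "x + i"] edge[of "Suc i" x] Suc.prems
      by (intro cocycle_d3[OF flag vert \<alpha>]) auto
    then show ?case using Suc evl_swap[of \<alpha> "P x" "P (x + Suc i)"] by (simp add: d3_def)
  qed simp
  let ?n = "CARD('n)"
  have Pn: "P ?n = P 0" by (simp add: P_def lab_def)
  \<comment> \<open>Here \<open>CARD('n) \<le> 3 * k\<close> enters: the way back to position 0 has
    at most \<open>k\<close> steps.\<close>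
  have e2: "{P (2 * k), P 0} \<in> K" using edge[of "?n - 2 * k" "2 * k"] kn by (simp add: Pn)
  have "d3 \<alpha> (P 0) (P k) (P (2 * k)) = 0"
    using edge[of k 0] edge[of k k] e2
    by (intro cocycle_d3[OF flag vert \<alpha>]) (auto simp: mult_2 insert_commute)
  moreover have "evl \<alpha> (P 0) (P k) = (\<Sum>s\<in>{0..<k}. evl \<alpha> (P s) (P (Suc s)))"
    using path[of k 0] by (simp add: atLeast0LessThan)
  moreover have "evl \<alpha> (P k) (P (2 * k)) = (\<Sum>s\<in>{k..<2 * k}. evl \<alpha> (P s) (P (Suc s)))"
    using path[of k k] sum.shift_bounds_nat_ivl[of "\<lambda>s. evl \<alpha> (P s) (P (Suc s))" 0 k k]
    by (simp add: atLeast0LessThan mult_2 add.commute)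
  moreover have "evl \<alpha> (P (2 * k)) (P 0) = (\<Sum>s\<in>{2 * k..<?n}. evl \<alpha> (P s) (P (Suc s)))"
    using path[of "?n - 2 * k" "2 * k"] kn Pn
      sum.shift_bounds_nat_ivl[of "\<lambda>s. evl \<alpha> (P s) (P (Suc s))" 0 "2 * k" "?n - 2 * k"]
    by (simp add: atLeast0LessThan add.commute)
  ultimately have "0 = (\<Sum>s\<in>{0..<k}. evl \<alpha> (P s) (P (Suc s))) + (\<Sum>s\<in>{k..<2 * k}. evl \<alpha> (P s) (P (Suc s)))
      + (\<Sum>s\<in>{2 * k..<?n}. evl \<alpha> (P s) (P (Suc s)))"
    by (simp add: d3_def)
  also have "\<dots> = (\<Sum>s\<in>{0..<?n}. evl \<alpha> (P s) (P (Suc s)))"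
    using kn by (simp add: sum.atLeastLessThan_concat)
  also have "\<dots> = hol \<alpha>"
    unfolding hol_def
  proof (rule sum.reindex_bij_witness[of _ "\<lambda>i. nat (pos i)" P])
    fix i :: 'n
    show "nat (pos i) \<in> {0..<?n}" using pos_less_card[of i] by (simp add: nat_less_iff)
  next
    fix s assume "s \<in> {0..<?n}"
    then show "evl \<alpha> (P s) (rot (P s)) = evl \<alpha> (P s) (P (Suc s))" by (simp add: P_def rot_def add.commute)
  qed (auto simp: P_def)
  finally show False using h by simp
qed

lemma nontrivial_H1_regular_iff:
  fixes K :: "'n::{finite,linorder} set set"
  assumes n: "3 \<le> CARD('n)" and K: "regular_complex K"
  shows "nontrivial_H1 K \<longleftrightarrow> small_steps K"
proof
  assume "nontrivial_H1 K"
  then show "small_steps K"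
    using small_steps_of_cocycle[OF n K] coboundary_iff_hol[OF n regular_imp_cyclic[OF K]]
    unfolding nontrivial_H1_def by blast
next
  assume "small_steps K"
  then have "step_cochain K \<in> cocycles K 1" using K by (intro step_cochain_cocycle) (auto simp: regular_complex_def)
  moreover have "hol (step_cochain K) \<noteq> 0"
    using hol_step_cochain[OF n, of K] K by (auto simp: regular_complex_def)
  ultimately show "nontrivial_H1 K"
    using coboundary_iff_hol[OF n regular_imp_cyclic[OF K]] unfolding nontrivial_H1_def by blast
qed

text \<open>A minimizing extension, pulled back along the symmetry with the sign \<open>s\<close>
  that it induces on steps (1 for rotations, -1 for flips), again extends the step cochain, and its
  coboundary has the same norm. Uniqueness of the minimum does the rest.\<close>

lemma death_cochain_symmetric:
  fixes K L :: "'n::{finite,linorder} set set" and \<pi> :: "'n \<Rightarrow> 'n"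
  assumes \<pi>: "bij \<pi>" and s: "\<And>u v. sstep (\<pi> u) (\<pi> v) = s * sstep u v" "s * s = 1"
    and cd: "\<And>u v. cdist (\<pi> u) (\<pi> v) = cdist u v"
    and K: "regular_complex K" and L: "regular_complex L" and KL: "K \<subseteq> L"
  defines "\<omega> \<equiv> death_cochain K L 1 (step_cochain K)"
  shows "\<bar>\<omega> $ (\<pi> ` \<sigma>)\<bar> = \<bar>\<omega> $ \<sigma>\<bar>"
proof -
  note in_ext = death_cochain_in[OF extension_coboundaries_nonempty[OF KL cochain_of_in_cochains(1)[of K sstep]], folded \<omega>_def]
  obtain \<gamma> where \<gamma>: "\<gamma> \<in> cochains L 1" "restr K \<gamma> = step_cochain K" "\<omega> = coboundary L 1 \<gamma>"
    using in_ext(1) by (auto simp: extension_coboundaries_def)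
  have e: "{\<pi> u, \<pi> v} \<in> M \<longleftrightarrow> {u, v} \<in> M" if "regular_complex M" for M u v
    using regular_edge_cong[OF that cd] .
  define \<gamma>' where "\<gamma>' = cochain_of L (\<lambda>u v. s * evl \<gamma> (\<pi> u) (\<pi> v))"
  have ev: "evl \<gamma>' u v = s * evl \<gamma> (\<pi> u) (\<pi> v)" for u v
  proof -
    have "evl \<gamma>' u v = (if {u, v} \<in> L then s * evl \<gamma> (\<pi> u) (\<pi> v) else 0)"
      unfolding \<gamma>'_def by (rule evl_cochain_of) (subst evl_swap, simp)
    then show ?thesis using evl_outside[OF \<gamma>(1), of "\<pi> u" "\<pi> v"] e[OF L] by simp
  qed
  have "s = 1 \<or> s = - 1" using s(2) by (simp add: square_eq_1_iff)
  then have s1: "\<bar>s\<bar> = 1" by auto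
  have restr: "restr K \<gamma>' = step_cochain K"
  proof (rule cochain_eqI)
    show "restr K \<gamma>' \<in> cochains K 1"
      using KL by (auto simp: \<gamma>'_def cochains_def restr_def cochain_of_def simplices_def)
    fix u v assume uv: "u \<noteq> v" "{u, v} \<in> K"
    have "evl \<gamma> (\<pi> u) (\<pi> v) = evl (restr K \<gamma>) (\<pi> u) (\<pi> v)" using uv e[OF K] by (simp add: evl_restr)
    also have "\<dots> = s * sstep u v" using uv e[OF K] s(1) by (simp add: \<gamma> evl_step_cochain)
    finally have "s * evl \<gamma> (\<pi> u) (\<pi> v) = (s * s) * sstep u v" by simp
    then show "evl (restr K \<gamma>') u v = evl (step_cochain K) u v"
      using uv s(2) by (simp add: evl_restr ev evl_step_cochain)
  qed simp
  have abs: "\<bar>coboundary L 1 \<gamma>' $ \<sigma>\<bar> = \<bar>\<omega> $ (\<pi> ` \<sigma>)\<bar>" for \<sigma>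
  proof (cases "card \<sigma> = 3")
    case True
    then obtain u v w where uvw: "\<sigma> = {u, v, w}" "u \<noteq> v" "v \<noteq> w" "u \<noteq> w" by (rule triple_cases)
    have neq: "\<pi> u \<noteq> \<pi> v" "\<pi> v \<noteq> \<pi> w" "\<pi> u \<noteq> \<pi> w" using uvw \<pi> by (auto simp: bij_def inj_eq)
    have "flag L" using L by (simp add: regular_complex_def)
    then have "{\<pi> u, \<pi> v, \<pi> w} \<in> L \<longleftrightarrow> {u, v, w} \<in> L"
      using e[OF L] e[OF L, of u u] e[OF L, of v v] e[OF L, of w w] by (simp add: flag_triple)
    moreover have "\<bar>d3 \<gamma>' u v w\<bar> = \<bar>d3 \<gamma> (\<pi> u) (\<pi> v) (\<pi> w)\<bar>"
    proof -
      have "d3 \<gamma>' u v w = s * d3 \<gamma> (\<pi> u) (\<pi> v) (\<pi> w)" by (simp add: d3_def ev algebra_simps)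
      then show ?thesis using s1 by (simp add: abs_mult)
    qed
    ultimately show ?thesis
      using coboundary_triple[OF uvw(2-4), of L \<gamma>'] coboundary_triple[OF neq, of L \<gamma>] uvw(1) \<gamma>(3) by simp
  next
    case False
    moreover have "card (\<pi> ` \<sigma>) = card \<sigma>" using \<pi> by (metis bij_is_inj card_image inj_on_subset subset_UNIV)
    ultimately have "\<sigma> \<notin> simplices L 2" "\<pi> ` \<sigma> \<notin> simplices L 2" by (auto simp: simplices_def)
    then show ?thesis by (simp add: \<gamma>(3) coboundary_outside del: One_nat_def)
  qed
  have "norm (coboundary L 1 \<gamma>') = norm \<omega>"
  proof -
    have "(\<Sum>\<sigma>\<in>UNIV. (\<omega> $ (\<pi> ` \<sigma>))\<^sup>2) = (\<Sum>\<sigma>\<in>UNIV. (\<omega> $ \<sigma>)\<^sup>2)"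
      by (rule sum.reindex_bij_betw[of "image \<pi>"]) (use \<pi> bij_betw_Pow[of \<pi> UNIV UNIV] in simp)
    moreover have "(coboundary L 1 \<gamma>' $ \<sigma>)\<^sup>2 = (\<omega> $ (\<pi> ` \<sigma>))\<^sup>2" for \<sigma>
      using abs[of \<sigma>] by (metis power2_abs)
    ultimately show ?thesis by (simp add: norm_vec_def L2_set_def del: One_nat_def)
  qed
  moreover have "coboundary L 1 \<gamma>' \<in> extension_coboundaries K L (step_cochain K)"
    using restr by (auto simp: extension_coboundaries_def \<gamma>'_def)
  ultimately have "\<omega> = coboundary L 1 \<gamma>'"
    unfolding \<omega>_def using in_ext(2) by (intro death_cochain_eqI) (auto simp: \<omega>_def)
  then show ?thesis using abs[of \<sigma>] by simp
qed

section \<open>A trigonometric inequality\<close>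

lemma sin_le_quintic:
  fixes x :: real
  assumes "0 < x"
  shows "sin x \<le> x - x ^ 3 / 6 + x ^ 5 / 120"
proof -
  obtain t where t: "sin x = (\<Sum>m<5. sin_coeff m * x ^ m) + sin (t + 1 / 2 * real 5 * pi) / fact 5 * x ^ 5"
    using Maclaurin_sin_expansion3[of 5 x] assms by auto
  have s: "(\<Sum>m<5. sin_coeff m * x ^ m) = x - x ^ 3 / 6"
    by (simp add: eval_nat_numeral lessThan_Suc sin_coeff_Suc cos_coeff_Suc)
  have "sin (t + 1 / 2 * real 5 * pi) * x ^ 5 \<le> 1 * x ^ 5"
    using assms by (intro mult_right_mono) auto
  then have "sin (t + 1 / 2 * real 5 * pi) / fact 5 * x ^ 5 \<le> x ^ 5 / 120"
    by (simp add: fact_numeral)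
  then show ?thesis using t s by simp
qed

lemma sin_ge_cubic:
  fixes x :: real
  assumes "0 < x"
  shows "x - x ^ 3 / 6 \<le> sin x"
proof -
  obtain t where t: "sin x = (\<Sum>m<3. sin_coeff m * x ^ m) + sin (t + 1 / 2 * real 3 * pi) / fact 3 * x ^ 3"
    using Maclaurin_sin_expansion3[of 3 x] assms by auto
  have s: "(\<Sum>m<3. sin_coeff m * x ^ m) = x"
    by (simp add: sin_coeff_def eval_nat_numeral lessThan_Suc)
  have "- 1 * x ^ 3 \<le> sin (t + 1 / 2 * real 3 * pi) * x ^ 3"
    using assms by (intro mult_right_mono) auto
  then have "- (x ^ 3 / 6) \<le> sin (t + 1 / 2 * real 3 * pi) / fact 3 * x ^ 3"
    by (simp add: fact_numeral)
  then show ?thesis using t s by simp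
qed

text \<open>\<open>21 / 40\<close> is one sixth of \<open>63 / 20\<close>. A larger \<pi> would put
  it below \<pi> / 6, where the sine is 1 / 2, but the cubic bound already gives 1 / 2 at
  \<open>21 / 40\<close>.\<close>

lemma pi_le_3_15: "pi \<le> 63 / 20"
proof (rule ccontr)
  assume "\<not> pi \<le> 63 / 20"
  then have "sin (21 / 40) < sin (pi / 6)"
    by (intro sin_monotone_2pi) (auto simp: field_simps)
  moreover have "1 / 2 \<le> sin (21 / 40 :: real)"
    using sin_ge_cubic[of "21 / 40"] by (simp add: power3_eq_cube)
  ultimately show False by (simp add: sin_30)
qed

text \<open>With this shape the weighted sum over steps needs only sums of squares and cubes. The
  range covers the angles up to \<pi> / 3 of edges with fewer than a third of the steps. Once
  \<open>x ^ 4\<close> is bounded by a multiple of \<open>x ^ 2\<close>, the quintic bound divided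
  by \<open>x\<close>, plus \<open>x / 4\<close>, is a quadratic with maximum about 1.0992, which
  explains the constant.\<close>

lemma sin_le_quadratic:
  fixes x :: real
  assumes "0 \<le> x" "x \<le> 21 / 20"
  shows "sin x \<le> x * (10993 / 10000 - x / 4)"
proof (cases "x = 0")
  case False
  then have x: "0 < x" using assms by simp
  have x2: "x\<^sup>2 \<le> 441 / 400" using power_mono[OF assms(2,1), of 2] by (simp add: power2_eq_square)
  have "x\<^sup>2 * x\<^sup>2 \<le> 441 / 400 * x\<^sup>2" using x2 by (intro mult_right_mono) auto
  \<comment> \<open>\<open>127 / 160\<close> approximates the point where that quadratic is
    largest.\<close>
  moreover have "0 \<le> x\<^sup>2 - 127 / 80 * x + 16129 / 25600"
  proof -
    have "x\<^sup>2 - 127 / 80 * x + 16129 / 25600 = (x - 127 / 160)\<^sup>2"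
      by (simp add: power2_eq_square algebra_simps)
    then show ?thesis by simp
  qed
  ultimately have "1 - x\<^sup>2 / 6 + x\<^sup>2 * x\<^sup>2 / 120 \<le> 10993 / 10000 - x / 4"
    using assms by linarith
  then have "x * (1 - x\<^sup>2 / 6 + x\<^sup>2 * x\<^sup>2 / 120) \<le> x * (10993 / 10000 - x / 4)"
    using x by (intro mult_left_mono) auto
  moreover have "x * (1 - x\<^sup>2 / 6 + x\<^sup>2 * x\<^sup>2 / 120) = x - x ^ 3 / 6 + x ^ 5 / 120"
    by (simp add: power2_eq_square eval_nat_numeral algebra_simps)
  ultimately show ?thesis using sin_le_quintic[OF x] by simp
qed simp

text \<open>Multiplication by the sine of half the angle makes the sum telescope, as for the
  Dirichlet kernel; the sum is a cotangent.\<close>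

lemma sum_sin_multiples:
  fixes n :: nat
  assumes "0 < n"
  shows "sin (pi / n / 2) * (\<Sum>k<n. sin (pi * k / n)) = cos (pi / n / 2)"
proof -
  let ?c = "\<lambda>k. cos ((real k - 1 / 2) * (pi / n))"
  have "2 * (sin (pi / n / 2) * sin (pi * k / n)) = ?c k - ?c (Suc k)" for k
  proof -
    have "2 * (sin h * sin x) = cos (x - h) - cos (x + h)" for h x :: real
      by (simp add: cos_diff cos_add)
    moreover have "pi * k / n - pi / n / 2 = (real k - 1 / 2) * (pi / n)"
      "pi * k / n + pi / n / 2 = (real (Suc k) - 1 / 2) * (pi / n)"
      by (simp_all add: algebra_simps add_divide_distrib)
    ultimately show ?thesis by (simp only:)
  qed
  then have "2 * (sin (pi / n / 2) * (\<Sum>k<n. sin (pi * k / n))) = (\<Sum>k<n. ?c k - ?c (Suc k))"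
    by (simp only: sum_distrib_left)
  also have "\<dots> = ?c 0 - ?c n" by (rule sum_lessThan_telescope')
  also have "?c 0 = cos (pi / n / 2)" by (simp add: mult.commute)
  also have "?c n = - cos (pi / n / 2)"
  proof -
    have "(real n - 1 / 2) * (pi / n) = pi - pi / n / 2" using assms by (simp add: field_simps)
    then show ?thesis by (metis cos_pi_minus)
  qed
  finally show ?thesis by simp
qed

text \<open>With \<open>y\<close> half the angle, the sum is \<open>cos y / sin y\<close>; it
  remains to use \<open>1 - y\<^sup>2 / 2 \<le> cos y\<close> and
  \<open>sin y \<le> y\<close>.\<close>

lemma sum_sin_multiples_ge:
  fixes n :: nat
  assumes "2 \<le> n"
  shows "2 - (pi / n)\<^sup>2 / 4 \<le> pi / n * (\<Sum>k<n. sin (pi * k / n))"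
proof -
  define y where "y = pi / n / 2"
  define S where "S = (\<Sum>k<n. sin (pi * k / n))"
  have y: "0 < y" using assms by (simp add: y_def)
  have "0 \<le> S" unfolding S_def
  proof (rule sum_nonneg, rule sin_ge_zero)
    fix k assume "k \<in> {..<n}"
    then have "pi * k \<le> pi * n" by (intro mult_left_mono) auto
    then show "pi * k / n \<le> pi" using assms by (simp add: field_simps)
  qed simp
  have "1 - y\<^sup>2 / 2 \<le> cos y"
  proof -
    have "(sin (y / 2))\<^sup>2 \<le> (y / 2)\<^sup>2"
      by (rule abs_le_square_iff[THEN iffD1, OF abs_sin_x_le_abs_x])
    moreover have "cos y = 1 - 2 * (sin (y / 2))\<^sup>2" using cos_double_sin[of "y / 2"] by simp
    ultimately show ?thesis by (simp add: power2_eq_square)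
  qed
  also have "\<dots> = sin y * S" using sum_sin_multiples[of n] assms by (simp add: y_def S_def)
  also have "\<dots> \<le> y * S" using \<open>0 \<le> S\<close> y sin_x_le_x[of y] by (intro mult_right_mono) auto
  finally have "2 - y\<^sup>2 \<le> 2 * y * S" by simp
  then show ?thesis by (simp add: y_def S_def power2_eq_square)
qed

lemma sum_nat_simps:
  "(\<Sum>k=1..m. real k) = m * (m + 1) / 2"
  "(\<Sum>k=1..m. real k ^ 2) = m * (m + 1) * (2 * m + 1) / 6"
  "(\<Sum>k=1..m. real k ^ 3) = (m * (m + 1) / 2) ^ 2"
  by (induction m) (simp_all add: field_simps eval_nat_numeral)

text \<open>In the application \<open>\<theta> = pi / n\<close> and \<open>u = m * \<theta>\<close>,
  with \<open>63 / 20\<close> in place of \<pi> and \<open>\<theta> \<le> 9 / 20\<close> because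
  \<open>n \<ge> 7\<close>. The left side grows with \<open>u\<close>, so the largest admissible
  \<open>u\<close> reduces the claim to a cubic in \<theta>; the margin at
  \<open>\<theta> = 0\<close> is about 0.01.\<close>

lemma polynomial_bound:
  fixes \<theta> u :: real
  assumes \<theta>: "0 \<le> \<theta>" "\<theta> \<le> 9 / 20" and u: "0 \<le> u" "3 * u \<le> 63 / 20 - \<theta>"
  shows "(63 / 20 - \<theta>) * (10993 / 10000 * ((2 * u + \<theta>) / 3) - u * (u + \<theta>) / 8) < 2 - \<theta>\<^sup>2 / 4"
proof -
  define y where "y = 63 / 20 - \<theta>"
  have y: "0 \<le> y" "u \<le> y / 3" using \<theta> u by (auto simp: y_def)
  \<comment> \<open>This product is the increase of the bracketed expression from \<open>u\<close>
    to the largest admissible value \<open>y / 3\<close>.\<close>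
  have "0 \<le> (y / 3 - u) * (2 * (10993 / 10000) / 3 - (y / 3 + u + \<theta>) / 8)"
  proof (rule mult_nonneg_nonneg)
    have "y / 3 + u + \<theta> \<le> 51 / 20" using y_def \<theta> u by linarith
    then have "(y / 3 + u + \<theta>) / 8 \<le> 2 / 3" by simp
    also have "2 / 3 \<le> 2 * (10993 / 10000) / (3::real)" by simp
    finally show "0 \<le> 2 * (10993 / 10000) / 3 - (y / 3 + u + \<theta>) / 8" by simp
  qed (use y in simp)
  then have "10993 / 10000 * ((2 * u + \<theta>) / 3) - u * (u + \<theta>) / 8
      \<le> 10993 / 10000 * ((2 * (y / 3) + \<theta>) / 3) - y / 3 * (y / 3 + \<theta>) / 8"
  proof -
    have "10993 / 10000 * ((2 * z + \<theta>) / 3) - z * (z + \<theta>) / 8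
        - (10993 / 10000 * ((2 * u + \<theta>) / 3) - u * (u + \<theta>) / 8)
        = (z - u) * (2 * (10993 / 10000) / 3 - (z + u + \<theta>) / 8)" for z :: real
      by (simp add: field_simps)
    then show ?thesis using \<open>0 \<le> (y / 3 - u) * _\<close> by (metis diff_ge_0_iff_ge)
  qed
  then have "y * (10993 / 10000 * ((2 * u + \<theta>) / 3) - u * (u + \<theta>) / 8)
      \<le> y * (10993 / 10000 * ((2 * (y / 3) + \<theta>) / 3) - y / 3 * (y / 3 + \<theta>) / 8)"
    using y by (intro mult_left_mono)
  also have "\<dots> < 2 - \<theta>\<^sup>2 / 4"
  proof -
    have "\<theta> * \<theta> \<le> 9 / 20 * \<theta>" using \<theta> by (intro mult_right_mono)
    moreover have "\<theta> * (\<theta> * \<theta>) \<le> \<theta> * (9 / 20 * \<theta>)" using calculation \<theta> by (intro mult_left_mono)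
    moreover have "0 \<le> \<theta> * (\<theta> * \<theta>)" "0 \<le> \<theta> * \<theta>" using \<theta> by auto
    moreover have "y * (10993 / 10000 * ((2 * (y / 3) + \<theta>) / 3) - y / 3 * (y / 3 + \<theta>) / 8)
        = 15918777 / 8000000 - 76951 / 200000 * \<theta> + 1639 / 180000 * (\<theta> * \<theta>) - 1 / 36 * (\<theta> * (\<theta> * \<theta>))"
      by (simp add: y_def field_simps)
    ultimately show ?thesis using \<theta> unfolding power2_eq_square by linarith
  qed
  finally show ?thesis by (simp add: y_def)
qed

text \<open>The asymptotic values of the two means are \<open>0.6245\<close> and \<open>2 / \<pi> = 0.6366\<close>, which is why
  the constants in the auxiliary bounds are so tight.\<close>

lemma weighted_mean_sin_less:
  fixes m n :: nat
  assumes "7 \<le> n" "1 \<le> m" "3 * m < n"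
  shows "(\<Sum>k=1..m. k * sin (pi * k / n)) * (n - 1) < (\<Sum>k=1..m. real k) * (\<Sum>k<n. sin (pi * k / n))"
proof -
  define \<theta> where "\<theta> = pi / n"
  define u where "u = m * \<theta>"
  have n: "0 < real n" using assms by simp
  have \<theta>: "0 < \<theta>" "\<theta> \<le> 9 / 20"
  proof -
    show "0 < \<theta>" using n by (simp add: \<theta>_def)
    have "pi / n \<le> pi / 7" using assms by (intro divide_left_mono) auto
    then show "\<theta> \<le> 9 / 20" using pi_le_3_15 by (simp add: \<theta>_def)
  qed
  have n\<theta>: "n * \<theta> = pi" using n by (simp add: \<theta>_def)
  \<comment> \<open>Integrality gains one step: \<open>3 * m < n\<close> yields
    \<open>3 * u + \<theta> \<le> pi\<close>, and the extra \<theta> is what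
    \<open>polynomial_bound\<close> asks for.\<close>
  have "3 * m + 1 \<le> n" using assms by simp
  then have "real (3 * m + 1) * \<theta> \<le> real n * \<theta>" using \<theta> by (intro mult_right_mono) (simp_all only: of_nat_le_iff)
  then have "real (3 * m + 1) * \<theta> \<le> pi" by (simp only: n\<theta>)
  then have u: "0 \<le> u" "3 * u + \<theta> \<le> pi" using \<theta> by (auto simp: u_def algebra_simps)
  let ?a = "10993 / 10000 :: real" and ?M = "\<Sum>k=1..m. real k"
  \<comment> \<open>The weighted mean of the quadratic bound: divided by \<open>?M\<close>, the sums
    of squares and cubes are \<open>(2 * m + 1) / 3\<close> and
    \<open>m * (m + 1) / 2\<close>.\<close>
  let ?B = "?a * ((2 * u + \<theta>) / 3) - u * (u + \<theta>) / 8"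
  have "k * sin (pi * k / n) \<le> ?a * \<theta> * real k ^ 2 - \<theta>\<^sup>2 / 4 * real k ^ 3" if "k \<in> {1..m}" for k
  proof -
    have "real k * \<theta> \<le> u" using that \<theta> by (simp add: u_def)
    then have "sin (k * \<theta>) \<le> k * \<theta> * (?a - k * \<theta> / 4)"
      using u \<theta> pi_le_3_15 by (intro sin_le_quadratic) auto
    then have "k * sin (k * \<theta>) \<le> k * (k * \<theta> * (?a - k * \<theta> / 4))" by (intro mult_left_mono) auto
    then show ?thesis by (simp add: \<theta>_def power2_eq_square power3_eq_cube algebra_simps)
  qed
  then have "(\<Sum>k=1..m. k * sin (pi * k / n)) \<le> (\<Sum>k=1..m. ?a * \<theta> * real k ^ 2 - \<theta>\<^sup>2 / 4 * real k ^ 3)"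
    by (rule sum_mono)
  also have "\<dots> = ?a * \<theta> * (\<Sum>k=1..m. real k ^ 2) - \<theta>\<^sup>2 / 4 * (\<Sum>k=1..m. real k ^ 3)"
    by (simp only: sum_subtractf sum_distrib_left)
  also have "\<dots> = ?M * ?B"
    unfolding sum_nat_simps u_def by (simp add: field_simps eval_nat_numeral)
  finally have le: "(\<Sum>k=1..m. k * sin (pi * k / n)) \<le> ?M * ?B" .
  have B: "0 \<le> ?B"
  proof -
    have "u * (u + \<theta>) \<le> 21 / 20 * (u + \<theta>)" using u \<theta> pi_le_3_15 by (intro mult_right_mono) auto
    then show ?thesis using u \<theta> by (simp add: field_simps)
  qed
  have "(pi - \<theta>) * ?B \<le> (63 / 20 - \<theta>) * ?B" using B pi_le_3_15 by (intro mult_right_mono) auto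
  also have "\<dots> < 2 - \<theta>\<^sup>2 / 4"
    using u \<theta> pi_le_3_15 by (intro polynomial_bound) auto
  also have "\<dots> \<le> \<theta> * (\<Sum>k<n. sin (pi * k / n))"
    using sum_sin_multiples_ge[of n] assms by (simp add: \<theta>_def)
  finally have "(pi - \<theta>) * ?B < \<theta> * (\<Sum>k<n. sin (pi * k / n))" .
  then have "\<theta> * ((real n - 1) * ?B) < \<theta> * (\<Sum>k<n. sin (pi * k / n))"
  proof -
    have "\<theta> * ((real n - 1) * x) = (pi - \<theta>) * x" for x
      unfolding n\<theta>[symmetric] by (simp add: algebra_simps)
    then show ?thesis using \<open>(pi - \<theta>) * _ < _\<close> by (simp only:)
  qed
  then have lt: "(real n - 1) * ?B < (\<Sum>k<n. sin (pi * k / n))" using \<theta> by (simp only: mult_less_cancel_left_pos)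
  have M: "0 < ?M" using assms by (simp only: sum_nat_simps) simp
  have "(\<Sum>k=1..m. k * sin (pi * k / n)) * (real n - 1) \<le> ?M * ?B * (real n - 1)"
    using le n assms by (intro mult_right_mono) auto
  also have "\<dots> = ?M * ((real n - 1) * ?B)" by simp
  also have "\<dots> < ?M * (\<Sum>k<n. sin (pi * k / n))" using lt M by (simp only: mult_less_cancel_left_pos)
  finally show ?thesis using assms by (simp add: of_nat_diff)
qed

section \<open>The death cochain on the full simplex\<close>

lemma sum_cofaces:
  fixes G :: "'n::finite set \<Rightarrow> 'n set \<Rightarrow> real"
  shows "(\<Sum>\<sigma> | card \<sigma> = 3. \<Sum>e | e \<subseteq> \<sigma> \<and> card e = 2. G e \<sigma>)
    = (\<Sum>e | card e = 2. \<Sum>w\<in>- e. G e (insert w e))"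
proof -
  let ?A = "Sigma {\<sigma>::'n set. card \<sigma> = 3} (\<lambda>\<sigma>. {e. e \<subseteq> \<sigma> \<and> card e = 2})"
  let ?B = "Sigma {e::'n set. card e = 2} (\<lambda>e. - e)"
  have "(\<Sum>\<sigma> | card \<sigma> = 3. \<Sum>e | e \<subseteq> \<sigma> \<and> card e = 2. G e \<sigma>) = (\<Sum>(\<sigma>, e)\<in>?A. G e \<sigma>)"
    by (rule sum.Sigma) auto
  also have "\<dots> = (\<Sum>(e, w)\<in>?B. G e (insert w e))"
  proof (rule sum.reindex_bij_witness[of _ "\<lambda>(e, w). (insert w e, e)" "\<lambda>(\<sigma>, e). (e, the_elem (\<sigma> - e))"])
    fix p assume p: "p \<in> ?A"
    obtain \<sigma> e where se: "p = (\<sigma>, e)" by force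
    then have "card (\<sigma> - e) = 1" using p by (simp add: card_Diff_subset)
    then obtain w where w: "\<sigma> - e = {w}" by (auto simp: card_1_singleton_iff)
    then have "insert w e = \<sigma>" "w \<notin> e" using p se by auto
    then show "(case case p of (\<sigma>, e) \<Rightarrow> (e, the_elem (\<sigma> - e)) of (e, w) \<Rightarrow> (insert w e, e)) = p"
      "(case p of (\<sigma>, e) \<Rightarrow> (e, the_elem (\<sigma> - e))) \<in> ?B"
      "(case case p of (\<sigma>, e) \<Rightarrow> (e, the_elem (\<sigma> - e)) of (e, w) \<Rightarrow> G e (insert w e)) = (case p of (\<sigma>, e) \<Rightarrow> G e \<sigma>)"
      using p se w by auto
  next
    fix q assume q: "q \<in> ?B"
    obtain e w where ew: "q = (e, w)" by force
    have "insert w e - e = {w}" using q ew by auto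
    then show "(case case q of (e, w) \<Rightarrow> (insert w e, e) of (\<sigma>, e) \<Rightarrow> (e, the_elem (\<sigma> - e))) = q"
      "(case q of (e, w) \<Rightarrow> (insert w e, e)) \<in> ?A"
      using q ew by auto
  qed
  also have "\<dots> = (\<Sum>e | card e = 2. \<Sum>w\<in>- e. G e (insert w e))"
    by (rule sum.Sigma[symmetric]) auto
  finally show ?thesis .
qed

abbreviation distinct3 :: "'a \<Rightarrow> 'a \<Rightarrow> 'a \<Rightarrow> bool" where
  "distinct3 u v w \<equiv> u \<noteq> v \<and> v \<noteq> w \<and> u \<noteq> w"

text \<open>Counting a triangle through its three edges, each with two orders, converts unordered
  triples into the six ordered ones.\<close>

lemma sum_triples:
  fixes F :: "'n::{finite,linorder} set \<Rightarrow> real"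
  shows "(\<Sum>\<sigma> | card \<sigma> = 3. F \<sigma>)
    = (\<Sum>u\<in>UNIV. \<Sum>v\<in>UNIV. \<Sum>w\<in>UNIV. if distinct3 u v w then F {u, v, w} else 0) / 6"
proof -
  have "card {e. e \<subseteq> \<sigma> \<and> card e = 2} = 3" if "card \<sigma> = 3" for \<sigma> :: "'n set"
    using n_subsets[of \<sigma> 2] that by (simp add: choose_two)
  then have "(\<Sum>\<sigma> | card \<sigma> = 3. \<Sum>e | e \<subseteq> \<sigma> \<and> card e = 2. F \<sigma>) = 3 * (\<Sum>\<sigma> | card \<sigma> = 3. F \<sigma>)"
    by (simp add: sum_distrib_left)
  then have "3 * (\<Sum>\<sigma> | card \<sigma> = 3. F \<sigma>) = (\<Sum>e | card e = 2. \<Sum>w\<in>- e. F (insert w e))"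
    using sum_cofaces[of "\<lambda>e. F"] by simp
  also have "\<dots> = (\<Sum>u\<in>UNIV. \<Sum>v\<in>UNIV. if u \<noteq> v then \<Sum>w\<in>- {u, v}. F (insert w {u, v}) else 0) / 2"
    by (rule sum_pairs)
  also have "\<dots> = (\<Sum>u\<in>UNIV. \<Sum>v\<in>UNIV. \<Sum>w\<in>UNIV. if distinct3 u v w then F {u, v, w} else 0) / 2"
  proof (intro arg_cong[where f = "\<lambda>x. x / 2"] sum.cong refl)
    fix u v :: 'n
    have "(\<Sum>w\<in>- {u, v}. F (insert w {u, v})) = (\<Sum>w\<in>UNIV. if distinct3 u v w then F {u, v, w} else 0)" if "u \<noteq> v"
    proof (rule sum.mono_neutral_cong_left)
      show "F (insert w {u, v}) = (if distinct3 u v w then F {u, v, w} else 0)" if "w \<in> - {u, v}" for w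
      proof -
        have "insert w {u, v} = {u, v, w}" by auto
        then show ?thesis using that \<open>u \<noteq> v\<close> by auto
      qed
    qed auto
    then show "(if u \<noteq> v then \<Sum>w\<in>- {u, v}. F (insert w {u, v}) else 0)
      = (\<Sum>w\<in>UNIV. if distinct3 u v w then F {u, v, w} else 0)"
      by (cases "u = v") auto
  qed
  finally show ?thesis by simp
qed

lemma sum_cyclic3:
  fixes F :: "'a::finite \<Rightarrow> 'a \<Rightarrow> 'a \<Rightarrow> real"
  shows "(\<Sum>u\<in>UNIV. \<Sum>v\<in>UNIV. \<Sum>w\<in>UNIV. F v w u) = (\<Sum>u\<in>UNIV. \<Sum>v\<in>UNIV. \<Sum>w\<in>UNIV. F u v w)"
    "(\<Sum>u\<in>UNIV. \<Sum>v\<in>UNIV. \<Sum>w\<in>UNIV. F w u v) = (\<Sum>u\<in>UNIV. \<Sum>v\<in>UNIV. \<Sum>w\<in>UNIV. F u v w)"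
proof -
  have 1: "(\<Sum>u\<in>UNIV. \<Sum>v\<in>UNIV. \<Sum>w\<in>UNIV. F v w u) = (\<Sum>u\<in>UNIV. \<Sum>v\<in>UNIV. \<Sum>w\<in>UNIV. F u v w)"
    for F :: "'a \<Rightarrow> 'a \<Rightarrow> 'a \<Rightarrow> real"
  proof -
    have "(\<Sum>u\<in>UNIV. \<Sum>v\<in>UNIV. \<Sum>w\<in>UNIV. F v w u) = (\<Sum>v\<in>UNIV. \<Sum>u\<in>UNIV. \<Sum>w\<in>UNIV. F v w u)"
      by (rule sum.swap)
    also have "\<dots> = (\<Sum>v\<in>UNIV. \<Sum>w\<in>UNIV. \<Sum>u\<in>UNIV. F v w u)"
      by (intro sum.cong refl sum.swap)
    finally show ?thesis .
  qed
  show "(\<Sum>u\<in>UNIV. \<Sum>v\<in>UNIV. \<Sum>w\<in>UNIV. F v w u) = (\<Sum>u\<in>UNIV. \<Sum>v\<in>UNIV. \<Sum>w\<in>UNIV. F u v w)"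
    by (rule 1)
  show "(\<Sum>u\<in>UNIV. \<Sum>v\<in>UNIV. \<Sum>w\<in>UNIV. F w u v) = (\<Sum>u\<in>UNIV. \<Sum>v\<in>UNIV. \<Sum>w\<in>UNIV. F u v w)"
    using 1[of "\<lambda>u v w. F w u v"] by simp
qed

section \<open>Circulation of the step cochain around triangles\<close>

lemma cdist_le_abs:
  fixes u v :: "'n::{finite,linorder}"
  assumes "x mod int CARD('n) = gap u v"
  shows "cdist u v \<le> \<bar>x\<bar>"
proof (cases "0 \<le> x")
  case True
  then have "gap u v \<le> x" using assms zmod_le_nonneg_dividend[of x "int CARD('n)"] by simp
  then show ?thesis by (simp add: cdist_def)
next
  case False
  have "gap v u = (- x) mod int CARD('n)" unfolding gap_uminus[of v u] assms[symmetric] by (simp add: mod_simps)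
  then have "gap v u \<le> - x" using False zmod_le_nonneg_dividend[of "- x" "int CARD('n)"] by simp
  then show ?thesis by (subst cdist_commute) (simp add: cdist_def)
qed

text \<open>Steps of opposite sign would have a total no larger than the longer of the two. But the
  total represents \<open>gap u w\<close> and is at least \<open>cdist u w\<close> in absolute
  value, so the signs agree.\<close>

lemma abs_sstep_add:
  fixes u v w :: "'n::{finite,linorder}"
  assumes "2 * cdist u v < int CARD('n)" "2 * cdist v w < int CARD('n)"
    and "cdist u v < cdist u w" "cdist v w < cdist u w"
  shows "\<bar>sstep u v + sstep v w\<bar> = of_int (cdist u v) + of_int (cdist v w)"
proof -
  obtain a where a: "sstep u v = of_int a" "a mod int CARD('n) = gap u v" "\<bar>a\<bar> = cdist u v"
    using sstep_int[OF assms(1)] by blast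
  obtain b where b: "sstep v w = of_int b" "b mod int CARD('n) = gap v w" "\<bar>b\<bar> = cdist v w"
    using sstep_int[OF assms(2)] by blast
  have "(a + b) mod int CARD('n) = gap u w"
    using gap_trans[of u w v] by (simp add: mod_simps flip: a b)
  then have "cdist u w \<le> \<bar>a + b\<bar>" by (rule cdist_le_abs)
  then have "\<bar>a + b\<bar> = \<bar>a\<bar> + \<bar>b\<bar>" using assms(3,4) a(3) b(3) by linarith
  then have "\<bar>sstep u v + sstep v w\<bar> = of_int (\<bar>a\<bar> + \<bar>b\<bar>)" using a b by (metis of_int_abs of_int_add)
  then show ?thesis by (simp add: a(3) b(3))
qed

lemma regular_not_edge:
  "regular_complex K \<Longrightarrow> {x, y} \<in> K \<Longrightarrow> {u, v} \<notin> K \<Longrightarrow> cdist x y < cdist u v"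
  unfolding regular_complex_def by (meson not_le)

text \<open>On a triangle with an edge outside \<open>K\<close> nothing cancels: the missing edge
  has more steps than the present ones, so two present edges point in the same direction. The
  circulation thus splits into contributions of the single short edges.\<close>

lemma abs_d3_step_cochain:
  fixes K :: "'n::{finite,linorder} set set"
  assumes K: "regular_complex K" "small_steps K"
  defines "p \<equiv> \<lambda>u v. if {u, v} \<in> K then real_of_int (cdist u v) else 0"
  shows "\<bar>d3 (step_cochain K) u v w\<bar> =
    (if {u, v} \<in> K \<and> {v, w} \<in> K \<and> {w, u} \<in> K then 0 else p u v + p v w + p w u)"
proof -
  have half: "2 * cdist x y < int CARD('n)" if "{x, y} \<in> K" for x y
  proof -
    have "3 * cdist x y < int CARD('n)" using K(2) that unfolding small_steps_def by blast
    then show ?thesis using cdist_ge_0[of x y] by linarith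
  qed
  have one: "\<bar>evl (step_cochain K) x y\<bar> = p x y" for x y
    using abs_sstep[of x y] half[of x y] by (simp add: evl_step_cochain p_def)
  have two: "\<bar>sstep x y + sstep y z\<bar> = p x y + p y z" if "{x, y} \<in> K" "{y, z} \<in> K" "{z, x} \<notin> K" for x y z
  proof -
    have "{x, z} \<notin> K" using that(3) by (simp add: insert_commute)
    then show ?thesis
      using that half abs_sstep_add[of x y z] regular_not_edge[OF K(1)] by (simp add: p_def)
  qed
  consider "{u, v} \<in> K" "{v, w} \<in> K" "{w, u} \<in> K" | "{u, v} \<in> K" "{v, w} \<in> K" "{w, u} \<notin> K"
    | "{u, v} \<in> K" "{v, w} \<notin> K" "{w, u} \<in> K" | "{u, v} \<notin> K" "{v, w} \<in> K" "{w, u} \<in> K"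
    | "{u, v} \<notin> K" "{v, w} \<notin> K" | "{u, v} \<notin> K" "{w, u} \<notin> K" | "{v, w} \<notin> K" "{w, u} \<notin> K"
    by blast
  then show ?thesis
  proof cases
    case 1
    then show ?thesis
      using K(2) sstep_cyclic_sum[of u v w] by (simp add: d3_def evl_step_cochain small_steps_def)
  next
    case 2
    then show ?thesis using two[of u v w] by (simp add: d3_def evl_step_cochain p_def)
  next
    case 3
    then show ?thesis using two[of w u v] by (simp add: d3_def evl_step_cochain p_def add.commute)
  next
    case 4
    then show ?thesis using two[of v w u] by (simp add: d3_def evl_step_cochain p_def)
  next
    case 5
    then show ?thesis using one[of w u] by (simp add: d3_def evl_step_cochain p_def)
  next
    case 6
    then show ?thesis using one[of v w] by (simp add: d3_def evl_step_cochain p_def)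
  next
    case 7
    then show ?thesis using one[of u v] by (simp add: d3_def evl_step_cochain p_def)
  qed
qed

lemma d3_degenerate: "\<not> distinct3 u v w \<Longrightarrow> d3 \<gamma> u v w = 0"
  using evl_swap[of \<gamma> u v] evl_swap[of \<gamma> u w] by (auto simp: d3_def)

lemma norm_coboundary_full:
  fixes L :: "'n::{finite,linorder} set set"
  assumes "\<And>\<sigma>. \<sigma> \<noteq> {} \<Longrightarrow> \<sigma> \<in> L"
  shows "(norm (coboundary L 1 \<gamma>))\<^sup>2 = (\<Sum>u\<in>UNIV. \<Sum>v\<in>UNIV. \<Sum>w\<in>UNIV. (d3 \<gamma> u v w)\<^sup>2) / 6"
proof -
  have "(norm (coboundary L 1 \<gamma>))\<^sup>2 = (\<Sum>\<sigma>\<in>UNIV. (coboundary L 1 \<gamma> $ \<sigma>)\<^sup>2)"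
    by (simp add: norm_vec_def L2_set_def sum_nonneg del: One_nat_def)
  also have "\<dots> = (\<Sum>\<sigma> | card \<sigma> = 3. (coboundary L 1 \<gamma> $ \<sigma>)\<^sup>2)"
  proof (rule sum.mono_neutral_right)
    show "\<forall>\<sigma>\<in>UNIV - {\<sigma>. card \<sigma> = 3}. (coboundary L 1 \<gamma> $ \<sigma>)\<^sup>2 = 0"
      using coboundary_outside[of _ L \<gamma>] by (auto simp: simplices_def simp del: One_nat_def)
  qed auto
  also have "\<dots> = (\<Sum>u\<in>UNIV. \<Sum>v\<in>UNIV. \<Sum>w\<in>UNIV.
      if distinct3 u v w then (coboundary L 1 \<gamma> $ {u, v, w})\<^sup>2 else 0) / 6"
    by (rule sum_triples)
  also have "\<dots> = (\<Sum>u\<in>UNIV. \<Sum>v\<in>UNIV. \<Sum>w\<in>UNIV. (d3 \<gamma> u v w)\<^sup>2) / 6"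
  proof (intro arg_cong[where f = "\<lambda>x. x / 6"] sum.cong refl)
    fix u v w :: 'n
    show "(if distinct3 u v w then (coboundary L 1 \<gamma> $ {u, v, w})\<^sup>2 else 0) = (d3 \<gamma> u v w)\<^sup>2"
    proof (cases "distinct3 u v w")
      case True
      then have "\<bar>coboundary L 1 \<gamma> $ {u, v, w}\<bar> = \<bar>d3 \<gamma> u v w\<bar>"
        using coboundary_triple[of u v w L \<gamma>] assms[of "{u, v, w}"] by simp
      then show ?thesis using True by (metis power2_abs)
    next
      case False
      then show ?thesis by (subst if_not_P[OF False]) (simp add: d3_degenerate[OF False])
    qed
  qed
  finally show ?thesis .
qed

text \<open>On the full simplex, a divergence-free cochain is an eigenvector of the Laplacian with
  eigenvalue \<open>CARD('n)\<close>, so its coboundary is orthogonal to that of every cochain supported on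
  complementary edges.\<close>

lemma death_cochain_full:
  fixes K L :: "'n::{finite,linorder} set set"
  assumes K: "regular_complex K" and L: "\<And>\<sigma>. \<sigma> \<noteq> {} \<Longrightarrow> \<sigma> \<in> L"
  shows "death_cochain K L 1 (step_cochain K) = coboundary L 1 (step_cochain K)"
proof (rule death_cochain_eqI)
  have "step_cochain K \<in> cochains L 1"
  proof -
    have "\<sigma> \<in> simplices L 1" if "\<sigma> \<in> simplices K 1" for \<sigma>
      using that L[of \<sigma>] by (cases "\<sigma> = {}") (auto simp: simplices_def)
    then show ?thesis by (auto simp: cochains_def cochain_of_def)
  qed
  then show "coboundary L 1 (step_cochain K) \<in> extension_coboundaries K L (step_cochain K)"
    using restr_cochains_id[OF cochain_of_in_cochains(1)] by (auto simp: extension_coboundaries_def)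
  fix \<omega>' assume "\<omega>' \<in> extension_coboundaries K L (step_cochain K)"
  then obtain \<gamma> where \<gamma>: "restr K \<gamma> = step_cochain K" "\<omega>' = coboundary L 1 \<gamma>"
    by (auto simp: extension_coboundaries_def)
  let ?s = "step_cochain K"
  define h where "h = \<gamma> - ?s"
  \<comment> \<open>\<open>h\<close> vanishes on the edges of \<open>K\<close>, which carry the step
    cochain.\<close>
  have disj: "evl h u v * evl ?s u v = 0" for u v
    using arg_cong[OF \<gamma>(1), of "\<lambda>a. evl a u v"] by (auto simp: h_def evl_restr evl_step_cochain)
  \<comment> \<open>Summed over the third vertex, two of the three terms of the circulation are
    divergences and vanish.\<close>
  have div: "(\<Sum>w\<in>UNIV. d3 ?s u v w) = CARD('n) * evl ?s u v" for u v
  proof -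
    have "(\<Sum>w\<in>UNIV. evl ?s w u) = (\<Sum>w\<in>UNIV. - evl ?s u w)"
      by (intro sum.cong refl) (rule evl_swap)
    then show ?thesis using sum_sstep[OF K] by (simp add: d3_def sum.distrib sum_negf)
  qed
  have "(\<Sum>u\<in>UNIV. \<Sum>v\<in>UNIV. \<Sum>w\<in>UNIV. evl h u v * d3 ?s u v w)
      = (\<Sum>u\<in>UNIV. \<Sum>v\<in>UNIV. evl h u v * (\<Sum>w\<in>UNIV. d3 ?s u v w))"
    by (simp only: sum_distrib_left)
  also have "\<dots> = 0"
    unfolding div by (intro sum.neutral ballI) (use disj in \<open>auto simp: algebra_simps\<close>)
  finally have 0: "(\<Sum>u\<in>UNIV. \<Sum>v\<in>UNIV. \<Sum>w\<in>UNIV. evl h u v * d3 ?s u v w) = 0" .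
  \<comment> \<open>The circulation of the step cochain is cyclically invariant, so the product
    splits into three sums that differ only by renaming vertices.\<close>
  have "d3 h u v w * d3 ?s u v w
      = evl h u v * d3 ?s u v w + evl h v w * d3 ?s v w u + evl h w u * d3 ?s w u v" for u v w
    by (simp add: d3_def algebra_simps)
  then have "(\<Sum>u\<in>UNIV. \<Sum>v\<in>UNIV. \<Sum>w\<in>UNIV. d3 h u v w * d3 ?s u v w)
      = (\<Sum>u\<in>UNIV. \<Sum>v\<in>UNIV. \<Sum>w\<in>UNIV. evl h u v * d3 ?s u v w)
      + (\<Sum>u\<in>UNIV. \<Sum>v\<in>UNIV. \<Sum>w\<in>UNIV. evl h v w * d3 ?s v w u)
      + (\<Sum>u\<in>UNIV. \<Sum>v\<in>UNIV. \<Sum>w\<in>UNIV. evl h w u * d3 ?s w u v)"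
    by (simp only: sum.distrib)
  also have "\<dots> = 0"
    unfolding sum_cyclic3[of "\<lambda>u v w. evl h u v * d3 ?s u v w"] 0 by simp
  finally have cross: "(\<Sum>u\<in>UNIV. \<Sum>v\<in>UNIV. \<Sum>w\<in>UNIV. d3 h u v w * d3 ?s u v w) = 0" .
  have "(\<Sum>u\<in>UNIV. \<Sum>v\<in>UNIV. \<Sum>w\<in>UNIV. (d3 ?s u v w)\<^sup>2)
      = (\<Sum>u\<in>UNIV. \<Sum>v\<in>UNIV. \<Sum>w\<in>UNIV. (d3 ?s u v w)\<^sup>2 + 2 * (d3 h u v w * d3 ?s u v w))"
    using cross by (simp add: sum.distrib flip: sum_distrib_left)
  also have "\<dots> \<le> (\<Sum>u\<in>UNIV. \<Sum>v\<in>UNIV. \<Sum>w\<in>UNIV. (d3 \<gamma> u v w)\<^sup>2)"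
  proof (intro sum_mono)
    fix u v w
    have "d3 \<gamma> u v w = d3 ?s u v w + d3 h u v w" by (simp add: d3_def h_def)
    then show "(d3 ?s u v w)\<^sup>2 + 2 * (d3 h u v w * d3 ?s u v w) \<le> (d3 \<gamma> u v w)\<^sup>2"
      by (simp add: power2_sum mult.commute)
  qed
  finally have "(norm (coboundary L 1 ?s))\<^sup>2 \<le> (norm \<omega>')\<^sup>2"
    unfolding \<gamma>(2) by (subst (1 2) norm_coboundary_full) (use L in \<open>auto intro: divide_right_mono\<close>)
  then show "norm (coboundary L 1 ?s) \<le> norm \<omega>'" by (rule power2_le_imp_le) simp
qed

text \<open>Each step number from 1 to \<open>m\<close> is taken by two labels, one on either side
  of \<open>u\<close>; they are distinct because \<open>2 * m < CARD('n)\<close>.\<close>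

lemma ring_sum:
  fixes u :: "'n::{finite,linorder}" and F :: "nat \<Rightarrow> real"
  assumes "2 * m < CARD('n)"
  shows "(\<Sum>v\<in>UNIV. if cdist u v \<le> int m then F (nat (cdist u v)) else 0) = F 0 + 2 * (\<Sum>k=1..m. F k)"
proof -
  let ?n = "CARD('n)"
  define h where "h x = (if min x (?n - x) \<le> m then F (min x (?n - x)) else 0)" for x :: nat
  have "(\<Sum>v\<in>UNIV. if cdist u v \<le> int m then F (nat (cdist u v)) else 0) = (\<Sum>v\<in>UNIV. h (nat (gap u v)))"
  proof (intro sum.cong refl)
    fix v
    have "cdist u v = int (min (nat (gap u v)) (?n - nat (gap u v)))"
    proof -
      obtain g where "gap u v = int g" using gap_ge_0[of u v] nonneg_int_cases by blast
      then show ?thesis using gap_less[of u v] by (simp add: cdist_def of_nat_min of_nat_diff)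
    qed
    then show "(if cdist u v \<le> int m then F (nat (cdist u v)) else 0) = h (nat (gap u v))"
      by (simp add: h_def)
  qed
  also have "\<dots> = (\<Sum>x\<in>{0..<int ?n}. h (nat x))" by (rule sum_gap[of "\<lambda>x. h (nat x)"])
  also have "\<dots> = (\<Sum>x\<in>{0..<?n}. h x)"
    by (rule sum.reindex_bij_witness[of _ int nat]) auto
  also have "\<dots> = (\<Sum>x\<in>{0} \<union> ({1..m} \<union> {?n - m..<?n}). h x)"
    by (rule sum.mono_neutral_right) (use assms in \<open>auto simp: h_def\<close>)
  also have "\<dots> = h 0 + (sum h {1..m} + sum h {?n - m..<?n})"
    using assms by (subst sum.union_disjoint, auto)+
  also have "sum h {?n - m..<?n} = (\<Sum>k=1..m. F k)"
    by (rule sum.reindex_bij_witness[of _ "\<lambda>k. ?n - k" "\<lambda>x. ?n - x"]) (use assms in \<open>auto simp: h_def min_def\<close>)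
  also have "sum h {1..m} = (\<Sum>k=1..m. F k)"
    by (rule sum.cong) (use assms in \<open>auto simp: h_def min_def\<close>)
  also have "h 0 = F 0" by (simp add: h_def)
  finally show ?thesis by simp
qed

section \<open>Contents with fixed complexes\<close>

definition long_edges :: "'n set set \<Rightarrow> 'n set set \<Rightarrow> 'n set \<Rightarrow> 'n set set" where
  "long_edges K L \<sigma> = {\<tau>. \<tau> \<subseteq> \<sigma> \<and> \<tau> \<in> simplices L 1 - simplices K 1}"

text \<open>The complex is an argument independent of \<open>X\<close>, so this is a fixed linear
  combination of edge lengths on all configurations; it agrees with the birth content near a generic
  polygon.\<close>

definition birth_value :: "'n::{finite,linorder} set set \<Rightarrow> 'n config \<Rightarrow> real" where
  "birth_value L X =
     (\<Sum>\<sigma>\<in>simplices L 1. diam X \<sigma> * \<bar>step_cochain L $ \<sigma>\<bar> / l1_norm (step_cochain L))"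

definition death_value :: "'n::{finite,linorder} set set \<Rightarrow> 'n set set \<Rightarrow> 'n config \<Rightarrow> real" where
  "death_value K L X = (let \<omega> = death_cochain K L 1 (step_cochain K) in
     \<Sum>\<sigma>\<in>simplices L 2. (\<Sum>\<tau>\<in>long_edges K L \<sigma>. diam X \<tau>) / real (card (long_edges K L \<sigma>))
       * \<bar>\<omega> $ \<sigma>\<bar> / l1_norm \<omega>)"

lemma l1_norm_cochains:
  assumes "\<alpha> \<in> cochains K k"
  shows "l1_norm \<alpha> = (\<Sum>\<sigma>\<in>simplices K k. \<bar>\<alpha> $ \<sigma>\<bar>)"
  unfolding l1_norm_def by (rule sum.mono_neutral_right) (use assms in \<open>auto simp: cochains_def\<close>)

lemma l1_norm_pos: "\<alpha> \<noteq> 0 \<Longrightarrow> 0 < l1_norm \<alpha>"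
proof -
  assume "\<alpha> \<noteq> 0"
  then obtain \<sigma> where "\<alpha> $ \<sigma> \<noteq> 0" by (auto simp: vec_eq_iff)
  then show ?thesis unfolding l1_norm_def by (intro sum_pos2[of _ \<sigma>]) auto
qed

lemma weighted_mean_gt:
  fixes \<alpha> :: "'n::finite cochain"
  assumes "\<alpha> \<in> cochains K k" "\<alpha> \<noteq> 0" "0 < (\<Sum>\<sigma>\<in>simplices K k. (f \<sigma> - c) * \<bar>\<alpha> $ \<sigma>\<bar>)"
  shows "c < (\<Sum>\<sigma>\<in>simplices K k. f \<sigma> * \<bar>\<alpha> $ \<sigma>\<bar> / l1_norm \<alpha>)"
proof -
  have "c * l1_norm \<alpha> < (\<Sum>\<sigma>\<in>simplices K k. f \<sigma> * \<bar>\<alpha> $ \<sigma>\<bar>)"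
    using assms(3) unfolding l1_norm_cochains[OF assms(1)] left_diff_distrib sum_subtractf sum_distrib_left
    by linarith
  then show ?thesis
    unfolding sum_divide_distrib[symmetric] using l1_norm_pos[OF assms(2)] by (simp only: pos_less_divide_eq)
qed

lemma weighted_mean_le:
  fixes \<alpha> :: "'n::finite cochain"
  assumes "\<alpha> \<in> cochains K k" "\<alpha> \<noteq> 0" "\<And>\<sigma>. \<sigma> \<in> simplices K k \<Longrightarrow> f \<sigma> \<le> c"
  shows "(\<Sum>\<sigma>\<in>simplices K k. f \<sigma> * \<bar>\<alpha> $ \<sigma>\<bar> / l1_norm \<alpha>) \<le> c"
proof -
  have "(\<Sum>\<sigma>\<in>simplices K k. f \<sigma> * \<bar>\<alpha> $ \<sigma>\<bar>) \<le> (\<Sum>\<sigma>\<in>simplices K k. c * \<bar>\<alpha> $ \<sigma>\<bar>)"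
    using assms(3) by (intro sum_mono mult_right_mono) auto
  also have "\<dots> = c * l1_norm \<alpha>"
    unfolding l1_norm_cochains[OF assms(1)] by (rule sum_distrib_left[symmetric])
  finally show ?thesis
    unfolding sum_divide_distrib[symmetric] using l1_norm_pos[OF assms(2)] by (simp only: pos_divide_le_eq)
qed

lemma step_cochain_nonzero:
  fixes K :: "'n::{finite,linorder} set set"
  assumes "3 \<le> CARD('n)" "regular_complex K"
  shows "step_cochain K \<noteq> 0"
proof
  assume "step_cochain K = 0"
  moreover have "hol (step_cochain K) = CARD('n)"
    using assms by (intro hol_step_cochain) (auto simp: regular_complex_def)
  ultimately show False by simp
qed

lemma regular_complex_steps:
  fixes K :: "'n::{finite,linorder} set set"
  assumes n: "3 \<le> CARD('n)" and K: "regular_complex K" "small_steps K"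
  obtains m where "1 \<le> m" "3 * m < CARD('n)" "\<And>u v. {u, v} \<in> K \<longleftrightarrow> cdist u v \<le> int m"
proof
  let ?S = "{cdist u v | u v. {u, v} \<in> K}"
  have fin: "finite ?S" by (rule finite_subset[of _ "(\<lambda>(u, v). cdist u v) ` UNIV"]) auto
  have mem: "cdist u v \<in> ?S" if "{u, v} \<in> K" for u v using that by blast
  obtain i :: 'n where True by simp
  have rot: "{i, rot i} \<in> K" using K by (simp add: regular_complex_def)
  have "Max ?S \<in> ?S" using fin mem[OF rot] by (intro Max_in) auto
  then obtain u v where "Max ?S = cdist u v" and uv1: "{u, v} \<in> K" by (elim CollectE exE conjE)
  then have uv: "{u, v} \<in> K" "cdist u v = Max ?S" by simp_all
  define m where "m = nat (Max ?S)"
  have m: "int m = Max ?S" using uv(2) cdist_ge_0[of u v] by (simp add: m_def)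
  have "1 \<le> Max ?S" using Max_ge[OF fin mem[OF rot]] cdist_rot[OF n, of i] by simp
  then show "1 \<le> m" using m by linarith
  have "3 * cdist u v < int CARD('n)" using K(2) uv(1) unfolding small_steps_def by blast
  then show "3 * m < CARD('n)" using uv(2) m by linarith
  show "{x, y} \<in> K \<longleftrightarrow> cdist x y \<le> int m" for x y
  proof
    assume "{x, y} \<in> K"
    then show "cdist x y \<le> int m" using Max_ge[OF fin mem] m by simp
  next
    assume "cdist x y \<le> int m"
    then have "cdist x y \<le> cdist u v" using uv(2) m by linarith
    then show "{x, y} \<in> K" using K(1) uv(1) unfolding regular_complex_def by blast
  qed
qed

section \<open>Contents of the unit polygon\<close>

lemma sum_simplices_1:
  fixes F :: "'n::{finite,linorder} set \<Rightarrow> real"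
  shows "(\<Sum>\<sigma>\<in>simplices K 1. F \<sigma>) = (\<Sum>u\<in>UNIV. \<Sum>v\<in>UNIV. if u \<noteq> v \<and> {u, v} \<in> K then F {u, v} else 0) / 2"
proof -
  have "(\<Sum>\<sigma>\<in>simplices K 1. F \<sigma>) = (\<Sum>\<sigma> | card \<sigma> = 2. if \<sigma> \<in> K then F \<sigma> else 0)"
    by (rule sum.mono_neutral_cong_left) (auto simp: simplices_def)
  also have "\<dots> = (\<Sum>u\<in>UNIV. \<Sum>v\<in>UNIV. if u \<noteq> v then (if {u, v} \<in> K then F {u, v} else 0) else 0) / 2"
    by (rule sum_pairs)
  also have "\<dots> = (\<Sum>u\<in>UNIV. \<Sum>v\<in>UNIV. if u \<noteq> v \<and> {u, v} \<in> K then F {u, v} else 0) / 2"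
    by (intro arg_cong[where f = "\<lambda>x. x / 2"] sum.cong refl) auto
  finally show ?thesis .
qed

text \<open>Each step number \<open>k \<le> m\<close> occurs on \<open>CARD('n)\<close> edges, with
  weight \<open>k\<close> and length \<open>2 * sin (pi * k / CARD('n))\<close>; the factor
  \<open>CARD('n)\<close> cancels against the norm.\<close>

lemma birth_value_polygon:
  fixes L :: "'n::{finite,linorder} set set"
  assumes n: "3 \<le> CARD('n)" and m: "1 \<le> m" "3 * m < CARD('n)" and L: "\<And>u v. {u, v} \<in> L \<longleftrightarrow> cdist u v \<le> int m"
  shows "birth_value L (polygon 1) * (\<Sum>k=1..m. real k) = 2 * (\<Sum>k=1..m. real k * sin (pi * k / CARD('n)))"
proof -
  let ?n = "CARD('n)" and ?s = "step_cochain L"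
  have half: "2 * m < ?n" using m by simp
  have abs: "\<bar>?s $ {u, v}\<bar> = real (nat (cdist u v))" if "u \<noteq> v" "{u, v} \<in> L" for u v
  proof -
    have "\<bar>?s $ {u, v}\<bar> = \<bar>sstep u v\<bar>" using that abs_evl[of u v ?s] by (simp add: evl_step_cochain)
    moreover have "cdist u v \<le> int m" using that(2) L by blast
    then have "2 * cdist u v < int ?n" using half by linarith
    ultimately show ?thesis by (simp add: abs_sstep)
  qed
  have S: "(\<Sum>\<sigma>\<in>simplices L 1. F \<sigma> * \<bar>?s $ \<sigma>\<bar>) = ?n * (\<Sum>k=1..m. f k * real k)"
    if F: "\<And>u v. F {u, v} = f (nat (cdist u v))" for F f
  proof -
    have "(\<Sum>v\<in>UNIV. if u \<noteq> v \<and> {u, v} \<in> L then F {u, v} * \<bar>?s $ {u, v}\<bar> else 0) = 2 * (\<Sum>k=1..m. f k * real k)" for u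
    proof -
      have "(\<Sum>v\<in>UNIV. if u \<noteq> v \<and> {u, v} \<in> L then F {u, v} * \<bar>?s $ {u, v}\<bar> else 0)
          = (\<Sum>v\<in>UNIV. if cdist u v \<le> int m then f (nat (cdist u v)) * real (nat (cdist u v)) else 0)"
        by (intro sum.cong refl) (auto simp: F abs L)
      then show ?thesis using ring_sum[OF half, of u "\<lambda>k. f k * real k"] by simp
    qed
    then show ?thesis unfolding sum_simplices_1 by simp
  qed
  have "l1_norm ?s = (\<Sum>\<sigma>\<in>simplices L 1. 1 * \<bar>?s $ \<sigma>\<bar>)" by (simp add: l1_norm_cochains[OF cochain_of_in_cochains(1)] del: One_nat_def)
  also have "\<dots> = ?n * (\<Sum>k=1..m. 1 * real k)" by (rule S) simp
  finally have l1: "l1_norm ?s = ?n * (\<Sum>k=1..m. real k)" by simp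
  have "(\<Sum>\<sigma>\<in>simplices L 1. diam (polygon 1) \<sigma> * \<bar>?s $ \<sigma>\<bar>) = ?n * (\<Sum>k=1..m. 2 * sin (pi * k / ?n) * real k)"
    by (rule S) (simp add: diam_pair dist_polygon chord_def)
  moreover have "0 < (\<Sum>k=1..m. real k)" using m by (simp only: sum_nat_simps) simp
  moreover have "(\<Sum>k=1..m. 2 * sin (pi * k / ?n) * real k) = 2 * (\<Sum>k=1..m. real k * sin (pi * k / ?n))"
    by (simp add: sum_distrib_left mult_ac)
  ultimately show ?thesis
    unfolding birth_value_def l1 sum_divide_distrib[symmetric] by simp
qed

lemma sum_chord: "(\<Sum>w\<in>UNIV. chord u w) = 2 * (\<Sum>k<CARD('n). sin (pi * k / CARD('n)))"
  for u :: "'n::{finite,linorder}"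
proof -
  have "(\<Sum>w\<in>UNIV. chord u w) = (\<Sum>w\<in>UNIV. 2 * sin (pi * of_int (gap u w) / CARD('n)))"
    by (simp only: sin_gap_eq_chord)
  also have "\<dots> = (\<Sum>x\<in>{0..<int CARD('n)}. 2 * sin (pi * of_int x / CARD('n)))"
    by (rule sum_gap[of "\<lambda>x. 2 * sin (pi * of_int x / CARD('n))"])
  also have "\<dots> = (\<Sum>k<CARD('n). 2 * sin (pi * k / CARD('n)))"
    by (rule sum.reindex_bij_witness[of _ int nat]) auto
  finally show ?thesis by (simp add: sum_distrib_left)
qed

text \<open>The trigonometric inequality in geometric form: the right side is
  \<open>CARD('n) - 1\<close> times the mean distance from \<open>u\<close> to the other
  vertices.\<close>

lemma mean_chord_gt_birth_value:
  fixes L :: "'n::{finite,linorder} set set" and u :: 'n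
  assumes n: "7 \<le> CARD('n)" and L: "regular_complex L" "small_steps L"
  shows "birth_value L (polygon 1) * (real CARD('n) - 1) < (\<Sum>w\<in>UNIV. chord u w)"
proof -
  have "3 \<le> CARD('n)" using n by simp
  from regular_complex_steps[OF this L]
  obtain m where m: "1 \<le> m" "3 * m < CARD('n)" and L: "\<And>u v. {u, v} \<in> L \<longleftrightarrow> cdist u v \<le> int m" by blast
  let ?M = "\<Sum>k=1..m. real k" and ?b = "birth_value L (polygon 1)"
  have M: "0 < ?M" using m by (simp only: sum_nat_simps) simp
  have "?b * (real CARD('n) - 1) * ?M = (?b * ?M) * (real CARD('n) - 1)" by simp
  also have "\<dots> = 2 * ((\<Sum>k=1..m. real k * sin (pi * k / CARD('n))) * (CARD('n) - 1))"
    using birth_value_polygon[OF \<open>3 \<le> CARD('n)\<close> m L] n by (simp add: of_nat_diff)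
  also have "\<dots> < 2 * (?M * (\<Sum>k<CARD('n). sin (pi * k / CARD('n))))"
    using weighted_mean_sin_less[OF n m] by simp
  also have "\<dots> = (\<Sum>w\<in>UNIV. chord u w) * ?M" by (simp add: sum_chord[of u])
  finally show ?thesis using M by (simp only: mult_less_cancel_right_pos)
qed

text \<open>A zero death cochain would extend the step cochain to a cocycle of nonzero holonomy on
  \<open>L\<close>, which forces small steps.\<close>

lemma death_cochain_nonzero:
  fixes K L :: "'n::{finite,linorder} set set"
  assumes n: "3 \<le> CARD('n)" and K: "regular_complex K" and L: "regular_complex L" "\<not> small_steps L"
    and KL: "K \<subseteq> L"
  shows "death_cochain K L 1 (step_cochain K) \<noteq> 0"
proof
  assume 0: "death_cochain K L 1 (step_cochain K) = 0"
  obtain \<gamma> where \<gamma>: "\<gamma> \<in> cochains L 1" "restr K \<gamma> = step_cochain K" "coboundary L 1 \<gamma> = 0"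
    using death_cochain_in(1)[OF extension_coboundaries_nonempty[OF KL cochain_of_in_cochains(1)[of K sstep]]] 0
    by (auto simp: extension_coboundaries_def)
  have "hol \<gamma> = hol (step_cochain K)"
    using hol_restr[of K \<gamma>] K \<gamma>(2) by (simp add: regular_complex_def)
  also have "\<dots> = CARD('n)" using K by (intro hol_step_cochain[OF n]) (auto simp: regular_complex_def)
  finally have "hol \<gamma> \<noteq> 0" by simp
  moreover have "\<gamma> \<in> cocycles L 1" using \<gamma> by (simp add: cocycles_def)
  ultimately show False using small_steps_of_cocycle[OF n L(1)] L(2) by blast
qed

text \<open>If all edges of a triangle lie in \<open>K\<close>, every extension agrees there with
  the step cochain and has no circulation. Hence triangles over which the mean of long edges is
  empty carry no weight.\<close>

lemma death_cochain_long_edges: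
  fixes K L :: "'n::{finite,linorder} set set"
  assumes n: "3 \<le> CARD('n)" and K: "regular_complex K" "small_steps K" and L: "regular_complex L"
    and KL: "K \<subseteq> L" and \<sigma>: "death_cochain K L 1 (step_cochain K) $ \<sigma> \<noteq> 0"
  shows "long_edges K L \<sigma> \<noteq> {}"
proof
  assume e: "long_edges K L \<sigma> = {}"
  obtain \<gamma> where \<gamma>: "restr K \<gamma> = step_cochain K"
    "death_cochain K L 1 (step_cochain K) = coboundary L 1 \<gamma>"
    using death_cochain_in(1)[OF extension_coboundaries_nonempty[OF KL cochain_of_in_cochains(1)[of K sstep]]]
    by (auto simp: extension_coboundaries_def)
  have "\<sigma> \<in> simplices L 2" using \<sigma> coboundary_outside[of \<sigma> L \<gamma>] \<gamma>(2) by metis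
  then have "card \<sigma> = 3" "\<sigma> \<in> L" by (auto simp: simplices_def)
  then obtain u v w where uvw: "\<sigma> = {u, v, w}" "distinct3 u v w" by (auto elim: triple_cases)
  have flag: "flag L" "flag K" using K L by (auto simp: regular_complex_def)
  have "{u, v} \<in> L" "{v, w} \<in> L" "{w, u} \<in> L"
    using flag_triple[OF flag(1), of u v w] uvw \<open>\<sigma> \<in> L\<close> by (auto simp: insert_commute)
  then have uv: "{u, v} \<in> K" and vw: "{v, w} \<in> K" and wu: "{w, u} \<in> K"
    using e uvw by (auto simp: long_edges_def simplices_def)
  have "evl \<gamma> x y = evl (step_cochain K) x y" if "{x, y} \<in> K" for x y
    using that arg_cong[OF \<gamma>(1), of "\<lambda>a. evl a x y"] by (simp add: evl_restr)
  then have "d3 \<gamma> u v w = d3 (step_cochain K) u v w" using uv vw wu by (simp add: d3_def)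
  also have "\<dots> = 0"
    using cocycle_d3[OF flag(2) cyclic_vertex[OF n regular_imp_cyclic[OF K(1)]] step_cochain_cocycle[OF flag(2) K(2)] uv vw] wu
    by (simp add: insert_commute)
  finally show False
    using coboundary_triple[of u v w L \<gamma>] uvw \<sigma> \<gamma>(2) by (auto split: if_splits)
qed

text \<open>Distributing each triangle over its short edges reduces the claim to
  the mean distance of a vertex to all others, since replacing the mean over the long edges at the
  third vertex by the mean over both edges only decreases it: a short edge is shorter than
  every long one, and shorter than \<open>c\<close>.\<close>

lemma death_value_full_gt:
  fixes K L :: "'n::{finite,linorder} set set"
  assumes n: "3 \<le> CARD('n)" and K: "regular_complex K" "small_steps K"
    and L: "\<And>\<sigma>. \<sigma> \<noteq> {} \<Longrightarrow> \<sigma> \<in> L" "regular_complex L" "\<not> small_steps L" and KL: "K \<subseteq> L"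
    and short: "\<And>u v. {u, v} \<in> K \<Longrightarrow> chord u v < c"
    and mean: "\<And>u::'n. c * (real CARD('n) - 1) < (\<Sum>w\<in>UNIV. chord u w)"
  shows "c < death_value K L (polygon 1)"
proof -
  let ?s = "step_cochain K" and ?X = "polygon 1 :: 'n config"
  define p where "p u v = (if {u, v} \<in> K then real_of_int (cdist u v) else 0)" for u v
  define \<omega> where "\<omega> = coboundary L 1 ?s"
  have \<omega>: "death_cochain K L 1 ?s = \<omega>" unfolding \<omega>_def by (rule death_cochain_full[OF K(1) L(1)])
  have \<omega>0: "\<omega> \<noteq> 0" unfolding \<omega>[symmetric] by (rule death_cochain_nonzero[OF n K(1) L(2,3) KL])
  define f where "f \<sigma> = (\<Sum>\<tau>\<in>long_edges K L \<sigma>. diam ?X \<tau>) / real (card (long_edges K L \<sigma>))" for \<sigma>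
  \<comment> \<open>On triangles without long edges \<open>f\<close> has the default value
    \<open>0 / 0 = 0\<close>. Their weight vanishes, and putting \<phi> to 0 there lets both the
    factorization \<open>weight\<close> and the bound \<open>\<phi>_ge\<close> hold without
    exception.\<close>
  define \<phi> where "\<phi> \<sigma> = (if long_edges K L \<sigma> = {} then 0 else f \<sigma> - c)" for \<sigma>
  have long: "{x, y} \<in> long_edges K L \<sigma> \<longleftrightarrow> {x, y} \<subseteq> \<sigma> \<and> x \<noteq> y \<and> {x, y} \<notin> K" for x y \<sigma>
    using L(1)[of "{x, y}"] by (auto simp: long_edges_def)
  have long3: "long_edges K L {u, v, w} = {\<tau> \<in> {{u, v}, {v, w}, {w, u}}. \<tau> \<notin> K}"
    if "distinct3 u v w" for u v w
  proof (rule set_eqI, rule iffI)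
    fix \<tau> assume \<tau>: "\<tau> \<in> long_edges K L {u, v, w}"
    then have "card \<tau> = 2" by (auto simp: long_edges_def simplices_def)
    then obtain x y where "\<tau> = {x, y}" unfolding card_2_iff by blast
    then show "\<tau> \<in> {\<tau> \<in> {{u, v}, {v, w}, {w, u}}. \<tau> \<notin> K}" using \<tau> long[of x y "{u, v, w}"] by auto
  next
    fix \<tau> assume "\<tau> \<in> {\<tau> \<in> {{u, v}, {v, w}, {w, u}}. \<tau> \<notin> K}"
    then show "\<tau> \<in> long_edges K L {u, v, w}" using that long by auto
  qed
  have weight: "(f {u, v, w} - c) * \<bar>\<omega> $ {u, v, w}\<bar> = (p u v + p v w + p w u) * \<phi> {u, v, w}"
    if d: "distinct3 u v w" for u v w
  proof -
    have abs: "\<bar>\<omega> $ {u, v, w}\<bar> = (if {u, v} \<in> K \<and> {v, w} \<in> K \<and> {w, u} \<in> K then 0 else p u v + p v w + p w u)"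
    proof -
      have "{u, v, w} \<in> L" by (rule L(1)) simp
      then have "\<bar>\<omega> $ {u, v, w}\<bar> = \<bar>d3 ?s u v w\<bar>"
        using coboundary_triple[of u v w L ?s] d unfolding \<omega>_def by presburger
      then show ?thesis unfolding abs_d3_step_cochain[OF K] p_def .
    qed
    have e: "long_edges K L {u, v, w} = {} \<longleftrightarrow> {u, v} \<in> K \<and> {v, w} \<in> K \<and> {w, u} \<in> K"
      unfolding long3[OF d] by auto
    show ?thesis unfolding abs \<phi>_def e by simp
  qed
  have sep: "chord x y < chord u v" if "{x, y} \<in> K" "{u, v} \<notin> K" for x y u v
    unfolding chord_less_iff by (rule regular_not_edge[OF K(1) that])
  have \<phi>_ge: "\<phi> {u, v, w} \<ge> ((chord u w - c) + (chord v w - c)) / 2"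
    if d: "distinct3 u v w" and uv: "{u, v} \<in> K" for u v w
  proof -
    have l3: "long_edges K L {u, v, w} = {\<tau> \<in> {{v, w}, {u, w}}. \<tau> \<notin> K}"
      unfolding long3[OF d] using uv insert_commute[of w u "{}"] by auto
    have neq: "{v, w} \<noteq> {u, w}" using d by (auto simp: doubleton_eq_iff)
    have dm: "diam ?X {x, y} = chord x y" for x y by (simp add: diam_pair dist_polygon)
    consider "{v, w} \<in> K" "{u, w} \<in> K" | "{v, w} \<in> K" "{u, w} \<notin> K" | "{v, w} \<notin> K" "{u, w} \<in> K"
      | "{v, w} \<notin> K" "{u, w} \<notin> K" by blast
    then show ?thesis
    proof cases
      case 1
      then have "long_edges K L {u, v, w} = {}" unfolding l3 by auto
      then show ?thesis using short[OF 1(1)] short[OF 1(2)] by (simp add: \<phi>_def)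
    next
      case 2
      then have "long_edges K L {u, v, w} = {{u, w}}" unfolding l3 by auto
      then show ?thesis using sep[OF 2] by (simp add: \<phi>_def f_def dm)
    next
      case 3
      then have "long_edges K L {u, v, w} = {{v, w}}" unfolding l3 by auto
      then show ?thesis using sep[OF 3(2,1)] by (simp add: \<phi>_def f_def dm)
    next
      case 4
      then have "long_edges K L {u, v, w} = {{v, w}, {u, w}}" unfolding l3 by auto
      then show ?thesis using neq by (simp add: \<phi>_def f_def dm field_simps)
    qed
  qed
  have inner: "0 < (\<Sum>w\<in>UNIV. if distinct3 u v w then \<phi> {u, v, w} else 0)" if uv: "u \<noteq> v" "{u, v} \<in> K" for u v
  proof -
    \<comment> \<open>The full sum contains \<open>w = x\<close>, whose term is
      \<open>0 - c\<close>; adding \<open>c\<close> leaves the sum over the other vertices, which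
      \<open>mean\<close> makes positive.\<close>
    have H: "(\<Sum>w\<in>UNIV. chord x w - c) + c > 0" for x :: 'n
      using mean[of x] by (simp add: sum_subtractf algebra_simps)
    have vu: "chord v u = chord u v" by (simp add: chord_def cdist_commute)
    \<comment> \<open>Dropping the other end of the short edge as well only helps, as its term
      \<open>chord u v - c\<close> is negative.\<close>
    have "(\<Sum>w\<in>UNIV - {u, v}. chord x w - c) = (\<Sum>w\<in>UNIV. chord x w - c) - (chord u v - c) + c"
      if "x = u \<or> x = v" for x
      using uv(1) that vu by (subst sum_diff) auto
    then have "0 < ((\<Sum>w\<in>UNIV - {u, v}. chord u w - c) + (\<Sum>w\<in>UNIV - {u, v}. chord v w - c)) / 2"
      using H[of u] H[of v] short[OF uv(2)] by simp
    also have "\<dots> = (\<Sum>w\<in>UNIV - {u, v}. ((chord u w - c) + (chord v w - c)) / 2)"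
      unfolding sum_divide_distrib[symmetric] by (simp only: sum.distrib)
    also have "\<dots> \<le> (\<Sum>w\<in>UNIV - {u, v}. if distinct3 u v w then \<phi> {u, v, w} else 0)"
    proof (rule sum_mono)
      fix w assume "w \<in> UNIV - {u, v}"
      then have "distinct3 u v w" using uv by auto
      then show "((chord u w - c) + (chord v w - c)) / 2 \<le> (if distinct3 u v w then \<phi> {u, v, w} else 0)"
        using \<phi>_ge uv by simp
    qed
    also have "\<dots> = (\<Sum>w\<in>UNIV. if distinct3 u v w then \<phi> {u, v, w} else 0)"
      by (rule sum.mono_neutral_left) auto
    finally show ?thesis .
  qed
  have "0 < (\<Sum>u\<in>UNIV. \<Sum>v\<in>UNIV. p u v * (\<Sum>w\<in>UNIV. if distinct3 u v w then \<phi> {u, v, w} else 0))"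
  proof -
    have nonneg: "0 \<le> p u v * (\<Sum>w\<in>UNIV. if distinct3 u v w then \<phi> {u, v, w} else 0)" for u v
    proof (cases "u \<noteq> v \<and> {u, v} \<in> K")
      case True
      then show ?thesis using inner[of u v] by (intro mult_nonneg_nonneg) (auto simp: p_def)
    qed (auto simp: p_def)
    obtain i :: 'n where True by simp
    have pos: "0 < p i (rot i) * (\<Sum>w\<in>UNIV. if distinct3 i (rot i) w then \<phi> {i, rot i, w} else 0)"
    proof (rule mult_pos_pos)
      have "{i, rot i} \<in> K" using K by (simp add: regular_complex_def)
      then show "0 < p i (rot i)" by (simp add: p_def cdist_rot[OF n])
      show "0 < (\<Sum>w\<in>UNIV. if distinct3 i (rot i) w then \<phi> {i, rot i, w} else 0)"
        using \<open>{i, rot i} \<in> K\<close> rot_neq[of i] n by (intro inner) auto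
    qed
    have "0 < (\<Sum>v\<in>UNIV. p i v * (\<Sum>w\<in>UNIV. if distinct3 i v w then \<phi> {i, v, w} else 0))"
      by (rule sum_pos2[of _ "rot i"]) (use nonneg pos in auto)
    then show ?thesis
      by (rule sum_pos2[of _ i, rotated 2]) (use nonneg in \<open>auto intro!: sum_nonneg\<close>)
  qed
  then have main: "0 < (\<Sum>u\<in>UNIV. \<Sum>v\<in>UNIV. \<Sum>w\<in>UNIV. p u v * (if distinct3 u v w then \<phi> {u, v, w} else 0))"
    by (simp only: sum_distrib_left)
  let ?q = "\<lambda>u v w. p u v * (if distinct3 u v w then \<phi> {u, v, w} else 0)"
  have "(\<Sum>\<sigma>\<in>simplices L 2. (f \<sigma> - c) * \<bar>\<omega> $ \<sigma>\<bar>) = (\<Sum>\<sigma> | card \<sigma> = 3. (f \<sigma> - c) * \<bar>\<omega> $ \<sigma>\<bar>)"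
  proof (rule sum.cong)
    have "\<sigma> \<in> L" if "card \<sigma> = 3" for \<sigma>
      by (rule L(1)) (use that in auto)
    then show "simplices L 2 = {\<sigma>. card \<sigma> = 3}" by (auto simp: simplices_def)
  qed simp
  also have "\<dots> = (\<Sum>u\<in>UNIV. \<Sum>v\<in>UNIV. \<Sum>w\<in>UNIV. if distinct3 u v w then (f {u, v, w} - c) * \<bar>\<omega> $ {u, v, w}\<bar> else 0) / 6"
    by (rule sum_triples)
  also have "\<dots> = (\<Sum>u\<in>UNIV. \<Sum>v\<in>UNIV. \<Sum>w\<in>UNIV. ?q u v w + ?q v w u + ?q w u v) / 6"
  proof (intro arg_cong[where f = "\<lambda>x. x / 6"] sum.cong refl)
    fix u v w :: 'n
    have "{v, w, u} = {u, v, w}" "{w, u, v} = {u, v, w}" by auto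
    then show "(if distinct3 u v w then (f {u, v, w} - c) * \<bar>\<omega> $ {u, v, w}\<bar> else 0) = ?q u v w + ?q v w u + ?q w u v"
      using weight[of u v w] by (auto simp: distrib_right)
  qed
  also have "\<dots> = (\<Sum>u\<in>UNIV. \<Sum>v\<in>UNIV. \<Sum>w\<in>UNIV. ?q u v w) / 2"
    unfolding sum.distrib sum_cyclic3[of ?q] by simp
  finally have "0 < (\<Sum>\<sigma>\<in>simplices L 2. (f \<sigma> - c) * \<bar>\<omega> $ \<sigma>\<bar>)" using main by simp
  from weighted_mean_gt[OF coboundary_in_cochains[of L ?s, folded \<omega>_def] \<omega>0 this]
  show ?thesis by (simp only: death_value_def Let_def \<omega> f_def)
qed

text \<open>The death content averages the lengths of long edges over triangles that all have such
  an edge, so a lower bound for long edges passes to it.\<close>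

lemma death_value_gt_of_long_edges:
  fixes K L :: "'n::{finite,linorder} set set"
  assumes n: "3 \<le> CARD('n)" and K: "regular_complex K" "small_steps K"
    and L: "regular_complex L" "\<not> small_steps L" and KL: "K \<subseteq> L"
    and long: "\<And>u v. {u, v} \<in> L \<Longrightarrow> {u, v} \<notin> K \<Longrightarrow> c < dist (X $ u) (X $ v)"
  shows "c < death_value K L X"
proof -
  define \<omega> where "\<omega> = death_cochain K L 1 (step_cochain K)"
  define f where "f \<sigma> = (\<Sum>\<tau>\<in>long_edges K L \<sigma>. diam X \<tau>) / real (card (long_edges K L \<sigma>))" for \<sigma>
  have \<omega>0: "\<omega> \<noteq> 0" unfolding \<omega>_def by (rule death_cochain_nonzero[OF n K(1) L KL])
  have \<omega>L: "\<omega> \<in> cochains L 2"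
    using death_cochain_in(1)[OF extension_coboundaries_nonempty[OF KL cochain_of_in_cochains(1)[of K sstep]]]
    unfolding \<omega>_def extension_coboundaries_def
    by (auto simp: coboundary_in_cochains simp del: One_nat_def)
  have f: "c < f \<sigma>" if "\<omega> $ \<sigma> \<noteq> 0" for \<sigma>
  proof -
    have ne: "long_edges K L \<sigma> \<noteq> {}"
      using death_cochain_long_edges[OF n K L(1) KL] that unfolding \<omega>_def by blast
    have "c < diam X \<tau>" if \<tau>: "\<tau> \<in> long_edges K L \<sigma>" for \<tau>
    proof -
      have "\<tau> \<in> simplices L 1" using \<tau> by (simp add: long_edges_def)
      then obtain u v where uv: "u < v" "\<tau> = {u, v}" "{u, v} \<in> L" using simplices_1_iff by blast
      then have "{u, v} \<notin> K" using \<tau> by (auto simp: long_edges_def)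
      then show ?thesis using long[OF uv(3)] uv(2) by (simp add: diam_pair)
    qed
    then have "(\<Sum>\<tau>\<in>long_edges K L \<sigma>. c) < (\<Sum>\<tau>\<in>long_edges K L \<sigma>. diam X \<tau>)"
      using ne by (intro sum_strict_mono) auto
    moreover have "0 < real (card (long_edges K L \<sigma>))" using ne by (simp add: card_gt_0_iff)
    ultimately show ?thesis by (simp add: f_def pos_less_divide_eq mult.commute)
  qed
  obtain \<sigma> where \<sigma>: "\<omega> $ \<sigma> \<noteq> 0" using \<omega>0 by (auto simp: vec_eq_iff)
  then have "\<sigma> \<in> simplices L 2" using \<omega>L by (auto simp: cochains_def)
  then have "0 < (\<Sum>\<sigma>\<in>simplices L 2. (f \<sigma> - c) * \<bar>\<omega> $ \<sigma>\<bar>)"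
  proof (rule sum_pos2[of _ \<sigma>, rotated])
    show "0 < (f \<sigma> - c) * \<bar>\<omega> $ \<sigma>\<bar>" using f[OF \<sigma>] \<sigma> by simp
    show "0 \<le> (f \<sigma> - c) * \<bar>\<omega> $ \<sigma>\<bar>" for \<sigma> using f[of \<sigma>] by (cases "\<omega> $ \<sigma> = 0") auto
  qed simp
  from weighted_mean_gt[OF \<omega>L \<omega>0 this] show ?thesis
    by (simp only: death_value_def Let_def \<omega>_def f_def)
qed

text \<open>\<open>sqrt 3\<close> is the side of the inscribed equilateral triangle; shorter edges
  make fewer than a third of all steps.\<close>

lemma death_ge_sqrt3:
  assumes n: "3 \<le> CARD('n)"
    and d: "polygon_scale (polygon 1 :: 'n::{finite,linorder} config) \<le> d"
      "\<not> small_steps (VR (polygon 1 :: 'n config) d)"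
  shows "sqrt 3 \<le> d"
proof (rule ccontr)
  assume lt: "\<not> sqrt 3 \<le> d"
  have "3 * cdist u v < int CARD('n)" if "{u, v} \<in> VR (polygon 1) d" for u v :: 'n
  proof -
    have "chord u v < 2 * sin (pi / 3)" using that lt by (simp add: dist_polygon sin_60)
    then have "sin (pi * of_int (cdist u v) / CARD('n)) < sin (pi / 3)" by (simp add: chord_def)
    moreover have "0 \<le> pi * of_int (cdist u v) / CARD('n)" by simp
    moreover have "pi * of_int (cdist u v) / CARD('n) \<le> pi / 2"
    proof -
      have "pi * of_int (2 * cdist u v) \<le> pi * of_int (int CARD('n))"
        using cdist_half[of u v] by (intro mult_left_mono) simp_all
      then show ?thesis by (simp add: field_simps)
    qed
    ultimately have "\<not> pi / 3 \<le> pi * of_int (cdist u v) / CARD('n)"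
      using sin_monotone_2pi_le[of "pi / 3" "pi * of_int (cdist u v) / CARD('n)"] pi_gt_zero by linarith
    then have "pi * of_int (cdist u v) / CARD('n) < pi / 3" by simp
    then have "real_of_int (3 * cdist u v) < of_int (int CARD('n))" by (simp add: field_simps)
    then show ?thesis by (simp only: of_int_less_iff)
  qed
  then show False using d(2) by (simp add: small_steps_def)
qed

lemma chord_le_2: "chord u v \<le> 2"
  by (simp add: chord_def)

lemma death_value_gt_birth_value:
  fixes b d \<epsilon> :: real
  defines "X \<equiv> polygon 1 :: 'n::{finite,linorder} config"
  assumes n: "3 \<le> CARD('n)" and bd: "\<And>t. nontrivial_H1 (VR X t) \<longleftrightarrow> b \<le> t \<and> t < d"
    and b: "b = polygon_scale X" and \<epsilon>: "0 < \<epsilon>" "\<epsilon> < d - b"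
  shows "birth_value (VR X (b + \<epsilon>)) X < death_value (VR X (d - \<epsilon>)) (VR X (d + \<epsilon>)) X"
proof -
  let ?B = "VR X (b + \<epsilon>)" and ?K = "VR X (d - \<epsilon>)" and ?L = "VR X (d + \<epsilon>)"
  have reg: "regular_complex (VR X t)" if "b \<le> t" for t
    using that regular_complex_polygon[of 1] unfolding X_def b by simp
  have small: "small_steps (VR X t) \<longleftrightarrow> t < d" if "b \<le> t" for t
    using nontrivial_H1_regular_iff[OF n reg[OF that]] bd[of t] that by blast
  have B: "regular_complex ?B" "small_steps ?B" and K: "regular_complex ?K" "small_steps ?K"
    and L: "regular_complex ?L" "\<not> small_steps ?L" and d: "\<not> small_steps (VR X d)"
    using reg small \<epsilon> by auto
  have KL: "?K \<subseteq> ?L" using \<epsilon> by (intro VR_mono) simp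
  have edge: "{u, v} \<in> VR X t \<longleftrightarrow> chord u v \<le> t" for u v t by (simp add: X_def dist_polygon)
  define c where "c = birth_value ?B X"
  have c: "c \<le> b + \<epsilon>"
    unfolding c_def birth_value_def
  proof (rule weighted_mean_le[OF cochain_of_in_cochains(1) step_cochain_nonzero[OF n B(1)]])
    show "diam X \<sigma> \<le> b + \<epsilon>" if "\<sigma> \<in> simplices ?B 1" for \<sigma>
      using that by (auto simp: simplices_def VR_def)
  qed
  show ?thesis
  proof (cases "\<forall>u v. {u, v} \<in> ?L \<longrightarrow> {u, v} \<notin> ?K \<longrightarrow> c < dist (X $ u) (X $ v)")
    case True
    then show ?thesis unfolding c_def[symmetric]
      by (intro death_value_gt_of_long_edges[OF n K L KL]) blast
  next
    case False
    then obtain u v where uv: "{u, v} \<notin> ?K" "dist (X $ u) (X $ v) \<le> c" by (auto simp: not_less)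
    then have uvc: "d - \<epsilon> < chord u v" "chord u v \<le> c" unfolding edge by (simp_all add: X_def dist_polygon)
    \<comment> \<open>The exceptional edge is longer than a side, hence has at least two steps, and
      is present at time \<open>b + \<epsilon>\<close>, hence has fewer than a third of all steps.
      This leaves only \<open>CARD('n) \<ge> 7\<close>.\<close>
    have "b < chord u v" using uvc \<epsilon> by linarith
    obtain i :: 'n where True by simp
    have "{i, rot i} \<in> VR X b" using polygon_scale_le_iff[of X b] b by simp
    then have "chord i (rot i) < chord u v" using \<open>b < chord u v\<close> unfolding edge by linarith
    then have "2 \<le> cdist u v" unfolding chord_less_iff cdist_rot[OF n] by simp
    moreover have "{u, v} \<in> ?B" unfolding edge using uvc c by linarith
    then have "3 * cdist u v < int CARD('n)" using B(2) unfolding small_steps_def by blast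
    ultimately have n7: "7 \<le> CARD('n)" by linarith
    have sqrt3: "sqrt 3 \<le> d"
      using death_ge_sqrt3[OF n, of d] d \<epsilon> unfolding X_def b by simp
    moreover have "5 / 3 \<le> sqrt (3::real)" by (rule real_le_rsqrt) (simp add: power2_eq_square)
    moreover have "b \<le> 1"
    proof -
      have "pi / CARD('n) \<le> pi / 6" using n7 by (intro divide_left_mono) auto
      then have "sin (pi / CARD('n)) \<le> sin (pi / 6)"
        using pi_gt_zero by (intro sin_monotone_2pi_le) (linarith | simp add: order_trans[of _ 0])+
      then show ?thesis using polygon_scale_polygon[OF n, of 1] unfolding b X_def by (simp add: sin_30)
    qed
    \<comment> \<open>Thus \<open>2 * \<epsilon> > d - b\<close>. With \<open>d \<ge> 5 / 3\<close>
      and \<open>b \<le> 1\<close> this gives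
      \<open>d + \<epsilon> > (3 * d - b) / 2 \<ge> 2\<close>, the diameter of the circle.\<close>
    moreover have "d - \<epsilon> < b + \<epsilon>" using uvc c by linarith
    ultimately have "2 \<le> d + \<epsilon>" by linarith
    then have "chord x y \<le> d + \<epsilon>" for x y :: 'n using chord_le_2[of x y] by linarith
    then have full: "\<sigma> \<in> ?L" if "\<sigma> \<noteq> {}" for \<sigma>
      using that unfolding VR_iff by (simp add: X_def dist_polygon)
    show ?thesis unfolding c_def[symmetric]
    proof (rule death_value_full_gt[OF n, folded X_def, OF K full L KL])
      show "chord x y < c" if "{x, y} \<in> ?K" for x y using that uvc unfolding edge by linarith
      show "c * (real CARD('n) - 1) < (\<Sum>w\<in>UNIV. chord x w)" for x :: 'n
        using mean_chord_gt_birth_value[OF n7 B] unfolding c_def X_def .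
    qed
  qed
qed

section \<open>Local formula\<close>

text \<open>No distance equals the limiting time, so each of the finitely many comparisons is strict
  and therefore stable.\<close>

lemma eventually_VR_eq:
  fixes X0 :: "'n::finite config"
  assumes \<tau>: "(\<tau> \<longlongrightarrow> t0) (nhds X0)" and ne: "\<And>u v. dist (X0 $ u) (X0 $ v) \<noteq> t0"
  shows "\<forall>\<^sub>F X in nhds X0. VR X (\<tau> X) = VR X0 t0"
proof -
  have "\<forall>\<^sub>F X in nhds X0. dist (X $ u) (X $ v) \<le> \<tau> X \<longleftrightarrow> dist (X0 $ u) (X0 $ v) \<le> t0" for u v
  proof -
    have lim: "((\<lambda>X. dist (X $ u) (X $ v) - \<tau> X) \<longlongrightarrow> dist (X0 $ u) (X0 $ v) - t0) (nhds X0)"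
      by (intro tendsto_diff tendsto_dist tendsto_vec_nth filterlim_ident \<tau>)
    show ?thesis
    proof (cases "dist (X0 $ u) (X0 $ v) < t0")
      case True
      then have "\<forall>\<^sub>F X in nhds X0. dist (X $ u) (X $ v) - \<tau> X < 0" using lim by (intro order_tendstoD(2)) auto
      then show ?thesis by (rule eventually_mono) (use True in auto)
    next
      case False
      then have "\<forall>\<^sub>F X in nhds X0. 0 < dist (X $ u) (X $ v) - \<tau> X"
        using lim ne[of u v] by (intro order_tendstoD(1)) auto
      then show ?thesis by (rule eventually_mono) (use False ne[of u v] in auto)
    qed
  qed
  then have "\<forall>\<^sub>F X in nhds X0. \<forall>u v. dist (X $ u) (X $ v) \<le> \<tau> X \<longleftrightarrow> dist (X0 $ u) (X0 $ v) \<le> t0"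
    by (intro eventually_all_finite)
  then show ?thesis by (rule eventually_mono) (intro VR_eqI, blast)
qed

lemma eventually_step_ordered:
  fixes X0 :: "'n::{finite,linorder} config"
  assumes "step_ordered X0"
  shows "\<forall>\<^sub>F X in nhds X0. step_ordered X"
  unfolding step_ordered_def
proof (intro eventually_all_finite)
  fix u v u' v' :: 'n
  show "\<forall>\<^sub>F X in nhds X0. cdist u v < cdist u' v' \<longrightarrow> dist (X $ u) (X $ v) < dist (X $ u') (X $ v')"
  proof (cases "cdist u v < cdist u' v'")
    case True
    have "((\<lambda>X. dist (X $ u') (X $ v') - dist (X $ u) (X $ v)) \<longlongrightarrow>
        dist (X0 $ u') (X0 $ v') - dist (X0 $ u) (X0 $ v)) (nhds X0)"
      by (intro tendsto_diff tendsto_dist tendsto_vec_nth filterlim_ident)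
    moreover have "0 < dist (X0 $ u') (X0 $ v') - dist (X0 $ u) (X0 $ v)"
      using assms True by (simp add: step_ordered_def)
    ultimately have "\<forall>\<^sub>F X in nhds X0. 0 < dist (X $ u') (X $ v') - dist (X $ u) (X $ v)"
      by (rule order_tendstoD(1))
    then show ?thesis by (rule eventually_mono) simp
  qed simp
qed

text \<open>The endpoints are determined by the times with nontrivial cohomology. Probing slightly
  before and after each endpoint, at times where the complexes are locally constant, confines the
  endpoints of nearby bars.\<close>

lemma bar_continuous:
  fixes X0 :: "'n::{finite,linorder} config" and b d :: "'n config \<Rightarrow> real"
  assumes n: "3 \<le> CARD('n)" and X0: "step_ordered X0" "has_bar X0"
    and bar: "\<And>X. has_bar X \<Longrightarrow> most_persistent_bar X (b X) (d X) (z X)"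
  shows "\<forall>\<^sub>F X in nhds X0. has_bar X" "(b \<longlongrightarrow> b X0) (nhds X0)" "(d \<longlongrightarrow> d X0) (nhds X0)"
proof -
  note props = most_persistent_bar_step_ordered[OF n _ bar]
  define b0 d0 where "b0 = b X0" and "d0 = d X0"
  have bd: "b0 < d0" and NT0: "\<And>t. nontrivial_H1 (VR X0 t) \<longleftrightarrow> b0 \<le> t \<and> t < d0"
    using props(1,2)[OF X0] by (simp_all add: b0_def d0_def)
  have main: "\<forall>\<^sub>F X in nhds X0. has_bar X \<and> \<bar>b X - b0\<bar> < e \<and> \<bar>d X - d0\<bar> < e" if e: "0 < e" for e
  proof -
    define S where "S = (\<lambda>(u, v). dist (X0 $ u) (X0 $ v)) ` UNIV"
    \<comment> \<open>The values of \<delta> for which a probing time would coincide with a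
      distance; there are finitely many.\<close>
    define bad where "bad = (\<lambda>s. b0 - s) ` S \<union> (\<lambda>s. s - b0) ` S \<union> (\<lambda>s. d0 - s) ` S \<union> (\<lambda>s. s - d0) ` S"
    have "finite bad" by (simp add: bad_def S_def)
    moreover have "infinite {0<..<min e ((d0 - b0) / 2)}" using e bd by (simp add: infinite_Ioo)
    ultimately have "\<not> {0<..<min e ((d0 - b0) / 2)} \<subseteq> bad" using finite_subset by blast
    then obtain \<delta> where \<delta>: "\<delta> \<in> {0<..<min e ((d0 - b0) / 2)}" "\<delta> \<notin> bad" by blast
    have ne: "dist (X0 $ u) (X0 $ v) \<noteq> t" if "t \<in> {b0 - \<delta>, b0 + \<delta>, d0 - \<delta>, d0 + \<delta>}" for t u v
    proof
      assume eq: "dist (X0 $ u) (X0 $ v) = t"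
      have "t \<in> S" unfolding S_def eq[symmetric] by force
      then have "b0 - t \<in> bad" "t - b0 \<in> bad" "d0 - t \<in> bad" "t - d0 \<in> bad" unfolding bad_def by blast+
      then show False using that \<delta>(2) by auto
    qed
    have ev: "\<forall>\<^sub>F X in nhds X0. VR X t = VR X0 t" if "t \<in> {b0 - \<delta>, b0 + \<delta>, d0 - \<delta>, d0 + \<delta>}" for t
      using ne[OF that] by (intro eventually_VR_eq tendsto_const)
    have "\<forall>\<^sub>F X in nhds X0. step_ordered X \<and> VR X (b0 - \<delta>) = VR X0 (b0 - \<delta>) \<and>
      VR X (b0 + \<delta>) = VR X0 (b0 + \<delta>) \<and> VR X (d0 - \<delta>) = VR X0 (d0 - \<delta>) \<and> VR X (d0 + \<delta>) = VR X0 (d0 + \<delta>)"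
      by (intro eventually_conj eventually_step_ordered X0(1) ev) auto
    then show ?thesis
    proof (rule eventually_mono)
      fix X
      assume X: "step_ordered X \<and> VR X (b0 - \<delta>) = VR X0 (b0 - \<delta>) \<and>
        VR X (b0 + \<delta>) = VR X0 (b0 + \<delta>) \<and> VR X (d0 - \<delta>) = VR X0 (d0 - \<delta>) \<and> VR X (d0 + \<delta>) = VR X0 (d0 + \<delta>)"
      have \<delta>': "0 < \<delta>" "\<delta> < e" "2 * \<delta> < d0 - b0" using \<delta>(1) by auto
      have "\<not> nontrivial_H1 (VR X0 (b0 - \<delta>))" "nontrivial_H1 (VR X0 (b0 + \<delta>))"
        "nontrivial_H1 (VR X0 (d0 - \<delta>))" "\<not> nontrivial_H1 (VR X0 (d0 + \<delta>))"
        unfolding NT0 using \<delta>' by linarith+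
      then have t: "\<not> nontrivial_H1 (VR X (b0 - \<delta>))" "nontrivial_H1 (VR X (b0 + \<delta>))"
        "nontrivial_H1 (VR X (d0 - \<delta>))" "\<not> nontrivial_H1 (VR X (d0 + \<delta>))"
        using X by metis+
      have hb: "has_bar X" using X t(2) has_bar_of_nontrivial_H1[OF n] by blast
      have iff: "nontrivial_H1 (VR X t) \<longleftrightarrow> b X \<le> t \<and> t < d X" for t
        by (rule props(2)[OF _ hb]) (use X in blast)
      have "b X \<le> b0 + \<delta>" "b0 - \<delta> < b X" "d0 - \<delta> < d X" "d X \<le> d0 + \<delta>"
        using t \<delta>' unfolding iff by linarith+
      then show "has_bar X \<and> \<bar>b X - b0\<bar> < e \<and> \<bar>d X - d0\<bar> < e"
        using hb \<delta>'(2) by auto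
    qed
  qed
  show "\<forall>\<^sub>F X in nhds X0. has_bar X" by (rule eventually_mono[OF main[of 1]]) simp_all
  show "(b \<longlongrightarrow> b X0) (nhds X0)"
    unfolding tendsto_iff dist_real_def b0_def[symmetric]
    by (intro allI impI, rule eventually_mono[OF main], assumption) blast
  show "(d \<longlongrightarrow> d X0) (nhds X0)"
    unfolding tendsto_iff dist_real_def d0_def[symmetric]
    by (intro allI impI, rule eventually_mono[OF main], assumption) blast
qed

text \<open>Contents are normalized by the norm of the cochain, so a nonzero scalar cancels.\<close>

lemma content_eq_value:
  fixes Y :: "'n::{finite,linorder} config"
  assumes c: "c \<noteq> 0"
    and birth: "birth_cochain (VR Y (b - \<epsilon>)) Lb 1 (z (b + \<epsilon>)) = c *\<^sub>R step_cochain Lb"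
      "VR Y (b + \<epsilon>) = Lb"
  shows "birth_content Y \<epsilon> b z = birth_value Lb Y"
proof -
  have "l1_norm (c *\<^sub>R step_cochain Lb) = \<bar>c\<bar> * l1_norm (step_cochain Lb)"
    by (simp add: l1_norm_def abs_mult sum_distrib_left)
  then show ?thesis
    using c by (simp add: birth_content_def birth_value_def birth abs_mult del: One_nat_def)
qed

lemma death_content_eq_value:
  fixes Y :: "'n::{finite,linorder} config"
  assumes c: "c \<noteq> 0"
    and death: "death_cochain K L 1 (z (d - \<epsilon>)) = c *\<^sub>R death_cochain K L 1 (step_cochain K)"
      "VR Y (d - \<epsilon>) = K" "VR Y (d + \<epsilon>) = L"
  shows "relaxed_death_content Y \<epsilon> d z = death_value K L Y"
proof -
  let ?\<omega> = "death_cochain K L 1 (step_cochain K)"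
  have "l1_norm (c *\<^sub>R ?\<omega>) = \<bar>c\<bar> * l1_norm ?\<omega>"
    by (simp add: l1_norm_def abs_mult sum_distrib_left)
  moreover have "relaxed_diam Y \<epsilon> d \<sigma> = (\<Sum>\<tau>\<in>long_edges K L \<sigma>. diam Y \<tau>) / real (card (long_edges K L \<sigma>))" for \<sigma>
    by (simp only: relaxed_diam_def long_edges_def death Let_def)
  ultimately show ?thesis
    using c by (simp add: relaxed_death_content_def death_value_def death abs_mult Let_def del: One_nat_def)
qed

section \<open>Regularity, homogeneity and symmetry of the local formula\<close>

lemma diam_differentiable:
  fixes X0 :: "'n::{finite,linorder} config"
  assumes "\<And>u v. u \<noteq> v \<Longrightarrow> X0 $ u \<noteq> X0 $ v" "\<sigma> \<in> simplices K 1"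
  shows "(\<lambda>X. diam X \<sigma>) differentiable (at X0)"
proof -
  obtain u v where uv: "u < v" "\<sigma> = {u, v}" using assms(2) simplices_1_iff[of \<sigma> K] by blast
  have "(\<lambda>X::'n config. X $ u - X $ v) differentiable (at X0)"
    by (intro bounded_linear_imp_differentiable bounded_linear_sub bounded_linear_vec_nth)
  moreover have "norm differentiable (at (X0 $ u - X0 $ v))"
    using assms(1)[of u v] uv by (intro differentiable_norm_at) auto
  ultimately have "(norm \<circ> (\<lambda>X::'n config. X $ u - X $ v)) differentiable (at X0)"
    by (intro differentiable_chain_at)
  then show ?thesis by (simp add: uv diam_pair dist_norm o_def)
qed

lemma value_differentiable:
  fixes X0 :: "'n::{finite,linorder} config"
  assumes "\<And>u v. u \<noteq> v \<Longrightarrow> X0 $ u \<noteq> X0 $ v"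
  shows "birth_value L differentiable (at X0)" "death_value K L differentiable (at X0)"
proof -
  have scale: "(\<lambda>X. f X * a / c) differentiable (at X0)" if "f differentiable (at X0)"
    for f :: "'n config \<Rightarrow> real" and a c
    using differentiable_mult[OF that differentiable_const[of "a / c"]] by simp
  have "(\<lambda>X. birth_value L X) differentiable (at X0)"
    unfolding birth_value_def
    by (intro differentiable_sum ballI scale diam_differentiable[OF assms]) auto
  then show "birth_value L differentiable (at X0)" by simp
  have "(\<lambda>X. (\<Sum>\<tau>\<in>long_edges K L \<sigma>. diam X \<tau>) / real (card (long_edges K L \<sigma>))) differentiable (at X0)" for \<sigma>
  proof -
    have "(\<lambda>X. \<Sum>\<tau>\<in>long_edges K L \<sigma>. diam X \<tau>) differentiable (at X0)"
      by (intro differentiable_sum ballI diam_differentiable[OF assms, of _ L]) (auto simp: long_edges_def)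
    from scale[OF this, of 1] show ?thesis by simp
  qed
  then have "(\<lambda>X. death_value K L X) differentiable (at X0)"
    unfolding death_value_def Let_def by (intro differentiable_sum ballI scale) auto
  then show "death_value K L differentiable (at X0)" by simp
qed

lemma diam_scaleR: "0 \<le> t \<Longrightarrow> \<sigma> \<in> simplices K 1 \<Longrightarrow> diam (t *\<^sub>R X) \<sigma> = t * diam X \<sigma>"
  for X :: "'n::{finite,linorder} config"
  using simplices_1_iff[of \<sigma> K] by (auto simp: diam_pair dist_norm simp flip: scaleR_right_diff_distrib)

lemma value_scaleR:
  fixes X :: "'n::{finite,linorder} config"
  assumes "0 \<le> t"
  shows "birth_value L (t *\<^sub>R X) = t * birth_value L X" "death_value K L (t *\<^sub>R X) = t * death_value K L X"
proof -
  show "birth_value L (t *\<^sub>R X) = t * birth_value L X"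
    unfolding birth_value_def sum_distrib_left
    by (intro sum.cong refl) (simp add: diam_scaleR[OF assms] del: One_nat_def)
  have mean: "(\<Sum>\<tau>\<in>long_edges K L \<sigma>. diam (t *\<^sub>R X) \<tau>) = t * (\<Sum>\<tau>\<in>long_edges K L \<sigma>. diam X \<tau>)" for \<sigma>
    unfolding sum_distrib_left
    by (intro sum.cong refl diam_scaleR[OF assms, of _ L]) (simp add: long_edges_def)
  show "death_value K L (t *\<^sub>R X) = t * death_value K L X"
    unfolding death_value_def Let_def mean by (subst sum_distrib_left) (intro sum.cong refl, simp)
qed

lemma diam_transform:
  fixes X :: "'n::{finite,linorder} config" and T :: "real ^ 2 \<Rightarrow> real ^ 2" and \<pi> :: "'n \<Rightarrow> 'n"
  assumes "orthogonal_transformation T" "\<sigma> \<in> simplices K 1"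
  shows "diam (\<chi> i. T (X $ \<pi> i)) \<sigma> = diam X (\<pi> ` \<sigma>)"
proof -
  have "dist (T x) (T y) = dist x y" for x y
    using assms(1) by (metis orthogonal_transformation_isometry)
  then show ?thesis using assms(2) simplices_1_iff[of \<sigma> K] by (auto simp: diam_pair)
qed

lemma simplices_image:
  fixes K :: "'n::{finite,linorder} set set"
  assumes \<pi>: "bij \<pi>" and cd: "\<And>u v. cdist (\<pi> u) (\<pi> v) = cdist u v" and K: "regular_complex K"
  shows "\<pi> ` \<sigma> \<in> simplices K k \<longleftrightarrow> \<sigma> \<in> simplices K k"
proof -
  have e: "{\<pi> u, \<pi> v} \<in> K \<longleftrightarrow> {u, v} \<in> K" for u v by (rule regular_edge_cong[OF K cd])
  have "flag K" using K by (simp add: regular_complex_def)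
  then have fl: "\<rho> \<in> K \<longleftrightarrow> \<rho> \<noteq> {} \<and> (\<forall>u\<in>\<rho>. \<forall>v\<in>\<rho>. {u, v} \<in> K)" for \<rho>
    unfolding flag_def by (rule spec)
  have "\<pi> ` \<sigma> \<in> K \<longleftrightarrow> \<sigma> \<in> K"
    unfolding fl[of "\<pi> ` \<sigma>"] fl[of \<sigma>] by (simp add: e)
  moreover have "card (\<pi> ` \<sigma>) = card \<sigma>" 
    by (rule card_image[OF inj_on_subset[OF bij_is_inj[OF \<pi>] subset_UNIV]])
  ultimately show ?thesis by (simp add: simplices_def)
qed

lemma bij_betw_simplices:
  fixes K :: "'n::{finite,linorder} set set"
  assumes \<pi>: "bij \<pi>" and cd: "\<And>u v. cdist (\<pi> u) (\<pi> v) = cdist u v" and K: "regular_complex K"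
  shows "bij_betw (image \<pi>) (simplices K k) (simplices K k)"
proof -
  have "inj_on (image \<pi>) (simplices K k)"
    using bij_is_inj[OF \<pi>] by (intro inj_onI) (simp add: inj_image_eq_iff)
  moreover have "image \<pi> ` simplices K k \<subseteq> simplices K k"
    using simplices_image[OF assms] by auto
  ultimately show ?thesis
    by (simp add: bij_betw_def endo_inj_surj)
qed

text \<open>The isometry preserves lengths, and the permutation only reindexes the sums because it
  preserves the complexes and the absolute values of the cochains.\<close>

lemma value_transform:
  fixes X :: "'n::{finite,linorder} config" and T :: "real ^ 2 \<Rightarrow> real ^ 2"
  assumes T: "orthogonal_transformation T" and \<pi>: "bij \<pi>" and cd: "\<And>u v. cdist (\<pi> u) (\<pi> v) = cdist u v"
    and s: "\<And>u v. sstep (\<pi> u) (\<pi> v) = s * sstep u v" "s * s = 1"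
    and K: "regular_complex K" and L: "regular_complex L" and KL: "K \<subseteq> L"
  shows "birth_value L (\<chi> i. T (X $ \<pi> i)) = birth_value L X"
    and "death_value K L (\<chi> i. T (X $ \<pi> i)) = death_value K L X"
proof -
  let ?Y = "\<chi> i. T (X $ \<pi> i)"
  have s1: "\<bar>s\<bar> = 1" using s(2) square_eq_1_iff[of s] by auto
  have abs: "\<bar>step_cochain L $ (\<pi> ` \<sigma>)\<bar> = \<bar>step_cochain L $ \<sigma>\<bar>" if \<sigma>: "\<sigma> \<in> simplices L 1" for \<sigma>
  proof -
    obtain u v where uv: "u < v" "\<sigma> = {u, v}" "{u, v} \<in> L" using \<sigma> simplices_1_iff by blast
    have "\<pi> u \<noteq> \<pi> v" using uv(1) bij_is_inj[OF \<pi>] by (auto simp: inj_eq)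
    moreover have "{\<pi> u, \<pi> v} \<in> L" using uv(3) regular_edge_cong[OF L cd] by blast
    ultimately have "\<bar>step_cochain L $ {\<pi> u, \<pi> v}\<bar> = \<bar>sstep (\<pi> u) (\<pi> v)\<bar>"
      using abs_evl[of "\<pi> u" "\<pi> v" "step_cochain L"] by (simp add: evl_step_cochain)
    moreover have "\<bar>step_cochain L $ {u, v}\<bar> = \<bar>sstep u v\<bar>"
      using abs_evl[of u v "step_cochain L"] uv by (simp add: evl_step_cochain)
    ultimately show ?thesis using uv(2) s1 by (simp add: s(1) abs_mult)
  qed
  have "birth_value L ?Y = (\<Sum>\<sigma>\<in>simplices L 1. diam X (\<pi> ` \<sigma>) * \<bar>step_cochain L $ (\<pi> ` \<sigma>)\<bar> / l1_norm (step_cochain L))"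
    unfolding birth_value_def by (intro sum.cong refl) (simp add: diam_transform[OF T] abs del: One_nat_def)
  also have "\<dots> = birth_value L X"
    unfolding birth_value_def by (rule sum.reindex_bij_betw[OF bij_betw_simplices[OF \<pi> cd L]])
  finally show "birth_value L ?Y = birth_value L X" .
  let ?\<omega> = "death_cochain K L 1 (step_cochain K)"
  have inj: "inj_on (image \<pi>) S" for S
    using bij_is_inj[OF \<pi>] by (intro inj_onI) (simp add: inj_image_eq_iff)
  have long: "long_edges K L (\<pi> ` \<sigma>) = image \<pi> ` long_edges K L \<sigma>" for \<sigma>
  proof (rule set_eqI, rule iffI)
    fix \<tau> assume \<tau>: "\<tau> \<in> long_edges K L (\<pi> ` \<sigma>)"
    then obtain \<rho> where \<rho>: "\<rho> \<subseteq> \<sigma>" "\<tau> = \<pi> ` \<rho>" by (auto simp: long_edges_def subset_image_iff)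
    then show "\<tau> \<in> image \<pi> ` long_edges K L \<sigma>"
      using \<tau> simplices_image[OF \<pi> cd K] simplices_image[OF \<pi> cd L] by (auto simp: long_edges_def)
  next
    fix \<tau> assume "\<tau> \<in> image \<pi> ` long_edges K L \<sigma>"
    then show "\<tau> \<in> long_edges K L (\<pi> ` \<sigma>)"
      using simplices_image[OF \<pi> cd K] simplices_image[OF \<pi> cd L] by (auto simp: long_edges_def)
  qed
  have mean: "(\<Sum>\<tau>\<in>long_edges K L \<sigma>. diam ?Y \<tau>) / real (card (long_edges K L \<sigma>))
      = (\<Sum>\<tau>\<in>long_edges K L (\<pi> ` \<sigma>). diam X \<tau>) / real (card (long_edges K L (\<pi> ` \<sigma>)))" for \<sigma>
  proof -
    have "(\<Sum>\<tau>\<in>long_edges K L \<sigma>. diam ?Y \<tau>) = (\<Sum>\<tau>\<in>long_edges K L \<sigma>. diam X (\<pi> ` \<tau>))"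
      by (intro sum.cong refl diam_transform[OF T, of _ L]) (simp add: long_edges_def)
    also have "\<dots> = (\<Sum>\<tau>\<in>long_edges K L (\<pi> ` \<sigma>). diam X \<tau>)"
      unfolding long by (simp add: sum.reindex[OF inj])
    finally show ?thesis unfolding long by (simp add: card_image[OF inj])
  qed
  let ?g = "\<lambda>\<sigma>. (\<Sum>\<tau>\<in>long_edges K L \<sigma>. diam X \<tau>) / real (card (long_edges K L \<sigma>)) * \<bar>?\<omega> $ \<sigma>\<bar> / l1_norm ?\<omega>"
  have "death_value K L ?Y = (\<Sum>\<sigma>\<in>simplices L 2. ?g (\<pi> ` \<sigma>))"
    unfolding death_value_def Let_def mean death_cochain_symmetric[OF \<pi> s cd K L KL] ..
  also have "\<dots> = death_value K L X"
    unfolding death_value_def Let_def by (rule sum.reindex_bij_betw[OF bij_betw_simplices[OF \<pi> cd L]])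
  finally show "death_value K L ?Y = death_value K L X" .
qed

section \<open>Dihedral symmetry\<close>

text \<open>Clockwise for positive \<open>a\<close>, so that together with the relabelling
  \<open>rot\<close> it fixes the polygon.\<close>

definition rotation :: "real \<Rightarrow> real ^ 2 \<Rightarrow> real ^ 2" where
  "rotation a x = vector [cos a * x $ 1 + sin a * x $ 2, - sin a * x $ 1 + cos a * x $ 2]"

definition reflection :: "real ^ 2 \<Rightarrow> real ^ 2" where
  "reflection x = vector [x $ 1, - x $ 2]"

lemma orthogonal_rotation: "orthogonal_transformation (rotation a)"
  unfolding orthogonal_transformation
proof
  show "linear (rotation a)"
    by (rule linearI) (simp_all add: rotation_def vec_eq_iff forall_2 algebra_simps)
  show "\<forall>x. norm (rotation a x) = norm x"
  proof
    fix x
    have "(norm (rotation a x))\<^sup>2 = ((cos a)\<^sup>2 + (sin a)\<^sup>2) * ((x $ 1)\<^sup>2 + (x $ 2)\<^sup>2)"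
      unfolding vec2_norm_power2 rotation_def vector_2 by algebra
    then show "norm (rotation a x) = norm x"
      by (simp add: vec2_norm_power2[symmetric] power2_eq_iff_nonneg)
  qed
qed

lemma orthogonal_reflection: "orthogonal_transformation reflection"
  unfolding orthogonal_transformation
proof
  show "linear reflection"
    by (rule linearI) (simp_all add: reflection_def vec_eq_iff forall_2)
  show "\<forall>x. norm (reflection x) = norm x"
  proof
    fix x
    have "(norm (reflection x))\<^sup>2 = (norm x)\<^sup>2"
      unfolding vec2_norm_power2 reflection_def vector_2 by simp
    then show "norm (reflection x) = norm x" by (simp add: power2_eq_iff_nonneg)
  qed
qed

lemma polygon_lab:
  "polygon r $ (lab x :: 'n::{finite,linorder}) =
    vector [r * cos (2 * pi * of_int x / CARD('n)), r * sin (2 * pi * of_int x / CARD('n))]"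
proof -
  let ?n = "int CARD('n)" and ?a = "2 * pi * of_int x / CARD('n)"
  have "x mod ?n = x - ?n * (x div ?n)" by (simp add: minus_mult_div_eq_mod)
  then have c: "real_of_int (x mod ?n) = of_int x - CARD('n) * of_int (x div ?n)" by simp
  have "2 * pi * of_int (x mod ?n) / CARD('n) = ?a - 2 * pi * of_int (x div ?n)"
    unfolding c by (simp add: field_simps)
  then show ?thesis
    by (simp add: polygon_def cos_diff sin_diff cos_int_2pin sin_int_2pin)
qed

lemma rotation_polygon: "rotation (2 * pi / CARD('n)) (polygon r $ rot i) = polygon r $ i"
  for i :: "'n::{finite,linorder}"
proof -
  let ?a = "2 * pi / CARD('n)" and ?b = "2 * pi * of_int (pos i) / CARD('n)"
  have "2 * pi * of_int (pos i + 1) / CARD('n) = ?b + ?a" by (simp add: field_simps)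
  then have "rotation ?a (polygon r $ rot i)
      = vector [r * (cos ((?b + ?a) - ?a)), r * (sin ((?b + ?a) - ?a))]"
    unfolding rot_def polygon_lab rotation_def cos_diff sin_diff by (simp add: vec_eq_iff forall_2 algebra_simps)
  then show ?thesis by (simp add: polygon_def)
qed

lemma reflection_polygon: "reflection (polygon r $ flip i) = polygon r $ i"
  for i :: "'n::{finite,linorder}"
  unfolding flip_def polygon_lab by (simp add: reflection_def polygon_def)

lemma rot_induct [case_names zero rot]:
  assumes "Q (lab 0)" "\<And>i. Q i \<Longrightarrow> Q (rot i)"
  shows "Q (i :: 'n::{finite,linorder})"
proof -
  have "Q (lab (int k))" for k
  proof (induction k)
    case (Suc k)
    have "lab (int (Suc k)) = rot (lab (int k) :: 'n)"
      by (rule lab_eqI) (simp add: rot_def mod_simps, simp add: add.commute)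
    then show ?case using assms(2)[OF Suc] by simp
  qed (use assms(1) in simp)
  from this[of "nat (pos i)"] show ?thesis by simp
qed

text \<open>Obtained by differentiating \<open>G \<circ> R = G\<close> at a fixed point of the
  linear map \<open>R\<close>.\<close>

lemma derivative_invariant:
  fixes G :: "'a::real_normed_vector \<Rightarrow> real"
  assumes "(G has_derivative G') (at x)" "bounded_linear R" "R x = x" "\<And>y. G (R y) = G y"
  shows "G' (R v) = G' v"
proof -
  have "(R has_derivative R) (at x)" using assms(2) by (rule bounded_linear_imp_has_derivative)
  moreover have "(G has_derivative G') (at (R x))" using assms by simp
  ultimately have "(G \<circ> R has_derivative G' \<circ> R) (at x)" by (rule diff_chain_at)
  moreover have "G \<circ> R = G" using assms(4) by auto
  ultimately have "G' \<circ> R = G'" using assms(1) has_derivative_unique by metis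
  then show ?thesis by (metis comp_apply)
qed

text \<open>Rotations reduce the derivative to its action on the vertex \<open>lab 0\<close>. The
  reflection that fixes this vertex kills the tangential direction, and the outward directions at
  all vertices contribute equally to the radial derivative, which is 0.\<close>

lemma symmetric_derivative_zero:
  fixes G :: "'n::{finite,linorder} config \<Rightarrow> real"
  assumes r: "0 < r" and G': "(G has_derivative G') (at (polygon r))"
    and inv_rot: "\<And>X. G (\<chi> i. rotation (2 * pi / CARD('n)) (X $ rot i)) = G X"
    and inv_flip: "\<And>X. G (\<chi> i. reflection (X $ flip i)) = G X"
    and radial: "G' (polygon r) = 0"
  shows "G' = (\<lambda>_. 0)"
proof -
  let ?T = "rotation (2 * pi / CARD('n))" and ?o = "lab 0 :: 'n"
  have lin: "linear G'" using G' by (simp add: has_derivative_linear)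
  have bl: "bounded_linear (\<lambda>X :: 'n config. \<chi> i. T (X $ \<pi> i))" if "linear T" for T :: "real ^ 2 \<Rightarrow> real ^ 2" and \<pi>
    unfolding linear_conv_bounded_linear[symmetric]
    by (rule linearI) (simp_all add: vec_eq_iff linear_add[OF that] linear_scale[OF that] del: vec_eq_iff, simp_all add: vec_eq_iff)
  have linT: "linear ?T" and linS: "linear reflection"
    using orthogonal_rotation orthogonal_reflection by (auto simp: orthogonal_transformation)
  have rotG: "G' (\<chi> i. ?T (X $ rot i)) = G' X" for X
    by (rule derivative_invariant[OF G' bl[OF linT]]) (simp_all add: rotation_polygon inv_rot)
  have flipG: "G' (\<chi> i. reflection (X $ flip i)) = G' X" for X
    by (rule derivative_invariant[OF G' bl[OF linS]]) (simp_all add: reflection_polygon inv_flip)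
  have rot_axis: "G' (axis (rot i) w) = G' (axis i (?T w))" for i w
  proof -
    have "(\<chi> j. ?T (axis (rot i) w $ rot j)) = axis i (?T w)"
      by (rule vec_eq_iff[THEN iffD2])
        (simp add: axis_def linear_0[OF linT] inj_eq[OF bij_is_inj[OF bij_rot]])
    then show ?thesis using rotG[of "axis (rot i) w"] by simp
  qed
  have flip_o: "flip ?o = ?o" by (simp add: flip_def)
  have flip_axis: "G' (axis ?o w) = G' (axis ?o (reflection w))" for w
  proof -
    have "flip j = ?o \<longleftrightarrow> j = ?o" for j
      using inj_eq[OF bij_is_inj[OF bij_flip], of j ?o] flip_o by simp
    then have "(\<chi> j. reflection (axis ?o w $ flip j)) = axis ?o (reflection w)"
      by (intro vec_eq_iff[THEN iffD2] allI) (simp add: axis_def linear_0[OF linS])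
    then show ?thesis using flipG[of "axis ?o w"] by simp
  qed
  have decomp: "G' X = (\<Sum>i\<in>UNIV. G' (axis i (X $ i)))" for X
  proof -
    have "X = (\<Sum>i\<in>UNIV. axis i (X $ i))" by (simp add: vec_eq_iff axis_def)
    then show ?thesis using linear_sum[OF lin, of "\<lambda>i. axis i (X $ i)" UNIV] by simp
  qed
  have axis_add: "axis i (x + y) = axis i x + axis i y" and axis_scale: "axis i (c *\<^sub>R x) = c *\<^sub>R axis i x"
    for i :: 'n and x y :: "real ^ 2" and c by (auto simp: vec_eq_iff axis_def)
  let ?c = "G' (axis ?o (polygon r $ ?o))"
  have "G' (axis i (polygon r $ i)) = ?c" for i
    by (induction i rule: rot_induct) (simp_all add: rot_axis rotation_polygon)
  then have "(\<Sum>i\<in>UNIV. G' (axis i (polygon r $ i))) = (\<Sum>i\<in>(UNIV :: 'n set). ?c)"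
    by (rule sum.cong[OF refl])
  then have "real CARD('n) * ?c = 0" using decomp[of "polygon r"] radial by (simp only: sum_constant)
  then have c: "?c = 0" by simp
  have "G' (axis ?o w) = 0" for w
  proof -
    let ?e = "vector [0, 1] :: real ^ 2"
    have "reflection ?e = (- 1) *\<^sub>R ?e" by (simp add: reflection_def vec_eq_iff forall_2)
    then have "G' (axis ?o ?e) = - 1 * G' (axis ?o ?e)"
      using flip_axis[of ?e] by (simp only: axis_scale linear_scale[OF lin] real_scaleR_def)
    then have e: "G' (axis ?o ?e) = 0" by simp
    have "polygon r $ ?o = vector [r, 0]" by (simp add: polygon_lab)
    then have w: "w = (w $ 1 / r) *\<^sub>R polygon r $ ?o + (w $ 2) *\<^sub>R ?e"
      using r by (simp add: vec_eq_iff forall_2)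
    have "G' (axis ?o w) = G' (axis ?o ((w $ 1 / r) *\<^sub>R polygon r $ ?o + (w $ 2) *\<^sub>R ?e))"
      by (rule arg_cong[OF w, where f = "\<lambda>x. G' (axis ?o x)"])
    also have "\<dots> = (w $ 1 / r) * ?c + (w $ 2) * G' (axis ?o ?e)"
      by (simp only: axis_add axis_scale linear_add[OF lin] linear_scale[OF lin] real_scaleR_def)
    finally have "G' (axis ?o w) = (w $ 1 / r) * ?c + (w $ 2) * G' (axis ?o ?e)" .
    then show ?thesis using c e by simp
  qed
  then have zero: "\<forall>w. G' (axis i w) = 0" for i
    by (induction i rule: rot_induct) (simp_all add: rot_axis)
  show ?thesis
  proof
    fix X
    show "G' X = 0" unfolding decomp[of X] using zero by (intro sum.neutral ballI) blast
  qed
qed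

text \<open>The derivative need not be continuous, so the point is found, as in Darboux's theorem,
  as an interior minimum of \<open>g t - \<kappa> * t\<close>, which decreases at the left end and
  increases towards the right end.\<close>

lemma derivative_attains_value:
  fixes g :: "real \<Rightarrow> real"
  assumes g: "\<And>t. g differentiable (at t)" and \<kappa>: "0 < \<kappa>"
    and zero: "((\<lambda>t. deriv g t) \<longlongrightarrow> 0) (at_right 0)" and inf: "filterlim (\<lambda>t. deriv g t) at_top at_top"
  obtains r where "0 < r" "deriv g r = \<kappa>"
proof -
  have g': "(g has_real_derivative deriv g t) (at t)" for t
    using g DERIV_deriv_iff_real_differentiable by blast
  obtain a where a: "0 < a" "deriv g a < \<kappa>"
  proof -
    have "\<forall>\<^sub>F t in at_right 0. deriv g t < \<kappa>" using zero \<kappa> by (rule order_tendstoD(2))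
    moreover have "\<forall>\<^sub>F t in at_right (0::real). 0 < t" by (rule eventually_at_right_less)
    ultimately have "\<forall>\<^sub>F t in at_right 0. deriv g t < \<kappa> \<and> 0 < t" by (rule eventually_conj)
    then obtain t where "deriv g t < \<kappa> \<and> 0 < t"
      using eventually_happens trivial_limit_at_right_real by blast
    then show thesis using that by blast
  qed
  obtain c where c: "a < c" "\<kappa> < deriv g c"
  proof -
    have "\<forall>\<^sub>F t in at_top. \<kappa> < deriv g t" using inf by (simp add: filterlim_at_top_dense)
    moreover have "\<forall>\<^sub>F t in at_top. a < t" by (rule eventually_gt_at_top)
    ultimately have "\<forall>\<^sub>F t in at_top. \<kappa> < deriv g t \<and> a < t" by (rule eventually_conj)
    then obtain t where "\<kappa> < deriv g t \<and> a < t" using eventually_happens trivial_limit_at_top_linorder by blast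
    then show thesis using that by blast
  qed
  define h where "h t = g t - \<kappa> * t" for t
  have h': "(h has_real_derivative deriv g t - \<kappa>) (at t)" for t
    unfolding h_def using g'[of t] by (auto intro!: derivative_eq_intros)
  have "continuous_on {a..c} h"
    using h' by (intro continuous_at_imp_continuous_on ballI) (blast intro: DERIV_isCont)
  then obtain x where x: "x \<in> {a..c}" "\<And>y. y \<in> {a..c} \<Longrightarrow> h x \<le> h y"
    using continuous_attains_inf[of "{a..c}" h] c by auto
  have "x \<noteq> a"
  proof
    assume "x = a"
    obtain e where e: "0 < e" "\<And>s. 0 < s \<Longrightarrow> s < e \<Longrightarrow> h (a + s) < h a"
      using DERIV_neg_dec_right[OF h'[of a]] a by auto
    define s where "s = min (e / 2) (c - a)"
    have "0 < s" "s < e" "a + s \<in> {a..c}" using e c by (auto simp: s_def)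
    then show False using e(2)[of s] x(2)[of "a + s"] \<open>x = a\<close> by auto
  qed
  moreover have "x \<noteq> c"
  proof
    assume "x = c"
    obtain e where e: "0 < e" "\<And>s. 0 < s \<Longrightarrow> s < e \<Longrightarrow> h (c - s) < h c"
      using DERIV_pos_inc_left[OF h'[of c]] c by auto
    define s where "s = min (e / 2) (c - a)"
    have "0 < s" "s < e" "c - s \<in> {a..c}" using e c by (auto simp: s_def)
    then show False using e(2)[of s] x(2)[of "c - s"] \<open>x = c\<close> by auto
  qed
  ultimately have "a < x" "x < c" using x(1) by auto
  then have "deriv g x - \<kappa> = 0"
    by (intro DERIV_local_min[OF h'[of x], of "min (x - a) (c - x)"]) (auto intro!: x(2) simp: abs_less_iff)
  then show thesis using that[of x] \<open>a < x\<close> a by simp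
qed

lemma half_open_interval_eq:
  fixes a b c d :: real
  assumes "a < b" "\<And>t. a \<le> t \<and> t < b \<longleftrightarrow> c \<le> t \<and> t < d"
  shows "a = c" "b = d"
proof -
  have cd: "c \<le> a" "a < d" using assms(2)[of a] assms(1) by auto
  then have "a \<le> c" using assms(2)[of c] by auto
  then show ac: "a = c" using cd by simp
  show "b = d"
  proof (rule antisym)
    show "b \<le> d" using assms(2)[of d] cd by (meson less_irrefl less_imp_le not_le)
    show "d \<le> b" using assms(2)[of b] assms(1) cd by (meson less_irrefl less_imp_le not_le order_trans)
  qed
qed

theorem theorem5p6:
  fixes \<epsilon>\<^sub>0 :: real
    and b d :: "'n::{finite,linorder} config \<Rightarrow> real"
    and z :: "'n config \<Rightarrow> real \<Rightarrow> 'n cochain"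
    and \<epsilon> B D P L :: "'n config \<Rightarrow> real"
  assumes n: "CARD('n) \<ge> 3"
    and \<epsilon>\<^sub>0: "0 < \<epsilon>\<^sub>0" "\<epsilon>\<^sub>0 < 1"
    and bar: "\<And>X. has_bar X \<Longrightarrow> most_persistent_bar X (b X) (d X) (z X)"
    and \<epsilon>: "\<And>X. \<epsilon> X = \<epsilon>\<^sub>0 * (d X - b X)"
    and B: "\<And>X. B X = (if has_bar X then birth_content X (\<epsilon> X) (b X) (z X) else 0)"
    and D: "\<And>X. D X = (if has_bar X then relaxed_death_content X (\<epsilon> X) (d X) (z X) else 0)"
    and P_nonneg: "\<And>X. P X \<ge> 0"
    and P_differentiable: "\<And>X. P differentiable (at X)"
    and P_isometry: "\<And>T X. orthogonal_transformation (T :: real ^ 2 \<Rightarrow> real ^ 2) \<Longrightarrow>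
           P (\<chi> i. T (X $ i)) = P X"
    and P_relabel: "\<And>\<pi> X. bij (\<pi> :: 'n \<Rightarrow> 'n) \<Longrightarrow> P (\<chi> i. X $ \<pi> i) = P X"
    and P_infinity: "\<And>X. X \<noteq> 0 \<Longrightarrow>
           filterlim (\<lambda>t\<^sub>0. deriv (\<lambda>t. P (t *\<^sub>R X)) t\<^sub>0) at_top at_top"
    and P_zero: "\<And>X. X \<noteq> 0 \<Longrightarrow>
           ((\<lambda>t\<^sub>0. deriv (\<lambda>t. P (t *\<^sub>R X)) t\<^sub>0) \<longlongrightarrow> 0) (at_right 0)"
    and L: "\<And>X. L X = - (D X - B X) + P X"
  shows "\<exists>X. regular_polygon X \<and>
           (has_bar X \<and> generic X (\<epsilon> X) (b X) (d X) \<longrightarrow>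
            (L has_derivative (\<lambda>_. 0)) (at X))"
proof (cases "has_bar (polygon 1 :: 'n config)")
  \<comment> \<open>Without a bar, as for the equilateral triangle, the required implication is
    vacuous at the unit polygon.\<close>
  case False
  then show ?thesis using regular_polygon_polygon[OF n, of 1] by (intro exI[of _ "polygon 1"]) simp
next
  case True
  define X1 :: "'n config" where "X1 = polygon 1"
  define b1 d1 \<epsilon>1 where "b1 = b X1" and "d1 = d X1" and "\<epsilon>1 = \<epsilon> X1"
  note props = most_persistent_bar_step_ordered[OF n _ bar]
  have so: "step_ordered (polygon r :: 'n config)" if "0 < r" for r
    using that by (rule step_ordered_polygon)
  have bd1: "b1 < d1" and NT1: "\<And>t. nontrivial_H1 (VR X1 t) \<longleftrightarrow> b1 \<le> t \<and> t < d1"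
    using props(1,2)[OF so[of 1] True] by (simp_all add: b1_def d1_def X1_def)
  have b1: "b1 = polygon_scale X1"
  proof -
    have "nontrivial_H1 (VR X1 b1)" using NT1 bd1 by blast
    moreover have "step_ordered X1" unfolding X1_def by (rule so) simp
    ultimately obtain d' where "\<And>t. nontrivial_H1 (VR X1 t) \<longleftrightarrow> polygon_scale X1 \<le> t \<and> t < d'"
      using nontrivial_H1_interval[OF n] by blast
    then show ?thesis using half_open_interval_eq(1)[OF bd1] NT1 by metis
  qed
  have \<epsilon>1: "0 < \<epsilon>1" "\<epsilon>1 < d1 - b1"
    using \<epsilon>\<^sub>0 bd1 by (simp_all add: \<epsilon>1_def \<epsilon> b1_def d1_def)
  \<comment> \<open>Taken at the unit polygon, these complexes serve every radius by scaling, so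
    that \<kappa> is fixed before the radius is chosen.\<close>
  define Lb Kd Ld where "Lb = VR X1 (b1 + \<epsilon>1)" and "Kd = VR X1 (d1 - \<epsilon>1)" and "Ld = VR X1 (d1 + \<epsilon>1)"
  have reg: "regular_complex (VR X1 t)" if "b1 \<le> t" for t
    using that unfolding b1 X1_def by (intro regular_complex_polygon) simp_all
  have small: "small_steps (VR X1 t)" if "b1 \<le> t" "t < d1" for t
    using nontrivial_H1_regular_iff[OF n reg[OF that(1)]] NT1[of t] that by blast
  have Lb: "regular_complex Lb" "small_steps Lb" and Kd: "regular_complex Kd" "small_steps Kd"
    and Ld: "regular_complex Ld"
    unfolding Lb_def Kd_def Ld_def using \<epsilon>1 by (auto intro!: reg small)
  have KL: "Kd \<subseteq> Ld" unfolding Kd_def Ld_def using \<epsilon>1 by (intro VR_mono) simp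
  have no_edge: "{u, v} \<notin> VR X1 (b1 - \<epsilon>1)" if "u \<noteq> v" for u v
  proof -
    have "1 \<le> cdist u v" using that cdist_ge_0[of u v] cdist_eq_0_iff[of u v] by linarith
    then have "chord i (rot i) \<le> chord u v" for i :: 'n unfolding chord_le_iff cdist_rot[OF n] .
    then have "b1 \<le> chord u v" unfolding b1 polygon_scale_le_iff by (simp add: X1_def dist_polygon)
    then show ?thesis using \<epsilon>1 by (simp add: X1_def dist_polygon)
  qed
  define \<kappa> where "\<kappa> = death_value Kd Ld X1 - birth_value Lb X1"
  have \<kappa>: "0 < \<kappa>"
    using death_value_gt_birth_value[OF n NT1[unfolded X1_def] b1[unfolded X1_def] \<epsilon>1]
    by (simp add: \<kappa>_def Lb_def Kd_def Ld_def X1_def)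
  define g where "g t = P (t *\<^sub>R X1)" for t
  have "X1 \<noteq> 0"
  proof
    assume "X1 = 0"
    then have "polygon_scale X1 = 0" by (simp add: polygon_scale_def)
    moreover have "0 < 2 * sin (pi / CARD('n))" using n by (intro mult_pos_pos sin_gt_zero) (simp_all add: field_simps)
    ultimately show False using polygon_scale_polygon[OF n, of 1] by (simp add: X1_def)
  qed
  have scale: "((\<lambda>t. t *\<^sub>R X1) has_derivative (\<lambda>h. h *\<^sub>R X1)) (at t)" for t
    by (auto intro!: derivative_eq_intros)
  have "g differentiable (at t)" for t
    using differentiable_chain_at[OF differentiableI[OF scale[of t]] P_differentiable]
    by (simp add: g_def[abs_def] o_def)
  then obtain r where r: "0 < r" "deriv g r = \<kappa>"
    using derivative_attains_value[of g \<kappa>] \<kappa> P_zero[OF \<open>X1 \<noteq> 0\<close>] P_infinity[OF \<open>X1 \<noteq> 0\<close>]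
    unfolding g_def by blast
  define X0 :: "'n config" where "X0 = polygon r"
  have X0: "X0 = r *\<^sub>R X1" using polygon_scaleR[of r 1] by (simp add: X0_def X1_def)
  have VR0: "VR X0 (r * t) = VR X1 t" for t
    by (rule VR_eqI) (use r in \<open>simp add: X0_def X1_def dist_polygon\<close>)
  have "(L has_derivative (\<lambda>_. 0)) (at X0)" if hb: "has_bar X0" and gen: "generic X0 (\<epsilon> X0) (b X0) (d X0)"
  proof -
    have so0: "step_ordered X0" unfolding X0_def by (rule so[OF r(1)])
    have "b1 \<le> t \<and> t < d1 \<longleftrightarrow> b X0 / r \<le> t \<and> t < d X0 / r" for t
      using props(2)[OF so0 hb, of "r * t"] NT1[of t] r(1)
      unfolding VR0 by (simp add: field_simps)
    from half_open_interval_eq[OF bd1 this] have bd0: "b X0 = r * b1" "d X0 = r * d1"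
      using r(1) by (simp_all add: field_simps)
    have \<epsilon>0: "\<epsilon> X0 = r * \<epsilon>1"
      by (simp add: \<epsilon> bd0 \<epsilon>1_def algebra_simps flip: b1_def d1_def)
    have cont: "\<forall>\<^sub>F X in nhds X0. has_bar X" "(b \<longlongrightarrow> b X0) (nhds X0)" "(d \<longlongrightarrow> d X0) (nhds X0)"
      by (rule bar_continuous[OF n so0 hb, of b d z], erule bar)+
    have \<epsilon>_cont: "(\<epsilon> \<longlongrightarrow> \<epsilon> X0) (nhds X0)"
      unfolding \<epsilon> by (intro tendsto_intros cont)
    have ne: "dist (X0 $ u) (X0 $ v) \<noteq> t"
      if "t \<in> {b X0 - \<epsilon> X0, b X0 + \<epsilon> X0, d X0 - \<epsilon> X0, d X0 + \<epsilon> X0}" for u v t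
    proof -
      have "diam X0 {u, v} \<in> diam X0 ` {\<sigma>. \<sigma> \<noteq> {}}" by blast
      then show ?thesis using gen that unfolding generic_def diam_pair by blast
    qed
    have ev1: "\<forall>\<^sub>F X in nhds X0. VR X (b X - \<epsilon> X) = VR X1 (b1 - \<epsilon>1)"
      using eventually_VR_eq[OF tendsto_diff[OF cont(2) \<epsilon>_cont] ne] VR0[of "b1 - \<epsilon>1"]
      by (simp add: bd0 \<epsilon>0 algebra_simps)
    have ev2: "\<forall>\<^sub>F X in nhds X0. VR X (b X + \<epsilon> X) = Lb"
      using eventually_VR_eq[OF tendsto_add[OF cont(2) \<epsilon>_cont] ne] VR0[of "b1 + \<epsilon>1"]
      by (simp add: Lb_def bd0 \<epsilon>0 algebra_simps)
    have ev3: "\<forall>\<^sub>F X in nhds X0. VR X (d X - \<epsilon> X) = Kd"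
      using eventually_VR_eq[OF tendsto_diff[OF cont(3) \<epsilon>_cont] ne] VR0[of "d1 - \<epsilon>1"]
      by (simp add: Kd_def bd0 \<epsilon>0 algebra_simps)
    have ev4: "\<forall>\<^sub>F X in nhds X0. VR X (d X + \<epsilon> X) = Ld"
      using eventually_VR_eq[OF tendsto_add[OF cont(3) \<epsilon>_cont] ne] VR0[of "d1 + \<epsilon>1"]
      by (simp add: Ld_def bd0 \<epsilon>0 algebra_simps)
    \<comment> \<open>With the complexes frozen, \<open>G\<close> is differentiable at
      \<open>X0\<close> and invariant under the symmetries on all configurations; \<open>L\<close>
      is compared with it only near \<open>X0\<close>.\<close>
    define G where "G X = - (death_value Kd Ld X - birth_value Lb X) + P X" for X
    have ev: "\<forall>\<^sub>F X in nhds X0. G X = L X"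
      using eventually_step_ordered[OF so0] cont(1) ev1 ev2 ev3 ev4
    proof eventually_elim
      case (elim X)
      have bd: "b X < d X" using props(1)[OF elim(1,2)] .
      have e: "0 < \<epsilon> X" "\<epsilon> X < d X - b X" using \<epsilon>\<^sub>0 bd by (simp_all add: \<epsilon>)
      have zb: "z X (b X + \<epsilon> X) \<in> cocycles Lb 1" "z X (b X + \<epsilon> X) \<notin> coboundaries Lb 1"
        using props(3)[OF elim(1,2), of "b X + \<epsilon> X"] e by (simp_all add: elim(4) del: One_nat_def)
      have zd: "z X (d X - \<epsilon> X) \<in> cocycles Kd 1" "z X (d X - \<epsilon> X) \<notin> coboundaries Kd 1"
        using props(3)[OF elim(1,2), of "d X - \<epsilon> X"] e by (simp_all add: elim(5) del: One_nat_def)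
      have hb: "hol (z X (b X + \<epsilon> X)) \<noteq> 0" and hd: "hol (z X (d X - \<epsilon> X)) \<noteq> 0"
        using coboundary_iff_hol[OF n regular_imp_cyclic] Lb(1) Kd(1) zb zd by blast+
      have "birth_content X (\<epsilon> X) (b X) (z X) = birth_value Lb X"
      proof (rule content_eq_value)
        show "birth_cochain (VR X (b X - \<epsilon> X)) Lb 1 (z X (b X + \<epsilon> X))
            = (hol (z X (b X + \<epsilon> X)) / CARD('n)) *\<^sub>R step_cochain Lb"
          unfolding elim(3) by (rule birth_cochain_regular[OF n Lb no_edge zb(1)])
      qed (use hb elim(4) in auto)
      moreover have "relaxed_death_content X (\<epsilon> X) (d X) (z X) = death_value Kd Ld X"
      proof (rule death_content_eq_value)
        show "death_cochain Kd Ld 1 (z X (d X - \<epsilon> X))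
            = (hol (z X (d X - \<epsilon> X)) / CARD('n)) *\<^sub>R death_cochain Kd Ld 1 (step_cochain Kd)"
          using Ld by (intro death_cochain_regular[OF n Kd KL _ zd(1) hd]) (simp add: regular_complex_def)
      qed (use hd elim(5,6) in auto)
      ultimately show "G X = L X" using elim(2) by (simp add: G_def L B D)
    qed
    have inj: "X0 $ u \<noteq> X0 $ v" if "u \<noteq> v" for u v
    proof -
      have "cdist u u < cdist u v" using that cdist_ge_0[of u v] cdist_eq_0_iff[of u v] by (simp add: less_le)
      then have "dist (X0 $ u) (X0 $ u) < dist (X0 $ u) (X0 $ v)"
        using so0 unfolding step_ordered_def by blast
      then show ?thesis by auto
    qed
    have "(\<lambda>X. - (death_value Kd Ld X - birth_value Lb X) + P X) differentiable (at X0)"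
      by (intro differentiable_add differentiable_minus differentiable_diff value_differentiable inj P_differentiable)
    then obtain G' where G': "(G has_derivative G') (at X0)"
      unfolding differentiable_def G_def by blast
    have "G' X1 = 0"
    proof -
      have "(G has_derivative G') (at (r *\<^sub>R X1))" using G' by (simp add: X0)
      from diff_chain_at[OF scale this]
      have "((\<lambda>t. G (t *\<^sub>R X1)) has_derivative (\<lambda>h. G' (h *\<^sub>R X1))) (at r)" by (simp add: o_def)
      then have 1: "((\<lambda>t. G (t *\<^sub>R X1)) has_real_derivative G' X1) (at r)"
        using linear_scale[OF has_derivative_linear[OF G']]
        by (simp add: has_field_derivative_def mult.commute[of "G' X1"] mult_commute_abs)
      have "(g has_real_derivative \<kappa>) (at r)"
        using \<open>\<And>t. g differentiable (at t)\<close> r(2) DERIV_deriv_iff_real_differentiable by metis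
      then have 2: "((\<lambda>t. - (t * \<kappa>) + g t) has_real_derivative 0) (at r)"
        by (auto intro!: derivative_eq_intros)
      \<comment> \<open>Lengths scale linearly only under nonnegative factors, hence the restriction
        to \<open>0 < t\<close>, which holds near \<open>r\<close>.\<close>
      have "\<forall>\<^sub>F t in nhds r. - (t * \<kappa>) + g t = G (t *\<^sub>R X1)"
      proof (rule eventually_mono)
        show "\<forall>\<^sub>F t in nhds r. 0 < t" using r(1) by (rule order_tendstoD(1)[OF filterlim_ident])
        fix t :: real assume "0 < t"
        then show "- (t * \<kappa>) + g t = G (t *\<^sub>R X1)"
          by (simp add: G_def g_def \<kappa>_def value_scaleR algebra_simps)
      qed
      then have "((\<lambda>t. G (t *\<^sub>R X1)) has_real_derivative 0) (at r)"
        using 2 by (subst (asm) DERIV_cong_ev[OF refl _ refl]) auto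
      then show ?thesis using 1 DERIV_unique by blast
    qed
    then have radial: "G' (polygon r) = 0"
      using linear_scale[OF has_derivative_linear[OF G'], of r X1] X0 by (simp add: X0_def)
    \<comment> \<open>An isometry that preserves the polygon may still permute its labelled vertices
      and fixes \<open>X0\<close> only together with a relabelling; therefore both invariances of
      the penalty enter.\<close>
    have inv: "G (\<chi> i. T (X $ \<pi> i)) = G X"
      if T: "orthogonal_transformation T" and \<pi>: "bij \<pi>" and cd: "\<And>u v. cdist (\<pi> u) (\<pi> v) = cdist u v"
        and s: "\<And>u v. sstep (\<pi> u) (\<pi> v) = s * sstep u v" "s * s = 1"
      for T :: "real ^ 2 \<Rightarrow> real ^ 2" and \<pi> :: "'n \<Rightarrow> 'n" and s X
    proof -
      have "P (\<chi> i. T (X $ \<pi> i)) = P X"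
        using P_isometry[OF T, of "\<chi> i. X $ \<pi> i"] P_relabel[OF \<pi>, of X] by simp
      then show ?thesis
        using value_transform(2)[OF T \<pi> cd s Kd(1) Ld KL] value_transform(1)[OF T \<pi> cd s Lb(1) Lb(1) order_refl]
        by (simp add: G_def)
    qed
    have "G' = (\<lambda>_. 0)"
    proof (rule symmetric_derivative_zero[where G = G and r = r])
      show "0 < r" "G' (polygon r) = 0" by (fact r(1) radial)+
      show "(G has_derivative G') (at (polygon r))" using G' by (simp add: X0_def)
      show "G (\<chi> i. rotation (2 * pi / CARD('n)) (X $ rot i)) = G X" for X
        by (rule inv[OF orthogonal_rotation bij_rot, of 1]) simp_all
      show "G (\<chi> i. reflection (X $ flip i)) = G X" for X
        by (rule inv[OF orthogonal_reflection bij_flip, of "- 1"]) simp_all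
    qed
    then have "(G has_derivative (\<lambda>_. 0)) (at X0)" using G' by simp
    then show ?thesis
      by (rule has_derivative_transform_eventually)
        (use ev in \<open>auto simp: eventually_nhds_conv_at intro: eventually_at_filter[THEN iffD2]\<close>)
  qed
  then show ?thesis using regular_polygon_polygon[OF n r(1)] unfolding X0_def by blast
qed

end
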